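(* Let $(X,\|\cdot\|)$ be a Hilbert space, and let $\mathbf L_0:\mathcal D(\mathbf L_0)\subseteq X\to X$ be a closed linear operator that generates a strongly continuous semigroup $(\mathbf S_0(\tau))_{\tau\ge0}\subseteq\mathcal B(X)$ for which $$\|\mathbf S_0(\tau)\mathbf u\|\le Me^{\omega_0\tau}\|\mathbf u\|$$ for some $M>0$, $\omega_0\in\mathbb R$ and for all $\mathbf u\in X$, $\tau\ge0$. Furthermore, let $\mathbf L':X\to X$ be a compact operator. Then the operator $$\mathbf L:=\mathbf L_0+\mathbf L':\mathcal D(\mathbf L):=\mathcal D(\mathbf L_0)\subseteq X\to X$$ generates a strongly continuous semigroup $(\mathbf S(\tau))_{\tau\ge0}\subseteq\mathcal B(X)$, for which, given any $\varepsilon>0$, the following statements hold. i) The set $S_\varepsilon:=\sigma(\mathbf L)\cap\{\lambda\in\mathbb C:\operatorname{Re}\lambda\ge\omega_0+\varepsilon\}$ consists of finitely many eigenvalues of $\mathbf L$, all of which have finite algebraic multiplicity. ii) The spectral mapping $$\sigma(\mathbf S(\tau))\setminus\mathbb D_{e^{\tau(\omega_0+\varepsilon)}}=\{e^{\tau\lambda}:\lambda\in S_\varepsilon\}$$ holds for all $\tau>0$, where $\mathbb D_r$ stands for the open disk of radius $r$ in $\mathbb C$ centered at zero. iii) Let $\mathbf P:=\sum_{\lambda\in S_\varepsilon}\mathbf P_\lambda$, and let $r_\varepsilon:=\sup\{\operatorname{Re}\lambda:\lambda\in\sigma(\mathbf L)\setminus S_\varepsilon\}$. Then for every $\omega>\max\{\omega_0,r_\varepsilon\}$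 there exists $C\ge1$ such that $$\|\mathbf S(\tau)(1-\mathbf P)\mathbf u\|\le Ce^{\omega\tau}\|(1-\mathbf P)\mathbf u\|$$ for all $\mathbf u\in X$ and $\tau\ge0$.
   Context: $X$ is a complex Hilbert space and $\mathcal B(X)$ is the set of bounded linear operators on $X$. $\sigma(\cdot)$ denotes the spectrum. For an isolated spectral point $\lambda_0$ of a closed linear operator $\mathbf L$ on $X$, the Riesz projection $\mathbf P_{\lambda_0}\in\mathcal B(X)$ is $$\mathbf P_{\lambda_0}:=\frac1{2\pi i}\int_\gamma(\lambda-\mathbf L)^{-1}\,d\lambda,$$ where $\gamma$ is a positively oriented circle centered at $\lambda_0$, contained in the resolvent set of $\mathbf L$, and whose interior contains no spectral point of $\mathbf L$ other than $\lambda_0$. The algebraic multiplicity of $\lambda_0$ is the dimension of the range of $\mathbf P_{\lambda_0}$. By convention $\sup\emptyset=-\infty$. *)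

theory Defs
  imports "HOL-Complex_Analysis.Complex_Analysis"
begin

section \<open>Complex Hilbert spaces\<close>

class complex_vector = real_vector +
  fixes scaleC :: "complex \<Rightarrow> 'a \<Rightarrow> 'a"  (infixr "*\<^sub>C" 75)
  assumes scaleC_add_right: "a *\<^sub>C (x + y) = a *\<^sub>C x + a *\<^sub>C y"
    and scaleC_add_left: "(a + b) *\<^sub>C x = a *\<^sub>C x + b *\<^sub>C x"
    and scaleC_scaleC: "a *\<^sub>C b *\<^sub>C x = (a * b) *\<^sub>C x"
    and scaleC_one: "1 *\<^sub>C x = x"
    and scaleR_scaleC: "r *\<^sub>R x = complex_of_real r *\<^sub>C x"

interpretation complex_vector: vector_space "scaleC :: complex \<Rightarrow> 'a \<Rightarrow> 'a::complex_vector"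
  by unfold_locales (simp_all add: scaleC_add_right scaleC_add_left scaleC_scaleC scaleC_one)

abbreviation clinear :: "('a::complex_vector \<Rightarrow> 'b::complex_vector) \<Rightarrow> bool"
  where "clinear \<equiv> Vector_Spaces.linear scaleC scaleC"

definition cdim :: "'a::complex_vector set \<Rightarrow> enat"
  where "cdim V = (if \<exists>B. finite B \<and> complex_vector.span B = V
                   then enat (complex_vector.dim V) else \<infinity>)"

class complex_normed_vector = complex_vector + real_normed_vector +
  assumes norm_scaleC: "norm (a *\<^sub>C x) = norm a * norm x"

class complex_inner = complex_normed_vector +
  fixes cinner :: "'a \<Rightarrow> 'a \<Rightarrow> complex"
  assumes cinner_add_left: "cinner (x + y) z = cinner x z + cinner y z"
    and cinner_scaleC_left: "cinner (a *\<^sub>C x) y = a * cinner x y"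
    and cinner_commute: "cinner x y = cnj (cinner y x)"
    and cinner_self: "cinner x x = complex_of_real ((norm x)\<^sup>2)"

class chilbert_space = complex_inner + complete_space

text \<open>The library's sort of complete normed spaces is needed to integrate operator-valued functions.\<close>

subclass (in chilbert_space) banach ..

text \<open>A complex Banach space structure on bounded operators. The elements of \<open>'a \<Rightarrow>\<^sub>L 'b\<close> are
  merely real-linear; bounded complex-linear operators are those which in addition satisfy
  \<^const>\<open>clinear\<close>.\<close>

instantiation blinfun :: (real_normed_vector, complex_normed_vector) complex_normed_vector
begin

lift_definition scaleC_blinfun :: "complex \<Rightarrow> 'a \<Rightarrow>\<^sub>L 'b \<Rightarrow> 'a \<Rightarrow>\<^sub>L 'b"
  is "\<lambda>c f x. c *\<^sub>C f x"
proof -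
  fix c :: complex and f :: "'a \<Rightarrow> 'b"
  assume f: "bounded_linear f"
  have "norm (c *\<^sub>C f x) \<le> norm x * (norm c * onorm f)" for x
    using mult_left_mono[OF onorm[OF f, of x], of "norm c"] by (simp add: norm_scaleC ac_simps)
  then show "bounded_linear (\<lambda>x. c *\<^sub>C f x)"
    by (intro bounded_linear_intro[where K = "norm c * onorm f"])
      (simp_all add: linear_simps[OF f] scaleC_add_right scaleR_scaleC scaleC_scaleC ac_simps)
qed

instance
proof
  fix a b :: complex and r :: real and f g :: "'a \<Rightarrow>\<^sub>L 'b"
  show "a *\<^sub>C (f + g) = a *\<^sub>C f + a *\<^sub>C g"
    by transfer (simp add: scaleC_add_right)
  show "(a + b) *\<^sub>C f = a *\<^sub>C f + b *\<^sub>C f"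
    by transfer (simp add: scaleC_add_left)
  show "a *\<^sub>C b *\<^sub>C f = (a * b) *\<^sub>C f"
    by transfer (simp add: scaleC_scaleC)
  show "1 *\<^sub>C f = f"
    by transfer (simp add: scaleC_one)
  show "r *\<^sub>R f = complex_of_real r *\<^sub>C f"
    by transfer (simp add: scaleR_scaleC)
  have le: "norm (c *\<^sub>C h) \<le> norm c * norm h" for c :: complex and h :: "'a \<Rightarrow>\<^sub>L 'b"
    by (rule norm_blinfun_bound)
      (simp_all add: scaleC_blinfun.rep_eq norm_scaleC mult.assoc mult_left_mono norm_blinfun)
  show "norm (a *\<^sub>C f) = norm a * norm f"
  proof (cases "a = 0")
    case True
    then show ?thesis using le[of a f] by simp
  next
    case False
    have "f = inverse a *\<^sub>C a *\<^sub>C f"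
      using False by transfer (simp add: scaleC_scaleC scaleC_one)
    then have "norm f \<le> norm (inverse a) * norm (a *\<^sub>C f)"
      using le[of "inverse a" "a *\<^sub>C f"] by simp
    then have "norm a * norm f \<le> norm a * (norm (inverse a) * norm (a *\<^sub>C f))"
      by (simp add: mult_left_mono)
    also have "\<dots> = norm (a *\<^sub>C f)"
      using False by (simp add: norm_inverse)
    finally have "norm a * norm f \<le> norm (a *\<^sub>C f)" .
    then show ?thesis using le[of a f] by simp
  qed
qed

end

instantiation complex :: chilbert_space
begin
definition "scaleC_complex = (\<lambda>(a::complex) x. a * x)"
definition "cinner_complex = (\<lambda>(x::complex) y. x * cnj y)"
instance
  by standard (simp_all add: scaleC_complex_def cinner_complex_def algebra_simps norm_mult
      scaleR_conv_of_real flip: complex_norm_square)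
end

section \<open>Unbounded operators and semigroups\<close>

text \<open>An operator \<open>D \<subseteq> X \<rightarrow> X\<close> is given by its domain and a function whose values
  outside of the domain are irrelevant.\<close>

definition linear_operator :: "'a::complex_vector set \<Rightarrow> ('a \<Rightarrow> 'a) \<Rightarrow> bool" where
  "linear_operator D A \<longleftrightarrow> complex_vector.subspace D \<and>
     (\<forall>u\<in>D. \<forall>v\<in>D. A (u + v) = A u + A v) \<and>
     (\<forall>u\<in>D. \<forall>c. A (c *\<^sub>C u) = c *\<^sub>C A u)"

definition closed_operator :: "'a::complex_normed_vector set \<Rightarrow> ('a \<Rightarrow> 'a) \<Rightarrow> bool" where
  "closed_operator D A \<longleftrightarrow> linear_operator D A \<and> closed ((\<lambda>u. (u, A u)) ` D)"

definition compact_operator :: "('a::complex_normed_vector \<Rightarrow> 'a) \<Rightarrow> bool" where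
  "compact_operator T \<longleftrightarrow> clinear T \<and> (\<forall>B. bounded B \<longrightarrow> compact (closure (T ` B)))"

text \<open>Only the values of \<open>S\<close> at nonnegative times are relevant.\<close>

definition strongly_continuous_semigroup :: "(real \<Rightarrow> 'a::complex_normed_vector \<Rightarrow>\<^sub>L 'a) \<Rightarrow> bool" where
  "strongly_continuous_semigroup S \<longleftrightarrow>
     (\<forall>t\<ge>0. clinear (blinfun_apply (S t))) \<and>
     S 0 = id_blinfun \<and>
     (\<forall>s\<ge>0. \<forall>t\<ge>0. S (s + t) = S s o\<^sub>L S t) \<and>
     (\<forall>u. continuous_on {0..} (\<lambda>t. S t u))"

text \<open>\<open>(D, A)\<close> is the infinitesimal generator of \<open>S\<close>, with \<open>D\<close> being the full set of vectors for
  which the derivative at zero exists.\<close>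

definition generates ::
    "'a::complex_normed_vector set \<Rightarrow> ('a \<Rightarrow> 'a) \<Rightarrow> (real \<Rightarrow> 'a \<Rightarrow>\<^sub>L 'a) \<Rightarrow> bool" where
  "generates D A S \<longleftrightarrow> strongly_continuous_semigroup S \<and>
     (\<forall>u v. ((\<lambda>h. (S h u - u) /\<^sub>R h) \<longlongrightarrow> v) (at_right 0) \<longleftrightarrow> u \<in> D \<and> A u = v)"

section \<open>Spectrum and Riesz projections\<close>

definition resolvent_set :: "'a::complex_normed_vector set \<Rightarrow> ('a \<Rightarrow> 'a) \<Rightarrow> complex set" where
  "resolvent_set D A = {z. bij_betw (\<lambda>u. z *\<^sub>C u - A u) D UNIV \<and>
     bounded_linear (inv_into D (\<lambda>u. z *\<^sub>C u - A u))}"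

definition spectrum :: "'a::complex_normed_vector set \<Rightarrow> ('a \<Rightarrow> 'a) \<Rightarrow> complex set" where
  "spectrum D A = - resolvent_set D A"

definition resolvent :: "'a::complex_normed_vector set \<Rightarrow> ('a \<Rightarrow> 'a) \<Rightarrow> complex \<Rightarrow> 'a \<Rightarrow>\<^sub>L 'a" where
  "resolvent D A z = Blinfun (inv_into D (\<lambda>u. z *\<^sub>C u - A u))"

definition eigenvalue :: "'a::complex_vector set \<Rightarrow> ('a \<Rightarrow> 'a) \<Rightarrow> complex \<Rightarrow> bool" where
  "eigenvalue D A z \<longleftrightarrow> (\<exists>u\<in>D. u \<noteq> 0 \<and> A u = z *\<^sub>C u)"

text \<open>The library's \<^const>\<open>contour_integral\<close> is restricted to complex-valued integrands; this is
  the same integral for vector-valued ones.\<close>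

definition vector_contour_integral ::
    "(real \<Rightarrow> complex) \<Rightarrow> (complex \<Rightarrow> 'b::complex_normed_vector) \<Rightarrow> 'b" where
  "vector_contour_integral g F =
     integral {0..1} (\<lambda>t. vector_derivative g (at t within {0..1}) *\<^sub>C F (g t))"

definition riesz_radius ::
    "'a::complex_normed_vector set \<Rightarrow> ('a \<Rightarrow> 'a) \<Rightarrow> complex \<Rightarrow> real \<Rightarrow> bool" where
  "riesz_radius D A z r \<longleftrightarrow> r > 0 \<and> sphere z r \<subseteq> resolvent_set D A \<and>
     ball z r \<inter> spectrum D A \<subseteq> {z}"

text \<open>Meaningful at isolated spectral points of closed operators. There an admissible radius exists
  and, the resolvent being holomorphic, the integral is the same for all of them.\<close>

definition riesz_projection ::
    "'a::complex_normed_vector set \<Rightarrow> ('a \<Rightarrow> 'a) \<Rightarrow> complex \<Rightarrow> 'a \<Rightarrow>\<^sub>L 'a" where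
  "riesz_projection D A z = (1 / (2 * of_real pi * \<i>)) *\<^sub>C
     vector_contour_integral (circlepath z (SOME r. riesz_radius D A z r)) (resolvent D A)"

definition algebraic_multiplicity ::
    "'a::complex_normed_vector set \<Rightarrow> ('a \<Rightarrow> 'a) \<Rightarrow> complex \<Rightarrow> enat" where
  "algebraic_multiplicity D A z = cdim (range (blinfun_apply (riesz_projection D A z)))"

end

theory Submission
  imports Defs
begin

text \<open>The perturbed semigroup solves \<open>S(t)u = S\<^sub>0(t)u + \<integral>\<^sub>0\<^sup>t S\<^sub>0(t - s) L' S(s)u ds\<close>, and since \<open>L'\<close> is compact
  so is \<open>S(t) - S\<^sub>0(t)\<close>. By the Fredholm alternative the spectrum of \<open>S(t)\<close> outside the disc of radius
  \<open>e\<close> to the power \<open>\<omega>\<^sub>0 t\<close> consists of eigenvalues, and the Fourier coefficients of the periodic orbits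
  \<open>e\<^sup>-\<^sup>\<lambda>\<^sup>s S(s)u\<close> turn their eigenvectors into eigenvectors of \<open>L\<close>; this is the spectral mapping.
  Orthonormalised eigenvectors of \<open>L\<close> show the eigenvalues as diagonal entries of \<open>S(t)\<close>, of which
  Bessel's inequality permits only finitely many large ones, whence finiteness (and isolation) without
  analytic Fredholm theory. The Riesz projections are compact because \<open>R = R\<^sub>0 + R L' R\<^sub>0\<close> with
  \<open>R\<^sub>0\<close> holomorphic. Finally \<open>S(1)(1 - P)\<close> is again a compact perturbation of \<open>S\<^sub>0(1)\<close>, and any
  eigenvalue of modulus at least \<open>e\<^sup>\<omega>\<close> would yield an eigenvector of \<open>L\<close> that \<open>P\<close> both fixes and
  annihilates; so its spectral radius is below \<open>e\<^sup>\<omega>\<close>, which bounds its powers.\<close>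

subsection \<open>Inner product and scalar multiplication\<close>

text \<open>Compactness is used as approximability by finite-rank operators, which in a Hilbert
  space is the same class. This form passes at once through compositions, norm limits and contour
  integrals, and the approximant can be taken as \<open>oproj E o\<^sub>L T\<close>; that one fact
  drives the Fredholm alternative, the Bessel count and the finite multiplicities. Two obstacles
  shape the argument. For a general strongly continuous semigroup the spectrum of S(t) may exceed
  the exponentials of the spectrum of its generator; eigenvalues, however, are carried over in both
  directions, so each spectral point concerned is first shown to be an eigenvalue. And
  \<open>M\<close> may exceed 1, so the norm at a single time does not confine the spectrum of the
  unperturbed semigroup to the right disc: Neumann series run on bounds \<open>M * q ^ n\<close> for
  powers, and eigenvalues are counted at a time so late that exp(\<epsilon> t) beats 4 M.
  Vector-valued holomorphy is tested on scalar entries of the resolvent. Entries of Riesz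
  projections are then residues, which removes the arbitrary radius from their definition and
  reduces their algebra to residue calculus.\<close>

lemma bounded_bilinear_scaleC:
  "bounded_bilinear (scaleC :: complex \<Rightarrow> 'a \<Rightarrow> 'a::complex_normed_vector)"
proof (rule bounded_bilinear.intro)
  show "(r *\<^sub>R a) *\<^sub>C (b::'a) = r *\<^sub>R a *\<^sub>C b" for r a b
    by (simp add: scaleR_conv_of_real[of r a] scaleR_scaleC[of r "a *\<^sub>C b"] scaleC_scaleC)
  show "a *\<^sub>C r *\<^sub>R (b::'a) = r *\<^sub>R a *\<^sub>C b" for r a b
    by (simp add: scaleR_scaleC scaleC_scaleC mult.commute)
qed (auto simp: scaleC_add_left scaleC_add_right norm_scaleC intro!: exI[of _ 1])

interpretation scaleC: bounded_bilinear "scaleC :: complex \<Rightarrow> 'a \<Rightarrow> 'a::complex_normed_vector"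
  by (rule bounded_bilinear_scaleC)

lemmas scaleC_simps = scaleC_add_left scaleC_add_right scaleC_scaleC scaleC_one
  complex_vector.scale_zero_left complex_vector.scale_zero_right
  complex_vector.scale_left_diff_distrib complex_vector.scale_right_diff_distrib
  complex_vector.scale_minus_left complex_vector.scale_minus_right

lemma cinner_add_right: "cinner (x::'a::complex_inner) (y + z) = cinner x y + cinner x z"
  by (metis cinner_add_left cinner_commute complex_cnj_add)

lemma cinner_scaleC_right: "cinner (x::'a::complex_inner) (c *\<^sub>C y) = cnj c * cinner x y"
  by (metis cinner_scaleC_left cinner_commute complex_cnj_mult)

lemma cinner_zero_left [simp]: "cinner 0 (y::'a::complex_inner) = 0"
  using cinner_add_left[of 0 0 y] by simp

lemma cinner_zero_right [simp]: "cinner (y::'a::complex_inner) 0 = 0"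
  using cinner_add_right[of y 0 0] by simp

lemma cinner_diff_left: "cinner (x - y) (z::'a::complex_inner) = cinner x z - cinner y z"
  using cinner_add_left[of "x - y" y z] by simp

lemma cinner_diff_right: "cinner (z::'a::complex_inner) (x - y) = cinner z x - cinner z y"
  using cinner_add_right[of z "x - y" y] by simp

lemma cinner_sum_left: "cinner (\<Sum>i\<in>I. f i) (z::'a::complex_inner) = (\<Sum>i\<in>I. cinner (f i) z)"
  by (induction I rule: infinite_finite_induct) (simp_all add: cinner_add_left)

lemma cinner_sum_right: "cinner (z::'a::complex_inner) (\<Sum>i\<in>I. f i) = (\<Sum>i\<in>I. cinner z (f i))"
  by (induction I rule: infinite_finite_induct) (simp_all add: cinner_add_right)

lemmas cinner_simps = cinner_add_left cinner_add_right cinner_diff_left cinner_diff_right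
  cinner_scaleC_left cinner_scaleC_right

lemma norm_eq_cinner: "(norm (x::'a::complex_inner))\<^sup>2 = Re (cinner x x)"
  by (simp add: cinner_self)

lemma cinner_swap_zero: "cinner (x::'a::complex_inner) y = 0 \<longleftrightarrow> cinner y x = 0"
  by (metis cinner_commute complex_cnj_zero)

lemma pythagoras:
  assumes "cinner (x::'a::complex_inner) y = 0"
  shows "(norm (x + y))\<^sup>2 = (norm x)\<^sup>2 + (norm y)\<^sup>2"
  using assms cinner_swap_zero[of x y] by (simp add: norm_eq_cinner cinner_simps)

lemma cauchy_schwarz: "norm (cinner (x::'a::complex_inner) y) \<le> norm x * norm y"
proof (cases "y = 0")
  case False
  define a where "a = cinner x y / of_real ((norm y)\<^sup>2)"
  have "cinner (x - a *\<^sub>C y) (a *\<^sub>C y) = 0"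
    using False by (simp add: a_def cinner_simps cinner_self)
  from pythagoras[OF this] have "(norm (a *\<^sub>C y))\<^sup>2 \<le> (norm x)\<^sup>2"
    by simp
  then have "norm (a *\<^sub>C y) \<le> norm x"
    by (simp add: power2_le_iff_abs_le)
  moreover have "norm (a *\<^sub>C y) = norm (cinner x y) / norm y"
    using False by (simp add: a_def norm_scaleC norm_divide norm_mult power2_eq_square)
  ultimately show ?thesis
    using False by (simp add: divide_le_eq)
qed simp

lemma bounded_bilinear_cinner:
  "bounded_bilinear (cinner :: 'a::complex_inner \<Rightarrow> 'a \<Rightarrow> complex)"
proof (rule bounded_bilinear.intro)
  show "cinner (r *\<^sub>R a) (b::'a) = r *\<^sub>R cinner a b" for r a b
    by (simp add: scaleR_scaleC[of r a] cinner_simps scaleR_conv_of_real)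
  show "cinner a (r *\<^sub>R (b::'a)) = r *\<^sub>R cinner a b" for r a b
    by (simp add: scaleR_scaleC[of r b] cinner_simps scaleR_conv_of_real)
qed (auto simp: cinner_simps cauchy_schwarz intro!: exI[of _ 1])

interpretation cinner: bounded_bilinear "cinner :: 'a::complex_inner \<Rightarrow> 'a \<Rightarrow> complex"
  by (rule bounded_bilinear_cinner)

lemma cinner_eqI:
  assumes "\<And>w. cinner (x::'a::complex_inner) w = cinner y w"
  shows "x = y"
proof -
  have "cinner (x - y) (x - y) = 0"
    using assms[of "x - y"] by (simp add: cinner_diff_left)
  then show ?thesis by (simp add: cinner_self)
qed

subsection \<open>Complex-linear bounded operators\<close>

text \<open>A blinfun is additive by its type, so complex homogeneity is all that is left of
  \<open>clinear\<close>.\<close>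

definition clin :: "('a::complex_normed_vector \<Rightarrow>\<^sub>L 'b::complex_normed_vector) \<Rightarrow> bool" where
  "clin T \<longleftrightarrow> (\<forall>c x. T (c *\<^sub>C x) = c *\<^sub>C T x)"

lemma clinD: "clin T \<Longrightarrow> blinfun_apply T (c *\<^sub>C x) = c *\<^sub>C T x"
  by (simp add: clin_def)

lemma clin_iff_clinear: "clin T \<longleftrightarrow> clinear (blinfun_apply T)"
  unfolding Vector_Spaces.linear_def module_hom_def module_hom_axioms_def clin_def
  by (auto simp: blinfun.add_right scaleC_scaleC scaleC_add_left scaleC_add_right scaleC_one
      intro!: vector_space.intro module.intro)

lemma blinfun_apply_scaleC: "blinfun_apply (c *\<^sub>C T) x = c *\<^sub>C blinfun_apply T x"
  by transfer simp

lemma clin_id [simp]: "clin id_blinfun" by (simp add: clin_def)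
lemma clin_zero [simp]: "clin 0" by (simp add: clin_def)
lemma clin_add: "clin S \<Longrightarrow> clin T \<Longrightarrow> clin (S + T)"
  by (simp add: clin_def blinfun.add_left scaleC_add_right)
lemma clin_diff: "clin S \<Longrightarrow> clin T \<Longrightarrow> clin (S - T)"
  by (simp add: clin_def blinfun.diff_left complex_vector.scale_right_diff_distrib)
lemma clin_compose: "clin S \<Longrightarrow> clin T \<Longrightarrow> clin (S o\<^sub>L T)"
  by (simp add: clin_def)
lemma clin_scaleC: "clin T \<Longrightarrow> clin (c *\<^sub>C T)"
  by (simp add: clin_def blinfun_apply_scaleC scaleC_scaleC mult.commute)
lemma clin_sum: "(\<And>i. i \<in> I \<Longrightarrow> clin (f i)) \<Longrightarrow> clin (\<Sum>i\<in>I. f i)"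
  by (induction I rule: infinite_finite_induct) (simp_all add: clin_add)

lemmas clin_intros = clin_id clin_zero clin_add clin_diff clin_compose clin_scaleC clin_sum

lemma closed_clin: "closed {T. clin T}"
proof -
  have "{T. clin T} = (\<Inter>c. \<Inter>x. {T. blinfun_apply T (c *\<^sub>C x) = c *\<^sub>C T x})"
    by (auto simp: clin_def)
  also have "closed \<dots>"
    by (intro closed_INT ballI closed_Collect_eq continuous_intros scaleC.continuous_on)
  finally show ?thesis .
qed

lemma clin_sum_apply: "clin T \<Longrightarrow> T (\<Sum>i\<in>I. c i *\<^sub>C f i) = (\<Sum>i\<in>I. c i *\<^sub>C T (f i))"
  by (simp add: blinfun.sum_right clinD)

lemma clin_span: "clin T \<Longrightarrow> T ` complex_vector.span Y = complex_vector.span (T ` Y)"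
  unfolding clin_iff_clinear
  by (metis module_hom.span_image module_hom_iff_linear)

subsection \<open>Finite orthonormal sets\<close>

definition orthonormal :: "'a::complex_inner set \<Rightarrow> bool" where
  "orthonormal E \<longleftrightarrow> finite E \<and> (\<forall>x\<in>E. norm x = 1) \<and> (\<forall>x\<in>E. \<forall>y\<in>E. x \<noteq> y \<longrightarrow> cinner x y = 0)"

text \<open>For orthonormal \<open>E\<close> this is the orthogonal projection onto the span of
  \<open>E\<close>.\<close>

definition oproj :: "'a::complex_inner set \<Rightarrow> 'a \<Rightarrow>\<^sub>L 'a" where
  "oproj E = Blinfun (\<lambda>x. \<Sum>e\<in>E. cinner x e *\<^sub>C e)"

lemma oproj_apply: "oproj E x = (\<Sum>e\<in>E. cinner x e *\<^sub>C e)"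
  unfolding oproj_def
  by (subst bounded_linear_Blinfun_apply; intro refl bounded_linear_sum
      bounded_linear_compose[OF scaleC.bounded_linear_left]
      cinner.bounded_linear_left)

lemma clin_oproj: "clin (oproj E)"
  by (simp add: clin_def oproj_apply cinner_scaleC_left complex_vector.scale_sum_right scaleC_scaleC)

lemma oproj_in_span: "oproj E x \<in> complex_vector.span E"
  unfolding oproj_apply
  by (intro complex_vector.span_sum complex_vector.span_scale complex_vector.span_base)

lemma cinner_oproj:
  assumes "orthonormal E" "e \<in> E"
  shows "cinner (oproj E x) e = cinner x e"
proof -
  have "cinner (oproj E x) e = (\<Sum>e'\<in>E. if e' = e then cinner x e else 0)"
    unfolding oproj_apply cinner_sum_left
    by (intro sum.cong) (use assms in \<open>auto simp: orthonormal_def cinner_scaleC_left cinner_self\<close>)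
  then show ?thesis using assms by (simp add: orthonormal_def)
qed

lemma cinner_oproj_span:
  assumes "orthonormal E" "y \<in> complex_vector.span E"
  shows "cinner (x - oproj E x) y = 0"
  using assms(2)
proof (induction rule: complex_vector.span_induct_alt)
  case (step c z w)
  then show ?case using cinner_oproj[OF assms(1), of z x] by (simp add: cinner_simps)
qed simp

text \<open>Pythagoras, since \<open>x - oproj E x\<close> is orthogonal to
  \<open>oproj E x - y\<close>. Thanks to this a projection can stand in for any other approximation
  with values in the span.\<close>

lemma oproj_minimizes:
  assumes "orthonormal E" "y \<in> complex_vector.span E"
  shows "norm (x - oproj E x) \<le> norm (x - y)"
proof -
  have "cinner (x - oproj E x) (oproj E x - y) = 0"
    by (intro cinner_oproj_span assms complex_vector.span_diff oproj_in_span)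
  from pythagoras[OF this] have "(norm (x - oproj E x))\<^sup>2 \<le> (norm (x - y))\<^sup>2"
    by simp
  then show ?thesis by (simp add: power2_le_iff_abs_le)
qed

lemma oproj_ident:
  assumes "orthonormal E" "y \<in> complex_vector.span E"
  shows "oproj E y = y"
  using oproj_minimizes[OF assms, of y] by simp

lemma norm_oproj_power2:
  assumes "orthonormal E"
  shows "(norm (oproj E x))\<^sup>2 = (\<Sum>e\<in>E. (norm (cinner x e))\<^sup>2)"
proof -
  have "cinner (oproj E x) (oproj E x) = (\<Sum>e\<in>E. cinner (oproj E x) (cinner x e *\<^sub>C e))"
    by (subst (2) oproj_apply) (rule cinner_sum_right)
  also have "\<dots> = (\<Sum>e\<in>E. cnj (cinner x e) * cinner x e)"
    by (intro sum.cong) (simp_all add: cinner_scaleC_right cinner_oproj[OF assms])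
  also have "\<dots> = of_real (\<Sum>e\<in>E. (norm (cinner x e))\<^sup>2)"
    by (simp add: complex_norm_square mult.commute flip: of_real_power)
  finally show ?thesis by (metis cinner_self of_real_eq_iff)
qed

lemma bessel:
  assumes "orthonormal E"
  shows "(\<Sum>e\<in>E. (norm (cinner x e))\<^sup>2) \<le> (norm x)\<^sup>2"
proof -
  have "cinner (x - oproj E x) (oproj E x) = 0"
    by (intro cinner_oproj_span assms oproj_in_span)
  from pythagoras[OF this] show ?thesis by (simp add: norm_oproj_power2[OF assms])
qed

lemma cinner_oproj_commute: "cinner (oproj E x) y = cinner x (oproj E y)"
  by (simp add: oproj_apply cinner_sum_left cinner_sum_right cinner_simps)
    (metis (no_types, lifting) cinner_commute mult.commute)

text \<open>Besides the new basis this exports \<open>norm e = 1\<close> and orthogonality to the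
  old span, from which diagonal entries are read off when eigenvectors are orthonormalised.\<close>

lemma gram_schmidt_step:
  assumes E: "orthonormal E" and y: "y \<notin> complex_vector.span E"
  defines "e \<equiv> complex_of_real (1 / norm (y - oproj E y)) *\<^sub>C (y - oproj E y)"
  shows "orthonormal (insert e E)" "e \<notin> E"
    "complex_vector.span (insert y E) = complex_vector.span (insert e E)"
    "y = oproj E y + complex_of_real (norm (y - oproj E y)) *\<^sub>C e"
    "\<And>x. x \<in> complex_vector.span E \<Longrightarrow> cinner e x = 0"
    "norm e = 1"
proof -
  let ?z = "y - oproj E y"
  have nz: "norm ?z \<noteq> 0"
    using y oproj_in_span[of E y] by auto
  show e1: "norm e = 1"
    using nz by (simp add: e_def norm_scaleC norm_divide)
  show orth: "cinner e x = 0" if "x \<in> complex_vector.span E" for x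
    unfolding e_def cinner_scaleC_left by (simp add: cinner_oproj_span[OF E that])
  then have "cinner e x = 0" "cinner x e = 0" if "x \<in> E" for x
    using that complex_vector.span_base cinner_swap_zero by blast+
  then show "orthonormal (insert e E)" using E e1 by (auto simp: orthonormal_def)
  show "e \<notin> E" using e1 \<open>\<And>x. x \<in> E \<Longrightarrow> cinner e x = 0\<close> cinner_self[of e] by auto
  show yeq: "y = oproj E y + complex_of_real (norm ?z) *\<^sub>C e"
    using nz by (simp add: e_def scaleC_scaleC scaleC_one flip: of_real_mult)
  have sub: "oproj E y \<in> complex_vector.span (insert a E)" for a
    using oproj_in_span complex_vector.span_mono[OF subset_insertI] by blast
  have "y \<in> complex_vector.span (insert e E)"
    by (subst yeq)
      (intro complex_vector.span_add sub complex_vector.span_scale complex_vector.span_base insertI1)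
  moreover have "e \<in> complex_vector.span (insert y E)"
    unfolding e_def
    by (intro complex_vector.span_scale complex_vector.span_diff sub complex_vector.span_base) simp
  ultimately show "complex_vector.span (insert y E) = complex_vector.span (insert e E)"
    by (intro antisym complex_vector.span_minimal complex_vector.subspace_span)
      (auto intro: complex_vector.span_base)
qed

lemma orthonormal_spanning:
  assumes "finite Y"
  obtains E where "orthonormal E" "complex_vector.span E = complex_vector.span Y"
  using assms
proof (induction Y arbitrary: thesis)
  case empty
  show ?case by (rule empty(1)[of "{}"]) (simp_all add: orthonormal_def)
next
  case (insert y Y)
  obtain E where E: "orthonormal E" "complex_vector.span E = complex_vector.span Y"
    using insert.IH by blast
  have eq: "complex_vector.span (insert y E) = complex_vector.span (insert y Y)"
    using E(2) by (simp add: complex_vector.span_insert)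
  show ?case
  proof (cases "y \<in> complex_vector.span E")
    case True
    then show ?thesis
      using insert.prems[OF E(1)] complex_vector.span_redundant eq by metis
  next
    case False
    show ?thesis
      using insert.prems[OF gram_schmidt_step(1)[OF E(1) False]]
        gram_schmidt_step(3)[OF E(1) False] eq by simp
  qed
qed

subsection \<open>Norm limits of finite-rank operators\<close>

definition finite_rank :: "('a::complex_normed_vector \<Rightarrow>\<^sub>L 'b::complex_normed_vector) \<Rightarrow> bool" where
  "finite_rank F \<longleftrightarrow> clin F \<and> (\<exists>Y. finite Y \<and> range F \<subseteq> complex_vector.span Y)"

text \<open>For operators into a Hilbert space these are exactly the compact ones. Membership in a
  closure makes stability under continuous operations immediate.\<close>

definition approximable :: "('a::complex_normed_vector \<Rightarrow>\<^sub>L 'b::complex_normed_vector) \<Rightarrow> bool" where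
  "approximable T \<longleftrightarrow> T \<in> closure {F. finite_rank F}"

lemma approximable_iff: "approximable T \<longleftrightarrow> (\<forall>e>0. \<exists>F. finite_rank F \<and> norm (T - F) < e)"
  by (auto simp: approximable_def closure_approachable dist_norm norm_minus_commute)

lemma closed_approximable: "closed {T. approximable T}"
  by (simp add: approximable_def)

lemma approximable_clin: "approximable T \<Longrightarrow> clin T"
  using closure_minimal[OF _ closed_clin, of "{F. finite_rank F}"]
  by (auto simp: approximable_def finite_rank_def)

lemma finite_rank_approximable: "finite_rank F \<Longrightarrow> approximable F"
  by (simp add: approximable_def subsetD[OF closure_subset])

lemma approximable_zero: "approximable 0"
  by (rule finite_rank_approximable) (auto simp: finite_rank_def intro: exI[of _ "{}"])

lemma finite_rank_add: 
  assumes "finite_rank F" "finite_rank G" 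
  shows "finite_rank (F + G)"
proof -
  obtain Y Z where "finite Y" "range F \<subseteq> complex_vector.span Y"
    "finite Z" "range G \<subseteq> complex_vector.span Z"
    using assms by (auto simp: finite_rank_def)
  moreover from this have "range (F + G) \<subseteq> complex_vector.span (Y \<union> Z)"
    by (auto simp: blinfun.add_left
        intro!: complex_vector.span_add 
        intro: subsetD[OF complex_vector.span_mono[of _ "Y \<union> Z"]])
  ultimately show ?thesis
    using assms by (auto simp: finite_rank_def intro!: clin_add exI[of _ "Y \<union> Z"])
qed

lemma finite_rank_compose_left:
  assumes "clin B" "finite_rank F"
  shows "finite_rank (B o\<^sub>L F)"
proof -
  obtain Y where "finite Y" "range F \<subseteq> complex_vector.span Y"
    using assms by (auto simp: finite_rank_def)
  moreover from this have "range (B o\<^sub>L F) \<subseteq> complex_vector.span (B ` Y)"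
    by (auto simp flip: clin_span[OF assms(1)])
  ultimately show ?thesis
    using assms by (auto simp: finite_rank_def intro!: clin_compose exI[of _ "B ` Y"])
qed

lemma finite_rank_compose_right:
  assumes "clin B" "finite_rank F"
  shows "finite_rank (F o\<^sub>L B)"
  using assms by (auto simp: finite_rank_def intro!: clin_compose)

lemma finite_rank_scaleC:
  assumes "finite_rank F" shows "finite_rank (c *\<^sub>C F)"
proof -
  have "c *\<^sub>C F = (c *\<^sub>C id_blinfun) o\<^sub>L F"
    by (rule blinfun_eqI) (simp add: blinfun_apply_scaleC)
  then show ?thesis
    using assms by (simp add: finite_rank_compose_left clin_scaleC)
qed

text \<open>A continuous map sends a closure into the closure of the image, so preservation of
  finite rank is all there is to check.\<close>

lemma closure_image_limit:
  assumes "continuous_on UNIV f" "\<And>F. finite_rank F \<Longrightarrow> finite_rank (f F)" "approximable T"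
  shows "approximable (f T)"
  using image_closure_subset[of "{F. finite_rank F}" f "closure {F. finite_rank F}"] assms
  by (auto simp: approximable_def intro: continuous_on_subset subsetD[OF closure_subset])

lemma approximable_compose_left: "clin B \<Longrightarrow> approximable T \<Longrightarrow> approximable (B o\<^sub>L T)"
  by (rule closure_image_limit[of "(o\<^sub>L) B"])
    (auto intro!: finite_rank_compose_left linear_continuous_on
       bounded_bilinear.bounded_linear_right[OF bounded_bilinear_blinfun_compose])

lemma approximable_compose_right: "clin B \<Longrightarrow> approximable T \<Longrightarrow> approximable (T o\<^sub>L B)"
  by (rule closure_image_limit[of "\<lambda>T. T o\<^sub>L B"])
    (auto intro!: finite_rank_compose_right linear_continuous_on
       bounded_bilinear.bounded_linear_left[OF bounded_bilinear_blinfun_compose])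

lemma approximable_scaleC: "approximable T \<Longrightarrow> approximable (c *\<^sub>C T)"
  by (rule closure_image_limit[of "\<lambda>T. c *\<^sub>C T"])
    (auto intro!: finite_rank_scaleC linear_continuous_on scaleC.bounded_linear_right)

lemma approximable_add:
  assumes "approximable S" "approximable T"
  shows "approximable (S + T)"
  unfolding approximable_iff
proof (intro allI impI)
  fix e :: real assume "e > 0"
  then obtain F G where "finite_rank F" "norm (S - F) < e/2" "finite_rank G" "norm (T - G) < e/2"
    using assms unfolding approximable_iff by (meson half_gt_zero)
  then show "\<exists>F. finite_rank F \<and> norm (S + T - F) < e"
    using norm_triangle_ineq[of "S - F" "T - G"]
    by (intro exI[of _ "F + G"] conjI finite_rank_add) (simp_all add: algebra_simps)
qed

lemma approximable_minus: "approximable T \<Longrightarrow> approximable (- T)"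
  using approximable_scaleC[of T "-1"] by (simp add: complex_vector.scale_minus_left scaleC_one)

lemma approximable_diff: "approximable S \<Longrightarrow> approximable T \<Longrightarrow> approximable (S - T)"
  using approximable_add[of S "- T"] by (simp add: approximable_minus)

lemma approximable_sum: "(\<And>i. i \<in> I \<Longrightarrow> approximable (f i)) \<Longrightarrow> approximable (\<Sum>i\<in>I. f i)"
  by (induction I rule: infinite_finite_induct) (simp_all add: approximable_add approximable_zero)

text \<open>If \<open>F\<close> has values in the span of \<open>E\<close>, then
  \<open>oproj E (T x)\<close> is at least as close to \<open>T x\<close> as \<open>F x\<close> is.
  An unknown approximant is thus traded for one expressed through \<open>T\<close> itself.\<close>

lemma approximable_oproj:
  assumes "approximable (T :: 'a::complex_normed_vector \<Rightarrow>\<^sub>L 'b::complex_inner)" "e > 0"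
  obtains E where "orthonormal E" "norm (T - (oproj E o\<^sub>L T)) < e"
proof -
  obtain F where F: "finite_rank F" "norm (T - F) < e"
    using assms by (auto simp: approximable_iff)
  then obtain Y where Y: "finite Y" "range F \<subseteq> complex_vector.span Y"
    by (auto simp: finite_rank_def)
  obtain E where E: "orthonormal E" "complex_vector.span E = complex_vector.span Y"
    using orthonormal_spanning[OF Y(1)] by blast
  have "norm ((T - (oproj E o\<^sub>L T)) x) \<le> norm (T - F) * norm x" for x
    using oproj_minimizes[OF E(1), of "F x" "T x"] norm_blinfun[of "T - F" x] Y(2) E(2)
    by (auto simp: blinfun.diff_left intro: order_trans)
  then have "norm (T - (oproj E o\<^sub>L T)) \<le> norm (T - F)"
    by (intro norm_blinfun_bound) auto
  then show ?thesis using that E F by force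
qed

lemma finite_rank_oproj_compose:
  assumes "orthonormal E" "clin T"
  shows "finite_rank (oproj E o\<^sub>L T)"
  using assms by (auto simp: finite_rank_def orthonormal_def oproj_in_span
      intro!: clin_compose clin_oproj exI[of _ E])

text \<open>Projecting onto the span of a finite net moves no point of \<open>C\<close> by more than
  its distance to the net.\<close>

lemma compact_oproj:
  fixes C :: "'a::complex_inner set"
  assumes "compact C" "e > 0"
  obtains E where "orthonormal E" "\<And>c. c \<in> C \<Longrightarrow> norm (c - oproj E c) \<le> e"
proof -
  obtain Y where Y: "finite Y" "C \<subseteq> (\<Union>y\<in>Y. ball y e)"
    using seq_compact_imp_totally_bounded[of C] assms compact_imp_seq_compact by meson
  obtain E where E: "orthonormal E" "complex_vector.span E = complex_vector.span Y"
    using orthonormal_spanning[OF Y(1)] by blast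
  have "norm (c - oproj E c) \<le> e" if "c \<in> C" for c
  proof -
    obtain y where "y \<in> Y" "norm (c - y) < e"
      using Y(2) \<open>c \<in> C\<close> by (auto simp: dist_norm norm_minus_commute)
    then show ?thesis
      using oproj_minimizes[OF E(1), of y c] E(2) complex_vector.span_base[of y Y] by simp
  qed
  then show ?thesis using that E by blast
qed

text \<open>Relative compactness of the image of the unit ball is used twice: as boundedness, which
  makes the operator a blinfun, and as total boundedness, which provides finite-rank
  approximants.\<close>

lemma compact_operatorE:
  fixes T :: "'a::chilbert_space \<Rightarrow> 'a"
  assumes "compact_operator T"
  obtains K where "clin K" "blinfun_apply K = T" "approximable K"
    "\<And>B. bounded B \<Longrightarrow> compact (closure (K ` B))"
proof -
  have lin: "clinear T" and comp: "\<And>B. bounded B \<Longrightarrow> compact (closure (T ` B))"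
    using assms by (auto simp: compact_operator_def)
  have add: "T (x + y) = T x + T y" and scale: "T (c *\<^sub>C x) = c *\<^sub>C T x" for x y c
    using lin by (simp_all add: Vector_Spaces.linear_def module_hom_def module_hom_axioms_def)
  have "bounded (T ` cball 0 1)"
    using comp[of "cball 0 1"] bounded_subset[OF compact_imp_bounded closure_subset] by auto
  then obtain B where B: "\<And>x. norm x \<le> 1 \<Longrightarrow> norm (T x) \<le> B"
    by (force simp: bounded_iff)
  have bound: "norm (T x) \<le> norm x * B" for x
  proof (cases "x = 0")
    case True
    then show ?thesis using scale[of 0 0] by simp
  next
    case False
    have "norm (T (complex_of_real (1 / norm x) *\<^sub>C x)) \<le> B"
      using False by (intro B) (simp add: norm_scaleC norm_divide)
    then show ?thesis
      using False by (simp add: scale norm_scaleC norm_divide field_simps)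
  qed
  have "bounded_linear T"
    by (rule bounded_linear_intro[of _ B]) (auto simp: add scale scaleR_scaleC bound)
  then have eq: "blinfun_apply (Blinfun T) = T"
    by (rule bounded_linear_Blinfun_apply)
  have cl: "clin (Blinfun T)" by (simp add: clin_def eq scale)
  have "approximable (Blinfun T)"
    unfolding approximable_iff
  proof (intro allI impI)
    fix e :: real assume e: "e > 0"
    obtain E where E: "orthonormal E" 
      "\<And>c. c \<in> closure (T ` cball 0 1) \<Longrightarrow> norm (c - oproj E c) \<le> e/2"
      using compact_oproj[OF comp, of "cball 0 1" "e/2"] e by auto
    have le: "norm (T x - oproj E (T x)) \<le> e/2 * norm x" for x
    proof (cases "x = 0")
      case True
      then show ?thesis using bound[of 0] by simp
    next
      case False
      let ?x = "complex_of_real (1 / norm x) *\<^sub>C x"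
      have "T ?x \<in> closure (T ` cball 0 1)"
        using False by (intro subsetD[OF closure_subset] imageI) (simp add: norm_scaleC norm_divide)
      from E(2)[OF this] have "norm (complex_of_real (1 / norm x)) * norm (T x - oproj E (T x)) \<le> e/2"
        by (simp only: scale clinD[OF clin_oproj] flip: complex_vector.scale_right_diff_distrib norm_scaleC)
      then show ?thesis
        using False by (simp add: norm_divide field_simps)
    qed
    have "norm (Blinfun T - (oproj E o\<^sub>L Blinfun T)) \<le> e/2"
      using e le by (intro norm_blinfun_bound) (auto simp: blinfun.diff_left eq)
    then show "\<exists>F. finite_rank F \<and> norm (Blinfun T - F) < e"
      using e finite_rank_oproj_compose[OF E(1) cl]
      by (intro exI[of _ "oproj E o\<^sub>L Blinfun T"]) auto
  qed
  then show ?thesis using that[of "Blinfun T"] cl eq comp by simp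
qed

subsection \<open>Invertibility\<close>

definition cinvertible :: "('a::complex_normed_vector \<Rightarrow>\<^sub>L 'a) \<Rightarrow> bool" where
  "cinvertible V \<longleftrightarrow> clin V \<and> (\<exists>W. clin W \<and> (\<forall>x. V (blinfun_apply W x) = x) \<and> (\<forall>x. W (V x) = x))"

lemma cinvertibleE:
  assumes "cinvertible V"
  obtains W where "clin W" "\<And>x. V (blinfun_apply W x) = x" "\<And>x. W (V x) = x"
  using assms by (auto simp: cinvertible_def)

text \<open>Injectivity turns a right inverse into a two-sided one, because \<open>V\<close>
  annihilates \<open>W (V x) - x\<close>.\<close>

lemma cinvertible_right_inverse:
  assumes "clin V" "clin W" "\<And>x. V (blinfun_apply W x) = x" "\<And>x. V x = 0 \<Longrightarrow> x = 0"
  shows "cinvertible V"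
proof -
  have "W (V x) = x" for x
    using assms(4)[of "W (V x) - x"] assms(3) by (simp add: blinfun.diff_right)
  then show ?thesis using assms by (auto simp: cinvertible_def)
qed

lemma cinvertible_compose:
  assumes "cinvertible V" "cinvertible V'"
  shows "cinvertible (V o\<^sub>L V')"
proof -
  obtain W W' where "clin W" "\<And>x. V (blinfun_apply W x) = x" "\<And>x. W (V x) = x"
    "clin W'" "\<And>x. V' (blinfun_apply W' x) = x" "\<And>x. W' (V' x) = x"
    using assms by (metis cinvertibleE)
  then show ?thesis
    using assms by (auto simp: cinvertible_def intro!: clin_compose exI[of _ "W' o\<^sub>L W"])
qed

lemma cinvertible_scaleC:
  assumes "cinvertible V" "c \<noteq> 0"
  shows "cinvertible (c *\<^sub>C V)"
proof -
  obtain W where "clin W" "\<And>x. V (blinfun_apply W x) = x" "\<And>x. W (V x) = x"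
    using assms by (metis cinvertibleE)
  then show ?thesis
    using assms by (auto simp: cinvertible_def clin_scaleC blinfun_apply_scaleC clinD scaleC_simps
        intro!: exI[of _ "(1/c) *\<^sub>C W"])
qed

lemma linear_operator_UNIV: "clin T \<Longrightarrow> linear_operator UNIV (blinfun_apply T)"
  by (simp add: linear_operator_def complex_vector.subspace_UNIV blinfun.add_right clinD)

text \<open>A two-sided inverse is unique, hence agrees with the \<open>inv_into\<close> of the
  definitions, which inherits boundedness from \<open>R\<close>.\<close>

lemma resolvent_eqI:
  fixes R :: "'a::complex_normed_vector \<Rightarrow>\<^sub>L 'a"
  assumes "\<And>y. R y \<in> D" "\<And>y. z *\<^sub>C R y - A (R y) = y" "\<And>u. u \<in> D \<Longrightarrow> R (z *\<^sub>C u - A u) = u"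
  shows "z \<in> resolvent_set D A" "resolvent D A z = R"
proof -
  have bij: "bij_betw (\<lambda>u. z *\<^sub>C u - A u) D UNIV"
    by (rule bij_betw_byWitness[of _ R]) (use assms in auto)
  have "inv_into D (\<lambda>u. z *\<^sub>C u - A u) = blinfun_apply R"
  proof
    fix y
    have "R (z *\<^sub>C inv_into D (\<lambda>u. z *\<^sub>C u - A u) y - A (inv_into D (\<lambda>u. z *\<^sub>C u - A u) y))
      = inv_into D (\<lambda>u. z *\<^sub>C u - A u) y"
      using bij by (intro assms inv_into_into) (auto simp: bij_betw_def)
    moreover have "z *\<^sub>C inv_into D (\<lambda>u. z *\<^sub>C u - A u) y - A (inv_into D (\<lambda>u. z *\<^sub>C u - A u) y) = y"
      using bij by (intro f_inv_into_f) (auto simp: bij_betw_def)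
    ultimately show "inv_into D (\<lambda>u. z *\<^sub>C u - A u) y = R y" by simp
  qed
  then show "z \<in> resolvent_set D A" "resolvent D A z = R"
    using bij by (simp_all add: resolvent_set_def resolvent_def blinfun.bounded_linear_right
        blinfun_apply_inverse)
qed

lemma resolvent_props:
  assumes lin: "linear_operator D A" and z: "z \<in> resolvent_set D A"
  shows resolvent_in_domain: "resolvent D A z y \<in> D"
    and resolvent_right: "z *\<^sub>C resolvent D A z y - A (resolvent D A z y) = y"
    and resolvent_left: "u \<in> D \<Longrightarrow> resolvent D A z (z *\<^sub>C u - A u) = u"
    and resolvent_clin: "clin (resolvent D A z)"
proof -
  let ?f = "\<lambda>u. z *\<^sub>C u - A u"
  have bij: "bij_betw ?f D UNIV" and "bounded_linear (inv_into D ?f)"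
    using z by (auto simp: resolvent_set_def)
  then have R: "blinfun_apply (resolvent D A z) = inv_into D ?f"
    by (simp add: resolvent_def bounded_linear_Blinfun_apply)
  show dom: "resolvent D A z y \<in> D" for y
    using bij by (auto simp: R bij_betw_def intro!: inv_into_into)
  show right: "?f (resolvent D A z y) = y" for y
    unfolding R using bij by (intro f_inv_into_f) (auto simp: bij_betw_def)
  show left: "resolvent D A z (?f u) = u" if "u \<in> D" for u
    unfolding R using bij that by (auto simp: bij_betw_def intro!: inv_into_f_f)
  show "clin (resolvent D A z)"
    unfolding clin_def
  proof (intro allI)
    fix c x
    let ?u = "c *\<^sub>C resolvent D A z x"
    have "?f ?u = c *\<^sub>C ?f (resolvent D A z x)"
      using lin dom[of x] by (simp add: linear_operator_def scaleC_simps mult.commute)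
    then have "?f ?u = c *\<^sub>C x" by (simp only: right)
    moreover have "?u \<in> D"
      using lin dom[of x] by (simp add: linear_operator_def complex_vector.subspace_scale)
    ultimately show "resolvent D A z (c *\<^sub>C x) = ?u" using left[of ?u] by simp
  qed
qed

lemma resolvent_set_blinfun_iff:
  assumes "clin T"
  shows "z \<in> resolvent_set UNIV (blinfun_apply T) \<longleftrightarrow> cinvertible (z *\<^sub>C id_blinfun - T)"
    (is "_ \<longleftrightarrow> cinvertible ?V")
proof
  assume z: "z \<in> resolvent_set UNIV (blinfun_apply T)"
  note R = resolvent_props[OF linear_operator_UNIV[OF assms] z]
  show "cinvertible ?V"
    unfolding cinvertible_def
    using R(2) R(3) R(4) assms
    by (auto simp: blinfun.diff_left blinfun_apply_scaleC intro!: clin_intros exI[of _ "resolvent UNIV T z"])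
next
  assume "cinvertible ?V"
  then obtain W where "\<And>x. ?V (blinfun_apply W x) = x" "\<And>x. W (?V x) = x"
    by (metis cinvertibleE)
  then show "z \<in> resolvent_set UNIV (blinfun_apply T)"
    by (intro resolvent_eqI(1)[of W]) (simp_all add: blinfun.diff_left blinfun_apply_scaleC)
qed

text \<open>The Neumann series under a bound on powers: the factor \<open>M\<close> may exceed 1, as
  happens for rescaled semigroup operators.\<close>

lemma cinvertible_id_minus:
  fixes B :: "'a::chilbert_space \<Rightarrow>\<^sub>L 'a"
  assumes "clin B" and pow: "\<And>n x. norm ((blinfun_apply B ^^ n) x) \<le> M * q ^ n * norm x"
    and q: "0 \<le> q" "q < 1"
  shows "cinvertible (id_blinfun - B)"
proof -
  define J where "J y = (\<Sum>n. (blinfun_apply B ^^ n) y)" for y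
  have geo: "summable (\<lambda>n. M * q ^ n * norm y)" for y :: 'a
    using q by (intro summable_mult summable_mult2 summable_geometric) auto
  have nsum: "summable (\<lambda>n. norm ((blinfun_apply B ^^ n) y))" for y
    by (rule summable_comparison_test[OF _ geo[of y]]) (use pow in auto)
  then have sum: "summable (\<lambda>n. (blinfun_apply B ^^ n) y)" for y
    by (rule summable_norm_cancel)
  have rec: "J y = y + B (J y)" for y
  proof -
    have "B (J y) = (\<Sum>n. (blinfun_apply B ^^ Suc n) y)"
      unfolding J_def by (subst bounded_linear.suminf[OF blinfun.bounded_linear_right sum]) simp
    then show ?thesis using suminf_split_head[OF sum[of y]] by (simp add: J_def)
  qed
  have lin: "(blinfun_apply B ^^ n) (x + y) = (blinfun_apply B ^^ n) x + (blinfun_apply B ^^ n) y"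
    "(blinfun_apply B ^^ n) (c *\<^sub>C x) = c *\<^sub>C (blinfun_apply B ^^ n) x" for n x y c
    by (induction n arbitrary: x y) (simp_all add: blinfun.add_right clinD[OF assms(1)])
  have Jadd: "J (x + y) = J x + J y" for x y
    unfolding J_def lin by (rule suminf_add[OF sum sum, symmetric])
  have Jscale: "J (c *\<^sub>C x) = c *\<^sub>C J x" for c x
    unfolding J_def lin
    by (rule bounded_linear.suminf[OF scaleC.bounded_linear_right sum, symmetric])
  have Jnorm: "norm (J y) \<le> norm y * (M / (1 - q))" for y
  proof -
    have sums: "(\<lambda>n. M * q ^ n * norm y) sums (M * (1 / (1 - q)) * norm y)"
      using q by (intro sums_mult sums_mult2 geometric_sums) auto
    have "norm (J y) \<le> (\<Sum>n. M * q ^ n * norm y)"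
      unfolding J_def by (intro order_trans[OF summable_norm[OF nsum]] suminf_le pow nsum geo)
    also have "\<dots> = M * (1 / (1 - q)) * norm y"
      using sums by (rule sums_unique[symmetric])
    finally show ?thesis by (simp add: mult.commute)
  qed
  have "bounded_linear J"
    by (rule bounded_linear_intro[OF _ _ Jnorm]) (simp_all add: Jadd Jscale scaleR_scaleC)
  then have Bl: "blinfun_apply (Blinfun J) = J" by (rule bounded_linear_Blinfun_apply)
  \<comment> \<open>A fixed point of \<open>B\<close> is fixed by all powers of \<open>B\<close>,
    and these tend to 0 on it. So the right inverse given by \<open>J\<close> is two-sided.\<close>
  have "x = 0" if "(id_blinfun - B) x = 0" for x
  proof -
    have "B x = x" using that by (simp add: blinfun.diff_left)
    then have iter: "(blinfun_apply B ^^ n) x = x" for n by (induction n) simp_all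
    have "norm x \<le> M * q ^ n * norm x" for n using pow[of n x] by (simp add: iter)
    moreover have "(\<lambda>n. M * q ^ n * norm x) \<longlonglongrightarrow> M * 0 * norm x"
      using q by (intro tendsto_intros LIMSEQ_power_zero) auto
    ultimately have "norm x \<le> M * 0 * norm x" by (intro LIMSEQ_le_const) auto
    then show "x = 0" by simp
  qed
  moreover have "(id_blinfun - B) (Blinfun J x) = x" for x
    using rec[of x] by (simp add: Bl blinfun.diff_left algebra_simps)
  ultimately show ?thesis
    using assms by (intro cinvertible_right_inverse[of _ "Blinfun J"])
      (auto simp: clin_def Bl Jscale blinfun.diff_left scaleC_simps)
qed

lemma cinvertible_id_minus_norm:
  fixes B :: "'a::chilbert_space \<Rightarrow>\<^sub>L 'a"
  assumes "clin B" "norm B < 1"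
  shows "cinvertible (id_blinfun - B)"
proof (rule cinvertible_id_minus[OF assms(1), of 1 "norm B"])
  show "norm ((blinfun_apply B ^^ n) x) \<le> 1 * norm B ^ n * norm x" for n x
  proof (induction n)
    case (Suc n)
    have "norm ((blinfun_apply B ^^ Suc n) x) \<le> norm B * norm ((blinfun_apply B ^^ n) x)"
      by (simp add: norm_blinfun)
    also have "\<dots> \<le> norm B * (norm B ^ n * norm x)"
      using Suc by (intro mult_left_mono) auto
    finally show ?case by (simp add: mult.assoc)
  qed simp
qed (use assms in auto)

subsection \<open>The Fredholm alternative\<close>

text \<open>Dimension count: an injective map carries a basis of the span to an independent set of
  the same size, and a vector of the span not reached would give one independent vector too
  many.\<close>

lemma injective_on_span_surjective:
  fixes N :: "'a::complex_normed_vector \<Rightarrow>\<^sub>L 'a"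
  assumes "finite Y" "clin N" "N ` complex_vector.span Y \<subseteq> complex_vector.span Y"
    and inj: "\<And>x. N x = 0 \<Longrightarrow> x = 0" and y: "y \<in> complex_vector.span Y"
  shows "\<exists>x\<in>complex_vector.span Y. N x = y"
proof -
  obtain B where B: "B \<subseteq> complex_vector.span Y" "complex_vector.independent B"
    "complex_vector.span Y \<subseteq> complex_vector.span B"
    by (rule complex_vector.maximal_independent_subset)
  have fB: "finite B"
    using complex_vector.independent_span_bound[OF assms(1) B(2) B(1)] by blast
  have eq: "complex_vector.span B = complex_vector.span Y"
    by (intro antisym complex_vector.span_minimal complex_vector.subspace_span B)
  have injN: "inj_on N S" for S
  proof (rule inj_onI)
    fix x y assume "N x = N y"
    then show "x = y" using inj[of "x - y"] by (simp add: blinfun.diff_right)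
  qed
  have ind: "complex_vector.independent (N ` B)"
    using assms(2)
    by (intro module_hom.independent_injective_image[OF _ B(2) injN])
      (simp add: clin_iff_clinear module_hom_iff_linear)
  have sub: "N ` B \<subseteq> complex_vector.span B"
    using image_mono[OF B(1), of N] assms(3) by (simp add: eq)
  have card: "card (N ` B) = card B" using injN by (simp add: card_image)
  have "y \<in> complex_vector.span (N ` B)"
  proof (rule ccontr)
    assume no: "y \<notin> complex_vector.span (N ` B)"
    then have "complex_vector.independent (insert y (N ` B))"
      using ind by (simp add: complex_vector.independent_insert)
    moreover have "insert y (N ` B) \<subseteq> complex_vector.span B" using sub y eq by simp
    ultimately have "card (insert y (N ` B)) \<le> card B"
      by (rule complex_vector.independent_span_bound[OF fB, THEN conjunct2])
    moreover have "y \<notin> N ` B" using no complex_vector.span_base[of y "N ` B"] by auto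
    ultimately show False using card fB by simp
  qed
  then have "y \<in> N ` complex_vector.span B"
    by (simp only: clin_span[OF assms(2)])
  then show ?thesis unfolding eq by (elim imageE) (intro bexI, rule sym)
qed

text \<open>The operator \<open>?N\<close>, that is 1 - F, is bijective on the span of
  \<open>E\<close>; let \<open>G\<close> project there and then invert it. Since
  \<open>?N (G (F y)) = oproj E (F y) = F y\<close>, the operator 1 + G F is a right
  inverse.\<close>

lemma fredholm_finite_rank:
  fixes F :: "'a::chilbert_space \<Rightarrow>\<^sub>L 'a"
  assumes E: "orthonormal E" and F: "clin F" "range F \<subseteq> complex_vector.span E"
    and inj: "\<And>x. F x = x \<Longrightarrow> x = 0"
  shows "cinvertible (id_blinfun - F)"
proof -
  let ?N = "id_blinfun - F"
  have N: "clin ?N" using F by (intro clin_intros)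
  have inv: "?N ` complex_vector.span E \<subseteq> complex_vector.span E"
    using F(2) by (auto simp: blinfun.diff_left intro!: complex_vector.span_diff)
  have inj0: "x = 0" if "?N x = 0" for x using inj[of x] that by (simp add: blinfun.diff_left)
  have "\<exists>m. ?N m = e" if "e \<in> E" for e
    using injective_on_span_surjective[OF _ N inv inj0 complex_vector.span_base[OF that]] E
    by (auto simp only: orthonormal_def)
  then obtain m where m: "\<And>e. e \<in> E \<Longrightarrow> ?N (m e) = e" by metis
  define G where "G = Blinfun (\<lambda>y. \<Sum>e\<in>E. cinner y e *\<^sub>C m e)"
  have G: "G y = (\<Sum>e\<in>E. cinner y e *\<^sub>C m e)" for y
    unfolding G_def
    by (subst bounded_linear_Blinfun_apply; intro refl bounded_linear_sum
        bounded_linear_compose[OF scaleC.bounded_linear_left] cinner.bounded_linear_left)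
  have clG: "clin G"
    by (simp add: clin_def G cinner_scaleC_left complex_vector.scale_sum_right scaleC_scaleC)
  have "?N (G y) = oproj E y" for y
    by (simp add: G clin_sum_apply[OF N] m oproj_apply cong: sum.cong)
  then have "?N ((id_blinfun + (G o\<^sub>L F)) y) = y" for y
    using oproj_ident[OF E subsetD[OF F(2) rangeI], of y]
    by (simp add: blinfun.add_left blinfun.add_right) (simp add: blinfun.diff_left)
  then show ?thesis
    using N clG F(1) inj0 by (intro cinvertible_right_inverse[of _ "id_blinfun + (G o\<^sub>L F)"] clin_intros)
qed

text \<open>With \<open>W\<close> the inverse of \<open>V\<close>, split H = W G into a small
  remainder, absorbed in the Neumann-invertible \<open>N\<close>, and a part with range in the span
  of \<open>E\<close>. This yields the factorisation V - G = V (1 - F) N with \<open>F\<close> of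
  finite rank.\<close>

theorem fredholm_alternative:
  fixes V G :: "'a::chilbert_space \<Rightarrow>\<^sub>L 'a"
  assumes V: "cinvertible V" and G: "approximable G" and inj: "\<And>x. V x = G x \<Longrightarrow> x = 0"
  shows "cinvertible (V - G)"
proof -
  obtain W where W: "clin W" "\<And>x. V (blinfun_apply W x) = x" "\<And>x. W (V x) = x"
    using cinvertibleE[OF V] by blast
  define H where "H = W o\<^sub>L G"
  have H: "approximable H" "clin H"
    using G W approximable_clin unfolding H_def by (auto intro: approximable_compose_left)
  obtain E where E: "orthonormal E" "norm (H - (oproj E o\<^sub>L H)) < 1"
    using approximable_oproj[OF H(1), of 1] by auto
  define N where "N = id_blinfun - (H - (oproj E o\<^sub>L H))"
  have N: "cinvertible N"
    unfolding N_def using E H by (intro cinvertible_id_minus_norm clin_intros clin_oproj)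
  then obtain J where J: "clin J" "\<And>x. N (blinfun_apply J x) = x" "\<And>x. J (N x) = x"
    using cinvertibleE by blast
  define F where "F = (oproj E o\<^sub>L H) o\<^sub>L J"
  have "cinvertible (id_blinfun - F)"
  proof (rule fredholm_finite_rank[OF E(1)])
    show "clin F" unfolding F_def by (intro clin_intros clin_oproj H J)
    show "range F \<subseteq> complex_vector.span E" by (auto simp: F_def oproj_in_span)
    fix x assume "F x = x"
    then have "N (J x) = oproj E (H (J x))" by (simp add: J F_def)
    then have "J x - (H (J x) - oproj E (H (J x))) = oproj E (H (J x))"
      by (simp add: N_def blinfun.diff_left)
    then have "H (J x) = J x" by simp
    then have "V (J x) = G (J x)" using W(2)[of "G (J x)"] by (simp add: H_def)
    then have "J x = 0" by (rule inj)
    then show "x = 0" using J(2)[of x] by simp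
  qed
  moreover have "V - G = V o\<^sub>L ((id_blinfun - F) o\<^sub>L N)"
  proof (rule blinfun_eqI)
    fix x
    have "(id_blinfun - F) (N x) = x - H x"
      by (simp add: F_def blinfun.diff_left J) (simp add: N_def blinfun.diff_left)
    then show "(V - G) x = (V o\<^sub>L ((id_blinfun - F) o\<^sub>L N)) x"
      by (simp add: blinfun.diff_left blinfun.diff_right H_def W)
  qed
  ultimately show ?thesis using V N by (simp add: cinvertible_compose)
qed

text \<open>A projection \<open>P\<close> that is almost finite rank, say \<open>P = F + E\<close> with \<open>norm E < 1\<close>, has its range
  in the image of that of \<open>F\<close> under the inverse of \<open>1 - E\<close>.\<close>

lemma approximable_projection_range:
  fixes P :: "'a::chilbert_space \<Rightarrow>\<^sub>L 'a"
  assumes P: "approximable P" "\<And>x. P (P x) = P x"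
  shows "cdim (range P) < \<infinity>"
proof -
  obtain E where E: "orthonormal E" "norm (P - (oproj E o\<^sub>L P)) < 1"
    using approximable_oproj[OF P(1), of 1] by auto
  define N where "N = id_blinfun - (P - (oproj E o\<^sub>L P))"
  have clP: "clin P" using P(1) by (rule approximable_clin)
  have "cinvertible N"
    unfolding N_def using E clP by (intro cinvertible_id_minus_norm clin_intros clin_oproj)
  then obtain J where J: "clin J" "\<And>x. N (blinfun_apply J x) = x" "\<And>x. J (N x) = x"
    using cinvertibleE by blast
  have sub: "range P \<subseteq> complex_vector.span (J ` E)"
  proof
    fix y assume "y \<in> range P"
    then have "P y = y" using P(2) by auto
    then have "N y = oproj E y" by (simp add: N_def blinfun.diff_left)
    then have "y = J (oproj E y)" using J(3)[of y] by simp
    then show "y \<in> complex_vector.span (J ` E)"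
      using oproj_in_span by (auto simp flip: clin_span[OF J(1)])
  qed
  obtain B where B: "B \<subseteq> range P" "complex_vector.independent B" "range P \<subseteq> complex_vector.span B"
    by (rule complex_vector.maximal_independent_subset)
  have "finite B"
    using complex_vector.independent_span_bound[OF _ B(2), of "J ` E"] B(1) sub E(1)
    by (auto simp: orthonormal_def)
  moreover have "complex_vector.span B = range P"
  proof (rule antisym)
    show "complex_vector.span B \<subseteq> range P"
    proof (rule complex_vector.span_minimal[OF B(1)])
      show "complex_vector.subspace (range P)"
        using clin_span[OF clP, of UNIV]
        unfolding complex_vector.span_UNIV
        by (metis complex_vector.subspace_span)
    qed
  qed (rule B(3))
  ultimately show ?thesis by (auto simp: cdim_def)
qed

subsection \<open>Fourier uniqueness\<close>

text \<open>Periodicity lets \<open>f\<close> descend to the unit circle, a compact set on which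
  Stone-Weierstrass approximation is available.\<close>

lemma continuous_on_circle_factor:
  fixes f :: "real \<Rightarrow> 'b::topological_space"
  assumes t: "t > 0" and cont: "continuous_on {0..t} f" and per: "f 0 = f t"
  defines "e \<equiv> \<lambda>s. exp (2 * pi * \<i> * of_real s / of_real t)"
  obtains h where "continuous_on (sphere 0 1) h" "\<And>s. s \<in> {0..t} \<Longrightarrow> h (e s) = f s"
proof -
  define h where "h z = f (t * Arg2pi z / (2 * pi))" for z
  have he: "h (e s) = f s" if "s \<in> {0..t}" for s
  proof (cases "s = t")
    case True
    moreover have "Arg2pi 1 = 0" by (simp add: Arg2pi_eq_0)
    ultimately show ?thesis using t per by (simp add: h_def e_def)
  next
    case False
    have "Arg2pi (e s) = 2 * pi * s / t"
      by (rule Arg2pi_unique[of 1]) (use t that False in \<open>auto simp: e_def field_simps\<close>)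
    then show ?thesis using t by (simp add: h_def)
  qed
  have e_image: "\<exists>s\<in>{0..t}. e s = z" if "z \<in> sphere 0 1" for z
  proof (rule bexI)
    show "e (t * Arg2pi z / (2 * pi)) = z"
    proof -
      have "2 * pi * \<i> * of_real (t * Arg2pi z / (2 * pi)) / of_real t = \<i> * of_real (Arg2pi z)"
        using t by (simp add: field_simps)
      then show ?thesis using Arg2pi_eq[of z] that unfolding e_def by simp
    qed
    show "t * Arg2pi z / (2 * pi) \<in> {0..t}"
      using Arg2pi[of z] t by (simp add: field_simps)
  qed
  \<comment> \<open>\<open>Arg2pi\<close> jumps at 1, so continuity is obtained from closed
    preimages: each is the image under \<open>e\<close> of a compact subset of
    \<open>{0..t}\<close>.\<close>
  have "closed (h -` B \<inter> sphere 0 1)" if "closed B" for B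
  proof -
    have "h -` B \<inter> sphere 0 1 = e ` ({0..t} \<inter> f -` B)"
    proof (intro set_eqI iffI)
      fix z assume z: "z \<in> h -` B \<inter> sphere 0 1"
      then obtain s where "s \<in> {0..t}" "e s = z" using e_image[of z] by blast
      moreover from this have "s \<in> {0..t} \<inter> f -` B" using he[of s] z by simp
      ultimately show "z \<in> e ` ({0..t} \<inter> f -` B)" by (intro image_eqI[of _ _ s]) simp_all
    next
      fix z assume "z \<in> e ` ({0..t} \<inter> f -` B)"
      then obtain s where "s \<in> {0..t}" "f s \<in> B" "z = e s" by (elim imageE IntE vimageE) simp
      then show "z \<in> h -` B \<inter> sphere 0 1" using he[of s] by (simp add: e_def)
    qed
    also have "compact \<dots>"
    proof (rule compact_continuous_image)
      show "continuous_on ({0..t} \<inter> f -` B) e"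
        unfolding e_def using t by (intro continuous_intros) auto
      have "closed (f -` B \<inter> {0..t})"
        using cont that continuous_on_closed_vimage[OF closed_atLeastAtMost] by blast
      then show "compact ({0..t} \<inter> f -` B)"
        using compact_Int_closed[OF compact_Icc, of "f -` B \<inter> {0..t}" 0 t]
        by (metis Int_commute Int_left_absorb)
    qed
    finally show ?thesis by (rule compact_imp_closed)
  qed
  then have "continuous_on (sphere 0 1) h"
    using continuous_on_closed_vimage[OF closed_sphere] by blast
  then show ?thesis using he that by blast
qed

text \<open>With frequencies of both signs included, the class is stable under multiplication by
  trigonometric polynomials.\<close>

definition fourier_null :: "real \<Rightarrow> (real \<Rightarrow> complex) \<Rightarrow> bool" where
  "fourier_null t f \<longleftrightarrow> continuous_on {0..t} f \<and>
     (\<forall>k::int. integral {0..t} (\<lambda>s. exp (2 * pi * \<i> * of_int k * of_real s / of_real t) * f s) = 0)"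

lemma fourier_null_add:
  assumes "t > 0" "fourier_null t f" "fourier_null t g"
  shows "fourier_null t (\<lambda>s. f s + g s)"
proof -
  have "integral {0..t} (\<lambda>s. exp (2 * pi * \<i> * of_int k * of_real s / of_real t) * (f s + g s)) = 0" for k :: int
  proof -
    have "integral {0..t} (\<lambda>s. exp (2 * pi * \<i> * of_int k * of_real s / of_real t) * f s
        + exp (2 * pi * \<i> * of_int k * of_real s / of_real t) * g s) = 0"
      using assms 
      by (subst integral_add) (auto simp: fourier_null_def intro!: integrable_continuous_real continuous_intros)
    then show ?thesis by (simp add: distrib_left)
  qed
  then show ?thesis using assms by (simp add: fourier_null_def continuous_on_add)
qed

lemma fourier_null_cmult:
  assumes "fourier_null t f"
  shows "fourier_null t (\<lambda>s. c * f s)"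
proof -
  have "integral {0..t} (\<lambda>s. exp (2 * pi * \<i> * of_int k * of_real s / of_real t) * (c * f s)) = 0" for k :: int
  proof -
    have "integral {0..t} (\<lambda>s. c * (exp (2 * pi * \<i> * of_int k * of_real s / of_real t) * f s)) = 0"
      using assms by (simp add: fourier_null_def)
    then show ?thesis by (simp add: mult_ac)
  qed
  then show ?thesis using assms by (simp add: fourier_null_def continuous_on_mult_left)
qed

lemma fourier_null_exp:
  assumes "t > 0" "fourier_null t f"
  shows "fourier_null t (\<lambda>s. exp (2 * pi * \<i> * of_int j * of_real s / of_real t) * f s)"
proof -
  have "integral {0..t} (\<lambda>s. exp (2 * pi * \<i> * of_int k * of_real s / of_real t) *
      (exp (2 * pi * \<i> * of_int j * of_real s / of_real t) * f s)) = 0" for k :: int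
  proof -
    have "integral {0..t} (\<lambda>s. exp (2 * pi * \<i> * of_int (k + j) * of_real s / of_real t) * f s) = 0"
      using assms by (simp add: fourier_null_def del: of_int_add)
    then show ?thesis by (simp add: algebra_simps exp_add add_divide_distrib)
  qed
  then show ?thesis
    using assms by (auto simp: fourier_null_def intro!: continuous_intros)
qed

text \<open>On the circle, real and imaginary parts are combinations of the point and its conjugate,
  that is, of the frequencies 1 and -1. A real polynomial in the point is therefore a trigonometric
  polynomial in \<open>s\<close>.\<close>

lemma fourier_null_real_polynomial:
  assumes t: "t > 0" and p: "real_polynomial_function p" and f: "fourier_null t f"
  shows "fourier_null t (\<lambda>s. of_real (p (exp (2 * pi * \<i> * of_real s / of_real t))) * f s)"
  using p f
proof (induction arbitrary: f)
  case (linear q)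
  let ?e = "\<lambda>s. exp (2 * pi * \<i> * of_real s / of_real t)"
  define a where "a = (of_real (q 1) - \<i> * of_real (q \<i>)) / 2"
  define b where "b = (of_real (q 1) + \<i> * of_real (q \<i>)) / 2"
  have q: "q z = Re z * q 1 + Im z * q \<i>" for z
  proof -
    have "q z = q (Re z *\<^sub>R 1 + Im z *\<^sub>R \<i>)"
      by (simp add: scaleR_conv_of_real mult.commute flip: complex_eq)
    then show ?thesis by (simp add: linear_simps[OF linear(1)])
  qed
  have "of_real (q (?e s)) = a * exp (2 * pi * \<i> * of_int 1 * of_real s / of_real t)
      + b * exp (2 * pi * \<i> * of_int (-1) * of_real s / of_real t)" for s
  proof -
    have "exp (2 * pi * \<i> * of_int (-1) * of_real s / of_real t) = cnj (?e s)"
      by (simp add: exp_cnj)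
    then show ?thesis
      by (subst q) (simp add: a_def b_def complex_eq_iff field_simps)
  qed
  then have "of_real (q (?e s)) * f s =
      a * (exp (2 * pi * \<i> * of_int 1 * of_real s / of_real t) * f s)
      + b * (exp (2 * pi * \<i> * of_int (-1) * of_real s / of_real t) * f s)" for s
    by (simp only: distrib_right mult.assoc)
  then show ?case
    by (simp only:) (intro fourier_null_add fourier_null_cmult fourier_null_exp t linear)
next
  case (const c)
  then show ?case by (simp add: fourier_null_cmult)
next
  case (add p q)
  then show ?case
    using fourier_null_add[OF t add.IH(1)[of f] add.IH(2)[of f]] by (simp add: distrib_right)
next
  case (mult p q)
  then show ?case
    using mult.IH(1)[OF mult.IH(2)[OF mult.prems]] by (simp add: mult.assoc)
qed

text \<open>Against trigonometric polynomials approximating \<open>cnj f\<close> uniformly, the integral of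
  \<open>f\<close> vanishes, hence so does that of \<open>\<bar>f\<bar>\<^sup>2\<close>.\<close>

lemma fourier_uniqueness:
  assumes t: "t > 0" and f: "fourier_null t f" and per: "f 0 = f t" and s: "s \<in> {0..t}"
  shows "f s = 0"
proof -
  have cont: "continuous_on {0..t} f" using f by (simp add: fourier_null_def)
  let ?e = "\<lambda>s. exp (2 * pi * \<i> * of_real s / of_real t)"
  have conte: "continuous_on {0..t} ?e" using t by (intro continuous_intros) auto
  \<comment> \<open>The conjugate of \<open>f\<close> transported to the circle; polynomials
    approximating it there pull back to trigonometric polynomials.\<close>
  obtain h where h: "continuous_on (sphere 0 1) h" "\<And>s. s \<in> {0..t} \<Longrightarrow> h (?e s) = cnj (f s)"
  proof (rule continuous_on_circle_factor[OF t continuous_on_cnj[OF cont]])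
    show "cnj (f 0) = cnj (f t)" by (simp add: per)
  qed (rule that)
  let ?I = "integral {0..t} (\<lambda>s. (norm (f s))\<^sup>2)"
  obtain B where B: "\<And>s. s \<in> {0..t} \<Longrightarrow> norm (f s) \<le> B"
    using compact_imp_bounded[OF compact_continuous_image[OF cont compact_Icc]]
    by (force simp: bounded_iff)
  have "?I \<le> \<epsilon> * (B * t)" if \<epsilon>: "\<epsilon> > 0" for \<epsilon>
  proof -
    obtain g where g: "polynomial_function g" "\<And>z. z \<in> sphere 0 1 \<Longrightarrow> norm (h z - g z) < \<epsilon>"
      using Stone_Weierstrass_polynomial_function[OF compact_sphere h(1) \<epsilon>] by blast
    have poly: "real_polynomial_function (Re \<circ> g)" "real_polynomial_function (Im \<circ> g)"
      using g(1) bounded_linear_Re bounded_linear_Im by (auto simp: polynomial_function_def)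
    have contg: "continuous_on X g" for X
      using g(1) by (rule continuous_on_polymonial_function)
    have gf: "fourier_null t (\<lambda>s. of_real (Re (g (?e s))) * f s + \<i> * (of_real (Im (g (?e s))) * f s))"
      using fourier_null_real_polynomial[OF t poly(1) f] fourier_null_real_polynomial[OF t poly(2) f]
      by (intro fourier_null_add fourier_null_cmult t) simp_all
    have eq: "of_real (Re (g (?e s))) * f s + \<i> * (of_real (Im (g (?e s))) * f s) = g (?e s) * f s" for s
      by (subst (3) complex_eq) (simp add: algebra_simps)
    have "fourier_null t (\<lambda>s. g (?e s) * f s)" using gf unfolding eq .
    then have int0: "integral {0..t} (\<lambda>s. g (?e s) * f s) = 0"
      by (auto simp: fourier_null_def dest: spec[of _ "0::int"])
    have contge: "continuous_on {0..t} (\<lambda>s. g (?e s))"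
      by (rule continuous_on_compose2[OF contg[of UNIV] conte]) simp
    have "of_real ?I = integral {0..t} (\<lambda>s. complex_of_real ((norm (f s))\<^sup>2))"
      using integral_linear[OF _ bounded_linear_of_real[where 'a = complex],
          of "\<lambda>s. (norm (f s))\<^sup>2" "{0..t}"]
      by (simp add: o_def integrable_continuous_real continuous_intros cont)
    also have "\<dots> = integral {0..t} (\<lambda>s. cnj (f s) * f s)"
      by (intro integral_cong, subst complex_norm_square, rule mult.commute)
    also have "\<dots> = integral {0..t} (\<lambda>s. cnj (f s) * f s) - integral {0..t} (\<lambda>s. g (?e s) * f s)"
      using int0 by simp
    also have "\<dots> = integral {0..t} (\<lambda>s. cnj (f s) * f s - g (?e s) * f s)"
      by (intro integral_diff[symmetric] integrable_continuous_real continuous_intros cont contge)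
    finally have "norm (complex_of_real ?I) = norm \<dots>" by simp
    also have "\<dots> \<le> \<epsilon> * B * (t - 0)"
    proof (rule integral_bound)
      show "continuous_on {0..t} (\<lambda>s. cnj (f s) * f s - g (?e s) * f s)"
        by (intro continuous_intros cont contge)
      fix s assume s: "s \<in> {0..t}"
      have "norm (cnj (f s) * f s - g (?e s) * f s) = norm (h (?e s) - g (?e s)) * norm (f s)"
        using h(2)[OF s] by (simp add: norm_mult flip: left_diff_distrib)
      also have "\<dots> \<le> \<epsilon> * B"
        using g(2)[of "?e s"] B[OF s] \<epsilon> by (intro mult_mono) auto
      finally show "norm (cnj (f s) * f s - g (?e s) * f s) \<le> \<epsilon> * B" .
    qed (use t in auto)
    finally show ?thesis by (simp add: abs_le_iff mult.assoc)
  qed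
  then have "?I \<le> 0 + e" if "e > 0" for e
  proof -
    have pos: "\<bar>B\<bar> * t + 1 > 0" using t by (simp add: add_nonneg_pos)
    have "?I \<le> e / (\<bar>B\<bar> * t + 1) * (B * t)"
      using that pos by (intro \<open>\<And>\<epsilon>. \<epsilon> > 0 \<Longrightarrow> ?I \<le> \<epsilon> * (B * t)\<close>) simp
    also have "\<dots> \<le> e / (\<bar>B\<bar> * t + 1) * (\<bar>B\<bar> * t + 1)"
      using that pos t by (intro mult_left_mono add_increasing2 mult_right_mono) auto
    finally show ?thesis using pos by simp
  qed
  then have "?I \<le> 0" by (rule field_le_epsilon)
  moreover have cont2: "continuous_on {0..t} (\<lambda>s. (norm (f s))\<^sup>2)"
    by (intro continuous_intros cont)
  then have "?I \<ge> 0"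
    by (intro integral_nonneg integrable_continuous_real) auto
  ultimately have "?I = 0" by (rule antisym)
  then have "\<forall>s\<in>{0..t}. (norm (f s))\<^sup>2 = 0"
    by (subst (asm) integral_eq_0_iff[OF cont2 t]) simp_all
  then show ?thesis using s by simp
qed

subsection \<open>Strongly continuous semigroups\<close>

lemma has_vector_derivative_quotient_right:
  assumes "(f has_vector_derivative d) (at (0::real))"
  shows "((\<lambda>h. (f h - f 0) /\<^sub>R h) \<longlongrightarrow> d) (at_right 0)"
proof -
  have "(\<lambda>h. norm (f h - f 0 - h *\<^sub>R d) / norm h) \<midarrow>0\<rightarrow> 0"
    using assms by (simp add: has_vector_derivative_def has_derivative_at)
  moreover have "norm (f h - f 0 - h *\<^sub>R d) / norm h = norm ((f h - f 0) /\<^sub>R h - d)" if "h \<noteq> 0" for h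
  proof -
    have "(f h - f 0) /\<^sub>R h - d = (f h - f 0 - h *\<^sub>R d) /\<^sub>R h"
      using that by (simp add: scaleR_diff_right)
    then show ?thesis by (simp add: divide_inverse mult.commute)
  qed
  ultimately have "((\<lambda>h. norm ((f h - f 0) /\<^sub>R h - d)) \<longlongrightarrow> 0) (at 0)"
    by (subst (asm) tendsto_cong) (auto simp: eventually_at_filter)
  then have "((\<lambda>h. (f h - f 0) /\<^sub>R h) \<longlongrightarrow> d) (at 0)"
    by (simp add: tendsto_norm_zero_iff LIM_zero_iff)
  then show ?thesis by (rule tendsto_mono[OF at_le, rotated]) simp
qed

locale bounded_semigroup =
  fixes S :: "real \<Rightarrow> 'a::chilbert_space \<Rightarrow>\<^sub>L 'a" and C b :: real
  assumes semigroup: "strongly_continuous_semigroup S"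
    and norm_S: "t \<ge> 0 \<Longrightarrow> norm (S t) \<le> C * exp (b * t)"
begin

lemma clin_S: "t \<ge> 0 \<Longrightarrow> clin (S t)"
  using semigroup by (simp add: strongly_continuous_semigroup_def clin_iff_clinear)

lemma S_0 [simp]: "S 0 x = x"
  using semigroup by (simp add: strongly_continuous_semigroup_def)

lemma S_add: "s \<ge> 0 \<Longrightarrow> t \<ge> 0 \<Longrightarrow> S (s + t) x = S s (S t x)"
  using semigroup by (simp add: strongly_continuous_semigroup_def)

lemma S_commute: "s \<ge> 0 \<Longrightarrow> t \<ge> 0 \<Longrightarrow> S s (S t x) = S t (S s x)"
  by (metis S_add add.commute)

text \<open>Strong continuity settles the fixed vector \<open>g0\<close>; the exponential bound
  makes the contribution of \<open>g y - g0\<close> vanish.\<close>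

lemma tendsto_S:
  assumes f: "(f \<longlongrightarrow> f0) F" and g: "(g \<longlongrightarrow> g0) F"
    and nn: "\<forall>\<^sub>F y in F. f y \<ge> 0" "f0 \<ge> 0"
  shows "((\<lambda>y. S (f y) (g y)) \<longlongrightarrow> S f0 g0) F"
proof -
  have cont: "continuous_on {0..} (\<lambda>t. S t g0)"
    using semigroup by (simp add: strongly_continuous_semigroup_def)
  have lim1: "((\<lambda>y. S (f y) g0) \<longlongrightarrow> S f0 g0) F"
    by (rule continuous_on_tendsto_compose[OF cont f]) (use nn in auto)
  have "((\<lambda>y. C * exp (b * f y) * norm (g y - g0)) \<longlongrightarrow> C * exp (b * f0) * norm (g0 - g0)) F"
    by (intro tendsto_intros f g)
  then have "((\<lambda>y. C * exp (b * f y) * norm (g y - g0)) \<longlongrightarrow> 0) F" by simp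
  moreover have "\<forall>\<^sub>F y in F. norm (S (f y) (g y - g0)) \<le> C * exp (b * f y) * norm (g y - g0)"
    using nn(1)
  proof eventually_elim
    case (elim y)
    show ?case
      by (rule order_trans[OF norm_blinfun mult_right_mono[OF norm_S[OF elim]]]) simp
  qed
  ultimately have "((\<lambda>y. S (f y) (g y - g0)) \<longlongrightarrow> 0) F"
    by (rule Lim_null_comparison[rotated])
  from tendsto_add[OF this lim1] show ?thesis by (simp add: blinfun.diff_right)
qed

lemma continuous_on_S [continuous_intros]:
  assumes "continuous_on A f" "continuous_on A g" "\<And>x. x \<in> A \<Longrightarrow> f x \<ge> 0"
  shows "continuous_on A (\<lambda>x. S (f x) (g x))"
  unfolding continuous_on_def
proof
  fix x assume "x \<in> A"
  then show "((\<lambda>x. S (f x) (g x)) \<longlongrightarrow> S (f x) (g x)) (at x within A)"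
    using assms by (intro tendsto_S) (auto simp: continuous_on_def eventually_at_topological)
qed

text \<open>If \<open>A\<close> is the generator, then \<open>(\<lambda> - A) Nint \<lambda> t = 1 - e\<^sup>-\<^sup>\<lambda>\<^sup>t S t\<close>, so this operator transfers spectral
  information between \<open>A\<close> and \<open>S t\<close>.\<close>

definition Nint :: "complex \<Rightarrow> real \<Rightarrow> 'a \<Rightarrow> 'a" where
  "Nint l t u = integral {0..t} (\<lambda>s. exp (- l * of_real s) *\<^sub>C S s u)"

lemma Nint_integrable: "(\<lambda>s. exp (- l * of_real s) *\<^sub>C S s u) integrable_on {0..t}"
  by (intro integrable_continuous_real scaleC.continuous_on continuous_intros) auto

lemma clin_Nint:
  assumes "t \<ge> 0"
  shows "clin (Blinfun (Nint l t))" "blinfun_apply (Blinfun (Nint l t)) = Nint l t"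
proof -
  have add: "Nint l t (u + v) = Nint l t u + Nint l t v" for u v
    unfolding Nint_def
    by (subst integral_add[OF Nint_integrable Nint_integrable, symmetric])
      (simp add: blinfun.add_right scaleC_add_right)
  have scale: "Nint l t (c *\<^sub>C u) = c *\<^sub>C Nint l t u" for c u
  proof -
    have "Nint l t (c *\<^sub>C u) = integral {0..t} (\<lambda>s. c *\<^sub>C exp (- l * of_real s) *\<^sub>C S s u)"
      unfolding Nint_def
      by (intro integral_cong) (simp add: clinD[OF clin_S] scaleC_scaleC mult.commute)
    also have "\<dots> = c *\<^sub>C Nint l t u"
      using integral_linear[OF Nint_integrable[of l u t] scaleC.bounded_linear_right[of c]]
      by (simp add: o_def Nint_def)
    finally show ?thesis .
  qed
  obtain B where B: "\<And>s. s \<in> {0..t} \<Longrightarrow> norm (exp (- l * of_real s)) * (C * exp (b * s)) \<le> B"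
  proof -
    have "bounded ((\<lambda>s. norm (exp (- l * of_real s)) * (C * exp (b * s))) ` {0..t})"
      by (intro compact_imp_bounded compact_continuous_image continuous_intros) auto
    then obtain a where "\<forall>s\<in>{0..t}. norm (norm (exp (- l * of_real s)) * (C * exp (b * s))) \<le> a"
      unfolding bounded_iff by blast
    then show ?thesis using that[of a] abs_le_D1 unfolding real_norm_def by blast
  qed
  have bound: "norm (Nint l t u) \<le> norm u * (B * t)" for u
  proof -
    have "norm (Nint l t u) \<le> B * norm u * (t - 0)"
      unfolding Nint_def
    proof (rule integral_bound[OF assms])
      show "continuous_on {0..t} (\<lambda>s. exp (- l * of_real s) *\<^sub>C S s u)"
        by (intro scaleC.continuous_on continuous_intros) auto
      fix s assume s: "s \<in> {0..t}"
      have "norm (exp (- l * of_real s) *\<^sub>C S s u)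
          \<le> norm (exp (- l * of_real s)) * ((C * exp (b * s)) * norm u)"
        unfolding norm_scaleC
        by (intro mult_left_mono order_trans[OF norm_blinfun] mult_right_mono norm_S) (use s in auto)
      also have "\<dots> \<le> B * norm u"
        using mult_right_mono[OF B[OF s], of "norm u"] by (simp add: mult.assoc)
      finally show "norm (exp (- l * of_real s) *\<^sub>C S s u) \<le> B * norm u" .
    qed
    then show ?thesis by (simp add: mult_ac)
  qed
  have "bounded_linear (Nint l t)"
    by (rule bounded_linear_intro[OF add _ bound]) (simp add: scaleR_scaleC scale)
  then show "blinfun_apply (Blinfun (Nint l t)) = Nint l t"
    by (rule bounded_linear_Blinfun_apply)
  then show "clin (Blinfun (Nint l t))" by (simp add: clin_def scale)
qed

lemma Nint_commute:
  assumes "t \<ge> 0" "h \<ge> 0"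
  shows "S h (Nint l t u) = Nint l t (S h u)"
proof -
  have "S h (Nint l t u) = integral {0..t} (\<lambda>s. S h (exp (- l * of_real s) *\<^sub>C S s u))"
    unfolding Nint_def by (rule integral_blinfun_apply[symmetric]) (rule Nint_integrable)
  also have "\<dots> = Nint l t (S h u)"
    unfolding Nint_def using assms
    by (intro integral_cong) (simp add: clinD[OF clin_S] S_commute)
  finally show ?thesis .
qed

text \<open>As \<open>S h\<close> shifts the integrand, \<open>S h (Nint l t u)\<close> is exp(l h)
  times the integral of \<open>T\<close> over [h, t + h]; the product rule at h = 0 gives the
  limit.\<close>

lemma Nint_derivative:
  assumes t: "t \<ge> 0"
  shows "((\<lambda>h. (S h (Nint l t u) - Nint l t u) /\<^sub>R h)
    \<longlongrightarrow> l *\<^sub>C Nint l t u - (u - exp (- l * of_real t) *\<^sub>C S t u)) (at_right 0)"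
proof -
  \<comment> \<open>Freezing the semigroup at time 0 for negative \<open>s\<close>, and integrating
    from -1, gives a primitive that is differentiable at 0 from both sides.\<close>
  define T where "T s = exp (- l * of_real s) *\<^sub>C S (max 0 s) u" for s
  have contT: "continuous_on A T" for A
    unfolding T_def by (intro scaleC.continuous_on continuous_intros) auto
  have intT: "T integrable_on {c..d}" for c d
    by (intro integrable_continuous_real contT)
  define F where "F x = integral {-1..x} T" for x
  have F': "(F has_vector_derivative T x) (at x)" if "x > -1" for x
  proof -
    have "(F has_vector_derivative T x) (at x within {-1..x+1})"
      unfolding F_def by (rule integral_has_vector_derivative[OF contT]) (use that in auto)
    moreover have "at x within {-1..x+1} = at x"
      using that by (intro at_within_Icc_at) auto
    ultimately show ?thesis by simp
  qed
  define G where "G h = exp (l * of_real h) *\<^sub>C (F (t + h) - F h)" for h :: real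
  have F_t: "((\<lambda>h. F (t + h)) has_vector_derivative T t) (at 0)"
  proof -
    have "((\<lambda>h. t + h) has_vector_derivative 1) (at 0)"
      by (auto intro!: derivative_eq_intros)
    from vector_diff_chain_at[OF this, of F "T t"] F'[of t] t show ?thesis by (simp add: o_def)
  qed
  have exp': "((\<lambda>h. exp (l * of_real h)) has_vector_derivative l) (at 0)"
  proof -
    have "((\<lambda>z. exp (l * z)) has_field_derivative l) (at (of_real 0))"
      by (auto intro!: derivative_eq_intros)
    then show ?thesis by (rule has_vector_derivative_real_field)
  qed
  have F_eq: "F y - F x = integral {x..y} T" if "-1 \<le> x" "x \<le> y" for x y
    using Henstock_Kurzweil_Integration.integral_combine[OF that intT] by (simp add: F_def algebra_simps)
  have F_Nint: "F t - F 0 = Nint l t u"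
    using t by (subst F_eq) (auto simp: Nint_def T_def intro!: integral_cong)
  have "(G has_vector_derivative exp (l * of_real 0) *\<^sub>C (T t - T 0) + l *\<^sub>C (F (t + 0) - F 0)) (at 0)"
    unfolding G_def
    by (intro scaleC.has_vector_derivative exp' has_vector_derivative_diff F_t F') simp
  then have "((\<lambda>h. (G h - G 0) /\<^sub>R h) \<longlongrightarrow> (T t - T 0) + l *\<^sub>C Nint l t u) (at_right 0)"
    using F_Nint by (intro has_vector_derivative_quotient_right) (simp add: scaleC_one)
  moreover have "G h = S h (Nint l t u)" if "h \<ge> 0" for h
  proof -
    have "S h (Nint l t u) = integral {0..t} (\<lambda>s. S h (exp (- l * of_real s) *\<^sub>C S s u))"
      unfolding Nint_def by (rule integral_blinfun_apply[symmetric]) (rule Nint_integrable)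
    also have "\<dots> = integral {0..t} (\<lambda>s. exp (l * of_real h) *\<^sub>C T (h + s))"
    proof (rule integral_cong)
      fix s assume "s \<in> {0..t}"
      then show "S h (exp (- l * of_real s) *\<^sub>C S s u) = exp (l * of_real h) *\<^sub>C T (h + s)"
        using that by (simp add: T_def clinD[OF clin_S] S_add scaleC_scaleC algebra_simps flip: exp_add)
    qed
    also have "\<dots> = exp (l * of_real h) *\<^sub>C integral {0..t} (T \<circ> (+) h)"
    proof -
      have "(T \<circ> (+) h) integrable_on {0..t}"
        by (intro integrable_continuous_real continuous_on_compose contT continuous_intros)
      from integral_linear[OF this scaleC.bounded_linear_right] show ?thesis by (simp add: o_def)
    qed
    also have "integral {0..t} (T \<circ> (+) h) = integral {h..t+h} T"
      using integral_shift_Icc_real[of 0 t T h] by simp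
    also have "\<dots> = F (t + h) - F h" using that t by (intro F_eq[symmetric]) auto
    finally show ?thesis by (simp add: G_def)
  qed
  ultimately have "((\<lambda>h. (S h (Nint l t u) - Nint l t u) /\<^sub>R h) \<longlongrightarrow> (T t - T 0) + l *\<^sub>C Nint l t u) (at_right 0)"
    by (subst tendsto_cong[of _ "\<lambda>h. (G h - G 0) /\<^sub>R h"])
      (auto simp: eventually_at_filter)
  then show ?thesis using t by (simp add: T_def scaleC_one algebra_simps)
qed

end

section \<open>Generators and the transfer of spectral information\<close>

locale semigroup_generator = bounded_semigroup S C b
  for S :: "real \<Rightarrow> 'a::chilbert_space \<Rightarrow>\<^sub>L 'a" and C b +
  fixes D :: "'a set" and A :: "'a \<Rightarrow> 'a"
  assumes gen: "generates D A S" and lin: "linear_operator D A"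
begin

lemma gen_iff: "((\<lambda>h. (S h u - u) /\<^sub>R h) \<longlongrightarrow> v) (at_right 0) \<longleftrightarrow> u \<in> D \<and> A u = v"
  using gen by (simp add: generates_def)

lemma gen_lim: "u \<in> D \<Longrightarrow> ((\<lambda>h. (S h u - u) /\<^sub>R h) \<longlongrightarrow> A u) (at_right 0)"
  using gen_iff by blast

lemma S_generator:
  assumes "u \<in> D" "t \<ge> 0"
  shows "S t u \<in> D" "A (S t u) = S t (A u)"
proof -
  have "((\<lambda>h. S t ((S h u - u) /\<^sub>R h)) \<longlongrightarrow> S t (A u)) (at_right 0)"
    by (intro tendsto_intros gen_lim assms)
  then have "((\<lambda>h. (S h (S t u) - S t u) /\<^sub>R h) \<longlongrightarrow> S t (A u)) (at_right 0)"
    by (rule Lim_transform_eventually)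
      (use assms in \<open>auto simp: eventually_at_filter blinfun.scaleR_right blinfun.diff_right S_commute\<close>)
  then show "S t u \<in> D" "A (S t u) = S t (A u)" by (simp_all add: gen_iff)
qed

lemma Nint_right:
  assumes "t \<ge> 0"
  shows "Nint l t u \<in> D" "l *\<^sub>C Nint l t u - A (Nint l t u) = u - exp (- l * of_real t) *\<^sub>C S t u"
  using Nint_derivative[OF assms, of l u] by (simp_all add: gen_iff)

text \<open>\<open>Nint l t\<close> is bounded and commutes with each \<open>S h\<close>, so it
  commutes with the generator on \<open>D\<close>.\<close>

lemma Nint_left:
  assumes "u \<in> D" "t \<ge> 0"
  shows "Nint l t (l *\<^sub>C u - A u) = u - exp (- l * of_real t) *\<^sub>C S t u"
proof -
  note N = clin_Nint[OF assms(2), of l]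
  let ?N = "Blinfun (Nint l t)"
  have "((\<lambda>h. ?N ((S h u - u) /\<^sub>R h)) \<longlongrightarrow> ?N (A u)) (at_right 0)"
    by (intro tendsto_intros gen_lim assms)
  moreover have "?N (S h u) = S h (?N u)" if "h \<ge> 0" for h
    using that assms by (simp add: N(2) Nint_commute)
  ultimately have "((\<lambda>h. (S h (?N u) - ?N u) /\<^sub>R h) \<longlongrightarrow> ?N (A u)) (at_right 0)"
    by (elim Lim_transform_eventually)
      (auto simp: eventually_at_filter blinfun.scaleR_right blinfun.diff_right)
  then have "A (?N u) = ?N (A u)" by (simp add: gen_iff)
  then have "?N (l *\<^sub>C u - A u) = l *\<^sub>C ?N u - A (?N u)"
    by (simp add: blinfun.diff_right clinD[OF N(1)])
  then show ?thesis using Nint_right(2)[OF assms(2)] by (simp add: N(2))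
qed

text \<open>Comes from \<open>Nint_left\<close>, in which \<open>l *\<^sub>C u - A u\<close>
  vanishes.\<close>

lemma eigenvector_S:
  assumes "u \<in> D" "A u = l *\<^sub>C u" "t \<ge> 0"
  shows "S t u = exp (l * of_real t) *\<^sub>C u"
proof -
  have "Nint l t 0 = 0"
    using clin_Nint(2)[OF assms(3), of l] blinfun.zero_right[of "Blinfun (Nint l t)"] by simp
  then have "exp (- l * of_real t) *\<^sub>C S t u = u"
    using Nint_left[OF assms(1,3), of l] assms(2) by simp
  then have "exp (l * of_real t) *\<^sub>C exp (- l * of_real t) *\<^sub>C S t u = exp (l * of_real t) *\<^sub>C u"
    by simp
  then show ?thesis by (simp add: scaleC_scaleC scaleC_one flip: exp_add)
qed

text \<open>Contrapositive of the inclusion of exp(t \<sigma>(A)) in \<sigma>(S t). Following the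
  inverse \<open>W\<close> of \<open>?V\<close> by \<open>Nint l t\<close> gives a right inverse of
  l - A; \<open>Nint_left\<close> and injectivity of \<open>?V\<close> make it a left
  inverse.\<close>

lemma spectral_inclusion:
  assumes t: "t \<ge> 0" and inv: "cinvertible (id_blinfun - exp (- l * of_real t) *\<^sub>C S t)" (is "cinvertible ?V")
  shows "l \<in> resolvent_set D A"
proof -
  obtain W where W: "clin W" "\<And>x. ?V (blinfun_apply W x) = x" "\<And>x. W (?V x) = x"
    using cinvertibleE[OF inv] by blast
  have V: "?V x = x - exp (- l * of_real t) *\<^sub>C S t x" for x
    by (simp add: blinfun.diff_left blinfun_apply_scaleC)
  let ?R = "Blinfun (Nint l t) o\<^sub>L W"
  have R: "?R y = Nint l t (W y)" for y by (simp add: clin_Nint(2)[OF t])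
  have dom: "?R y \<in> D" for y unfolding R by (rule Nint_right(1)[OF t])
  have right: "l *\<^sub>C ?R y - A (?R y) = y" for y
    unfolding R by (simp only: Nint_right(2)[OF t] V[symmetric] W(2))
  have left: "?R (l *\<^sub>C u - A u) = u" if u: "u \<in> D" for u
  proof -
    let ?w = "?R (l *\<^sub>C u - A u)"
    have "l *\<^sub>C ?w - A ?w = l *\<^sub>C u - A u" by (rule right)
    then have "?V ?w = ?V u"
      unfolding V by (metis Nint_left[OF _ t] dom u)
    then show ?thesis by (metis W(3))
  qed
  show ?thesis by (rule resolvent_eqI(1)[OF dom right left])
qed

text \<open>If \<open>S t u = \<mu> u\<close> then \<open>s \<mapsto> e\<^sup>-\<^sup>\<lambda>\<^sup>s S s u\<close> is \<open>t\<close>-periodic for \<open>e\<^sup>\<lambda>\<^sup>t = \<mu>\<close>, and its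
  Fourier coefficients are eigenvectors of the generator.\<close>

lemma point_spectral_mapping:
  assumes t: "t > 0" and u: "u \<noteq> 0" "S t u = \<mu> *\<^sub>C u" and \<mu>: "\<mu> \<noteq> 0"
  obtains l where "exp (of_real t * l) = \<mu>" "Nint l t u \<in> D" "Nint l t u \<noteq> 0"
    "A (Nint l t u) = l *\<^sub>C Nint l t u"
proof -
  define l0 where "l0 = Ln \<mu> / of_real t"
  have l0: "exp (of_real t * l0) = \<mu>" using t \<mu> by (simp add: l0_def)
  \<comment> \<open>All exponents with exp(t l) = \<mu>; they differ by the Fourier frequencies of
    period \<open>t\<close>.\<close>
  define l where "l k = l0 - 2 * of_real pi * \<i> * of_int k / of_real t" for k :: int
  have expl: "exp (of_real t * l k) = \<mu>" for k
  proof -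
    have "of_real t * l k = of_real t * l0 - 2 * of_real pi * \<i> * of_int k" using t by (simp add: l_def field_simps)
    moreover have "exp (2 * of_real pi * \<i> * of_int k) = 1"
      using exp_integer_2pi[of "of_int k"] by (simp add: mult_ac)
    ultimately show ?thesis by (simp add: exp_diff l0)
  qed
  have eig: "l k *\<^sub>C Nint (l k) t u = A (Nint (l k) t u)" for k
  proof -
    have "exp (- l k * of_real t) * \<mu> = 1"
      using expl[of k] \<mu> by (simp add: exp_minus mult.commute)
    then show ?thesis
      using Nint_right(2)[of t "l k" u] t u by (simp add: scaleC_scaleC scaleC_one)
  qed
  have "\<exists>k. Nint (l k) t u \<noteq> 0"
  proof (rule ccontr)
    assume "\<not> ?thesis"
    then have zero: "Nint (l k) t u = 0" for k by simp
    \<comment> \<open>If all coefficients vanished, Fourier uniqueness would annihilate this scalar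
      function, although \<open>f 0\<close> is the squared norm of \<open>u\<close>.\<close>
    define f where "f s = cinner (exp (- l0 * of_real s) *\<^sub>C S s u) u" for s
    have null: "fourier_null t f"
      unfolding fourier_null_def
    proof (intro conjI allI)
      show "continuous_on {0..t} f"
        unfolding f_def by (intro cinner.continuous_on scaleC.continuous_on continuous_intros) auto
      fix k :: int
      have "integral {0..t} (\<lambda>s. exp (complex_of_real (2 * pi) * \<i> * of_int k * of_real s / of_real t) * f s)
        = integral {0..t} ((\<lambda>x. cinner x u) \<circ> (\<lambda>s. exp (- l k * of_real s) *\<^sub>C S s u))"
        by (intro integral_cong)
          (simp add: f_def l_def cinner_scaleC_left algebra_simps flip: exp_add)
      also have "\<dots> = cinner (Nint (l k) t u) u"
        unfolding Nint_def by (rule integral_linear[OF Nint_integrable cinner.bounded_linear_left])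
      finally show "integral {0..t} (\<lambda>s. exp (complex_of_real (2 * pi) * \<i> * of_int k * of_real s / of_real t) * f s) = 0"
        by (simp add: zero)
    qed
    have "f 0 = f t"
      using l0 \<mu> u by (simp add: f_def cinner_scaleC_left exp_minus scaleC_one mult.commute)
    from fourier_uniqueness[OF t null this, of 0] t have "cinner u u = 0"
      by (simp add: f_def scaleC_one)
    then show False using u by (simp add: cinner_self)
  qed
  then obtain k where "Nint (l k) t u \<noteq> 0" by blast
  then show ?thesis using that[of "l k"] expl eig Nint_right(1)[of t "l k" u] t by simp
qed

end

subsection \<open>Bounded perturbations of semigroups\<close>

locale perturbed_semigroup = bounded_semigroup S C b
  for S :: "real \<Rightarrow> 'a::chilbert_space \<Rightarrow>\<^sub>L 'a" and C b +
  fixes K :: "'a \<Rightarrow>\<^sub>L 'a"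
  assumes clin_K: "clin K"
begin

section \<open>The Volterra convolution in exponentially weighted norms\<close>

definition conv :: "(real \<Rightarrow> 'a) \<Rightarrow> real \<Rightarrow> 'a" where
  "conv f t = integral {0..t} (\<lambda>s. S (t - s) (K (f s)))"

text \<open>The convolution divided by \<open>t\<close>, rescaled to the fixed interval [0, 1]:
  continuity in \<open>t\<close> becomes that of a parameter integral, and the value
  \<open>K (f 0)\<close> at 0 is the right derivative of \<open>conv f\<close> there.\<close>

definition conv_mean :: "(real \<Rightarrow> 'a) \<Rightarrow> real \<Rightarrow> 'a" where
  "conv_mean f t = integral {0..1} (\<lambda>\<sigma>. S (t - t * \<sigma>) (K (f (t * \<sigma>))))"

lemma C_nonneg: "C \<ge> 0"
  using order_trans[OF norm_ge_zero norm_S[of 0]] by simp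

lemma conv_continuous_integrand:
  assumes "continuous_on {0..} f" "X \<subseteq> {0..t}"
  shows "continuous_on X (\<lambda>s. S (t - s) (K (f s)))"
  using assms
  by (intro continuous_on_S continuous_on_diff continuous_on_const continuous_on_id
      bounded_linear.continuous_on[OF blinfun.bounded_linear_right] continuous_on_subset[OF assms(1)]) auto

lemma conv_integrable:
  assumes "continuous_on {0..} f" "c \<ge> 0" "d \<le> t"
  shows "(\<lambda>s. S (t - s) (K (f s))) integrable_on {c..d}"
  using assms by (intro integrable_continuous_real conv_continuous_integrand) auto

lemma conv_eq_mean:
  assumes "t \<ge> 0"
  shows "conv f t = t *\<^sub>R conv_mean f t"
proof (cases "t = 0")
  case False
  then have "(\<lambda>x. x / t) ` {0..t} = {0..1}"
    using assms by (subst image_divide_atLeastAtMost) auto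
  then show ?thesis
    using integral_stretch_real[of t 0 t "\<lambda>s. S (t - s) (K (f s))"] False assms
    by (simp add: conv_def conv_mean_def)
qed (simp add: conv_def)

lemma conv_mean_continuous:
  assumes "continuous_on {0..} f"
  shows "continuous_on {0..} (conv_mean f)"
proof -
  have "continuous_on ({0..} \<times> cbox 0 1) (\<lambda>(t, \<sigma>). S (t - t * \<sigma>) (K (f (t * \<sigma>))))"
    unfolding split_beta
  proof (rule continuous_on_S)
    have "continuous_on ({0..} \<times> cbox 0 1) (\<lambda>p. f (fst p * snd p))"
      by (rule continuous_on_compose2[OF assms]) (auto intro!: continuous_intros)
    then show "continuous_on ({0..} \<times> cbox 0 1) (\<lambda>p. K (f (fst p * snd p)))"
      by (rule bounded_linear.continuous_on[OF blinfun.bounded_linear_right])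
    show "continuous_on ({0..} \<times> cbox 0 1) (\<lambda>p::real \<times> real. fst p - fst p * snd p)"
      by (intro continuous_intros)
    show "0 \<le> fst p - fst p * snd p" if "p \<in> {0..} \<times> cbox 0 1" for p :: "real \<times> real"
      using that by (auto simp: mult_left_le)
  qed
  from integral_continuous_on_param[OF this] show ?thesis
    by (simp add: conv_mean_def[abs_def])
qed

lemma conv_continuous:
  assumes "continuous_on {0..} f"
  shows "continuous_on {0..} (conv f)"
proof -
  have "continuous_on {0..} (\<lambda>t. t *\<^sub>R conv_mean f t)"
    by (intro continuous_intros conv_mean_continuous assms)
  then show ?thesis by (rule continuous_on_eq) (simp add: conv_eq_mean)
qed

lemma conv_diff:
  assumes "continuous_on {0..} f" "continuous_on {0..} g"
  shows "conv (\<lambda>s. f s - g s) t = conv f t - conv g t"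
  unfolding conv_def
  by (subst integral_diff[OF conv_integrable conv_integrable, symmetric])
    (auto simp: assms blinfun.diff_right)

lemma conv_add:
  assumes "continuous_on {0..} f" "continuous_on {0..} g"
  shows "conv (\<lambda>s. f s + g s) t = conv f t + conv g t"
  unfolding conv_def
  by (subst Henstock_Kurzweil_Integration.integral_add[OF conv_integrable conv_integrable, symmetric])
    (auto simp: assms blinfun.add_right)

lemma conv_scaleC:
  assumes "continuous_on {0..} f"
  shows "conv (\<lambda>s. c *\<^sub>C f s) t = c *\<^sub>C conv f t"
proof -
  have "conv (\<lambda>s. c *\<^sub>C f s) t = integral {0..t} ((*\<^sub>C) c \<circ> (\<lambda>s. S (t - s) (K (f s))))"
    unfolding conv_def by (intro integral_cong) (simp add: clinD[OF clin_K] clinD[OF clin_S])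
  also have "\<dots> = c *\<^sub>C conv f t"
    unfolding conv_def by (intro integral_linear conv_integrable assms scaleC.bounded_linear_right) auto
  finally show ?thesis .
qed

text \<open>In the norm weighted by exp(-\<beta> s) the convolution has size at most
  \<open>C * norm K / (\<beta> - b)\<close>, which a large \<open>\<beta>\<close> makes small
  uniformly in time.\<close>

lemma conv_bound:
  assumes f: "continuous_on {0..} f" and t: "t \<ge> 0" and \<beta>: "\<beta> > b" and m: "m \<ge> 0"
    and bound: "\<And>s. 0 \<le> s \<Longrightarrow> s \<le> t \<Longrightarrow> norm (f s) \<le> m * exp (\<beta> * s)"
  shows "norm (conv f t) \<le> C * norm K / (\<beta> - b) * m * exp (\<beta> * t)"
proof -
  define G where "G s = C * norm K * m * exp (b * t) * exp ((\<beta> - b) * s) / (\<beta> - b)" for s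
  define g where "g s = C * norm K * m * exp (b * t) * exp ((\<beta> - b) * s)" for s
  have "(g has_integral G t - G 0) {0..t}"
    unfolding G_def g_def
    by (rule fundamental_theorem_of_calculus[OF t])
      (use \<beta> in \<open>auto intro!: derivative_eq_intros simp flip: has_real_derivative_iff_has_vector_derivative\<close>)
  moreover have "norm (conv f t) \<le> integral {0..t} g"
    unfolding conv_def
  proof (rule integral_norm_bound_integral)
    show "g integrable_on {0..t}" using calculation by blast
    fix s assume s: "s \<in> {0..t}"
    have "norm (S (t - s) (K (f s))) \<le> norm (S (t - s)) * (norm K * norm (f s))"
      by (rule order_trans[OF norm_blinfun mult_left_mono[OF norm_blinfun]]) simp
    also have "\<dots> \<le> (C * exp (b * (t - s))) * (norm K * (m * exp (\<beta> * s)))"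
      using s by (intro mult_mono norm_S mult_left_mono bound) (auto simp: C_nonneg)
    also have "\<dots> = g s"
      by (simp add: g_def algebra_simps flip: exp_add)
    finally show "norm (S (t - s) (K (f s))) \<le> g s" .
  qed (intro conv_integrable f; simp)
  moreover have "G 0 \<ge> 0" using \<beta> m C_nonneg by (simp add: G_def)
  moreover have "G t = C * norm K / (\<beta> - b) * m * exp (\<beta> * t)"
    by (simp add: G_def algebra_simps flip: exp_add)
  ultimately show ?thesis by (simp add: integral_unique)
qed

text \<open>Chosen so that the weighted norm of the convolution is at most 1/2; the summand 1 keeps
  \<open>rate\<close> above \<open>b\<close> when \<open>K\<close> is 0.\<close>

definition rate :: real where "rate = b + 1 + 2 * C * norm K"

lemma rate_gt: "rate > b"
proof -
  have "0 \<le> 2 * C * norm K" using C_nonneg by simp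
  then show ?thesis unfolding rate_def by linarith
qed

lemma rate_half: "C * norm K / (rate - b) \<le> 1 / 2"
proof -
  have "0 \<le> C * norm K" using C_nonneg by simp
  then have "C * norm K / (1 + 2 * (C * norm K)) \<le> 1 / 2" by (simp add: field_simps)
  then show ?thesis by (simp add: rate_def mult.assoc)
qed

lemma conv_bound_half:
  assumes f: "continuous_on {0..} f" and t: "t \<ge> 0" and m: "m \<ge> 0"
    and bound: "\<And>s. 0 \<le> s \<Longrightarrow> s \<le> t \<Longrightarrow> norm (f s) \<le> m * exp (rate * s)"
  shows "norm (conv f t) \<le> 1/2 * m * exp (rate * t)"
proof (rule order_trans[OF conv_bound[OF f t rate_gt m bound]])
  show "C * norm K / (rate - b) * m * exp (rate * t) \<le> 1/2 * m * exp (rate * t)"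
    by (intro mult_right_mono rate_half m) simp
qed

text \<open>At a point of [0, T] where the weighted norm is maximal, the factor 1/2 forces the
  maximum to be 0. The maximum exists for continuous \<open>x\<close> of any growth, so uniqueness
  holds among all continuous solutions.\<close>

lemma conv_fixed_point_zero:
  assumes x: "continuous_on {0..} x" and eq: "\<And>t. t \<ge> 0 \<Longrightarrow> x t = conv x t" and T: "T \<ge> 0"
  shows "x T = 0"
proof -
  have "continuous_on {0..T} (\<lambda>s. exp (- rate * s) * norm (x s))"
    using x by (auto intro!: continuous_intros intro: continuous_on_subset)
  from continuous_attains_sup[OF compact_Icc _ this] obtain s0 where s0: "s0 \<in> {0..T}"
    and max: "\<And>s. s \<in> {0..T} \<Longrightarrow> exp (- rate * s) * norm (x s) \<le> exp (- rate * s0) * norm (x s0)"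
    using T by auto
  define m where "m = exp (- rate * s0) * norm (x s0)"
  have m: "m \<ge> 0" by (simp add: m_def)
  have bound: "norm (x s) \<le> m * exp (rate * s)" if "0 \<le> s" "s \<le> T" for s
    using max[of s] that by (simp add: m_def exp_minus field_simps)
  have "norm (conv x s0) \<le> 1/2 * m * exp (rate * s0)"
    using s0 by (intro conv_bound_half x m bound) auto
  then have "norm (x s0) \<le> 1/2 * m * exp (rate * s0)" using eq s0 by simp
  then have "m \<le> 1/2 * m" by (simp add: m_def exp_minus field_simps)
  then have "m = 0" using m by simp
  then show ?thesis using bound[of T] T by simp
qed

text \<open>Banach's fixed point theorem for y(t) = exp(-rate t) x(t) among bounded continuous
  functions, where the integral equation is a contraction with factor 1/2.\<close>

lemma solution_exists:
  "\<exists>x. continuous_on {0..} x \<and> (\<forall>t\<ge>0. x t = S t u + conv x t) \<and>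
    (\<forall>t\<ge>0. norm (x t) \<le> 2 * C * norm u * exp (rate * t))"
proof -
  define grow :: "(real \<Rightarrow>\<^sub>C 'a) \<Rightarrow> real \<Rightarrow> 'a" where "grow y s = exp (rate * s) *\<^sub>R y s" for y s
  have grow_cont: "continuous_on {0..} (grow y)" for y
    unfolding grow_def by (intro continuous_intros continuous_on_apply_bcontfun)
  \<comment> \<open>Bounded continuous functions live on the whole real line, so
    \<open>max 0 t\<close> extends the problem by a constant to negative times.\<close>
  define \<phi> where "\<phi> y t = exp (- rate * max 0 t) *\<^sub>R (S (max 0 t) u + conv (grow y) (max 0 t))" for y t
  have conv_norm: "norm (conv (\<lambda>s. grow y s - grow z s) t) \<le> 1/2 * dist y z * exp (rate * t)" if "t \<ge> 0" for y z t
  proof (rule conv_bound_half)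
    fix s :: real
    show "norm (grow y s - grow z s) \<le> dist y z * exp (rate * s)"
      using dist_bounded[of y s z] by (simp add: grow_def dist_norm flip: scaleR_diff_right)
  qed (use that grow_cont in \<open>auto intro!: continuous_intros\<close>)
  have weaken: "exp (- rate * t) * a \<le> c" if "a \<le> c * exp (rate * t)" for a c t
    using that by (simp add: exp_minus field_simps)
  have \<phi>_dist: "norm (\<phi> y t - \<phi> z t) \<le> 1/2 * dist y z" for y z t
  proof -
    have "\<phi> y t - \<phi> z t = exp (- rate * max 0 t) *\<^sub>R conv (\<lambda>s. grow y s - grow z s) (max 0 t)"
      by (simp add: \<phi>_def conv_diff[OF grow_cont grow_cont] algebra_simps)
    then show ?thesis
      using weaken[OF conv_norm[of "max 0 t" y z]] by simp
  qed
  have \<phi>_norm: "norm (\<phi> y t) \<le> C * norm u + 1/2 * dist y 0" for y t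
  proof -
    have "norm (S (max 0 t) u) \<le> C * norm u * exp (rate * max 0 t)"
    proof -
      have "norm (S (max 0 t) u) \<le> C * exp (b * max 0 t) * norm u"
        by (rule order_trans[OF norm_blinfun mult_right_mono[OF norm_S]]) auto
      also have "\<dots> \<le> C * exp (rate * max 0 t) * norm u"
        using rate_gt C_nonneg by (intro mult_left_mono mult_right_mono) (auto intro: mult_right_mono)
      finally show ?thesis by (simp add: mult_ac)
    qed
    moreover have "norm (conv (grow y) (max 0 t)) \<le> 1/2 * dist y 0 * exp (rate * max 0 t)"
    proof -
      have "(\<lambda>s. grow y s - grow 0 s) = grow y" by (rule ext) (simp add: grow_def)
      then show ?thesis using conv_norm[of "max 0 t" y 0] by simp
    qed
    ultimately have "norm (S (max 0 t) u + conv (grow y) (max 0 t))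
        \<le> (C * norm u + 1/2 * dist y 0) * exp (rate * max 0 t)"
      by (intro norm_triangle_le) (simp add: algebra_simps)
    from weaken[OF this] show ?thesis by (simp add: \<phi>_def)
  qed
  have "\<phi> y \<in> bcontfun" for y
  proof -
    have "continuous_on UNIV (\<lambda>t. conv (grow y) (max 0 t))"
      by (rule continuous_on_compose2[OF conv_continuous[OF grow_cont]]) (auto intro!: continuous_intros)
    then have "continuous_on UNIV (\<phi> y)"
      unfolding \<phi>_def by (intro continuous_intros) auto
    then show ?thesis
      using \<phi>_norm by (auto simp: bcontfun_def bounded_iff)
  qed
  then have app: "apply_bcontfun (Bcontfun (\<phi> y)) = \<phi> y" for y by (rule Bcontfun_inverse)
  have "\<exists>!y. Bcontfun (\<phi> y) = y"
  proof (rule banach_fix_type[of "1/2"])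
    show "\<forall>y z. dist (Bcontfun (\<phi> y)) (Bcontfun (\<phi> z)) \<le> 1/2 * dist y z"
      using \<phi>_dist by (intro allI dist_bound) (simp add: app dist_norm)
  qed auto
  then obtain y where y: "Bcontfun (\<phi> y) = y" by blast
  then have y_eq: "apply_bcontfun y = \<phi> y" by (metis app)
  show ?thesis
  proof (intro exI[of _ "grow y"] conjI allI impI grow_cont)
    fix t :: real assume t: "t \<ge> 0"
    show "grow y t = S t u + conv (grow y) t"
      unfolding grow_def[of y t] y_eq using t
      by (simp add: \<phi>_def[of y t] flip: exp_add)
    \<comment> \<open>The fixed point satisfies d \<le> C |u| + d/2, whence the factor 2 in the
      bound.\<close>
    have "dist y 0 \<le> C * norm u + 1/2 * dist y 0"
      by (rule dist_bound) (use \<phi>_norm[of y] in \<open>simp add: y_eq\<close>)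
    then have "dist y 0 \<le> 2 * C * norm u" by simp
    moreover have "norm (y t) \<le> dist y 0" using dist_bounded[of y t 0] by simp
    ultimately have "norm (y t) \<le> 2 * C * norm u" by simp
    then show "norm (grow y t) \<le> 2 * C * norm u * exp (rate * t)"
      by (simp add: grow_def mult.commute)
  qed
qed

section \<open>The perturbed semigroup and its generator\<close>

definition sol :: "'a \<Rightarrow> real \<Rightarrow> 'a" where
  "sol u = (SOME x. continuous_on {0..} x \<and> (\<forall>t\<ge>0. x t = S t u + conv x t) \<and>
    (\<forall>t\<ge>0. norm (x t) \<le> 2 * C * norm u * exp (rate * t)))"

lemma sol_continuous: "continuous_on {0..} (sol u)"
  and sol_eq: "t \<ge> 0 \<Longrightarrow> sol u t = S t u + conv (sol u) t"
  and sol_bound: "t \<ge> 0 \<Longrightarrow> norm (sol u t) \<le> 2 * C * norm u * exp (rate * t)"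
  using someI_ex[OF solution_exists[of u]] by (auto simp: sol_def)

lemma sol_unique:
  assumes x: "continuous_on {0..} x" and eq: "\<And>t. t \<ge> 0 \<Longrightarrow> x t = S t u + conv x t" and t: "t \<ge> 0"
  shows "x t = sol u t"
proof -
  have "x t - sol u t = 0"
  proof (rule conv_fixed_point_zero[OF _ _ t])
    show "continuous_on {0..} (\<lambda>t. x t - sol u t)"
      by (intro continuous_intros x sol_continuous)
    show "x s - sol u s = conv (\<lambda>t. x t - sol u t) s" if "s \<ge> 0" for s
      unfolding conv_diff[OF x sol_continuous] using eq[OF that] sol_eq[OF that, of u] by simp
  qed
  then show ?thesis by simp
qed

definition pert :: "real \<Rightarrow> 'a \<Rightarrow>\<^sub>L 'a" where "pert t = Blinfun (\<lambda>u. sol u t)"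

text \<open>Sums and multiples of solutions solve the equation for the corresponding initial
  vectors, so uniqueness gives linearity.\<close>

lemma
  assumes t: "t \<ge> 0"
  shows pert_apply: "pert t u = sol u t" and clin_pert: "clin (pert t)"
    and norm_pert: "norm (pert t) \<le> 2 * C * exp (rate * t)"
proof -
  have add: "sol (u + v) t = sol u t + sol v t" for u v
    using conv_add[OF sol_continuous[of u] sol_continuous[of v]]
    by (intro sol_unique[symmetric] t continuous_intros sol_continuous)
      (simp add: sol_eq[of _ u] sol_eq[of _ v] blinfun.add_right)
  have scale: "sol (c *\<^sub>C u) t = c *\<^sub>C sol u t" for c u
    using conv_scaleC[OF sol_continuous[of u], of c]
    by (intro sol_unique[symmetric] t scaleC.continuous_on continuous_on_const sol_continuous)
      (simp add: sol_eq[of _ u] clinD[OF clin_S] scaleC_add_right)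
  have "bounded_linear (\<lambda>u. sol u t)"
    by (rule bounded_linear_intro[of _ "2 * C * exp (rate * t)"])
      (use sol_bound[OF t] in \<open>auto simp: add scaleR_scaleC scale mult_ac\<close>)
  then show app: "pert t u = sol u t" for u
    by (simp add: pert_def bounded_linear_Blinfun_apply)
  show "clin (pert t)" by (simp add: clin_def app scale)
  show "norm (pert t) \<le> 2 * C * exp (rate * t)"
    using sol_bound[OF t] C_nonneg by (intro norm_blinfun_bound) (auto simp: app mult_ac)
qed

lemma sol_0 [simp]: "sol u 0 = u"
  using sol_eq[of 0 u] by (simp add: conv_def)

text \<open>Splitting the integral at \<open>r\<close> shows that the shifted solution solves the
  equation with initial vector \<open>sol u r\<close>; uniqueness then yields the semigroup
  law.\<close>

lemma sol_add:
  assumes r: "r \<ge> 0" and t: "t \<ge> 0"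
  shows "sol u (t + r) = sol (sol u r) t"
proof -
  define x where "x s = sol u (s + r)" for s
  have "x t = sol (sol u r) t"
  proof (rule sol_unique[OF _ _ t])
    show "continuous_on {0..} x"
      unfolding x_def by (rule continuous_on_compose2[OF sol_continuous])
        (use r in \<open>auto intro!: continuous_intros\<close>)
    fix t :: real assume t: "t \<ge> 0"
    let ?g = "\<lambda>s. S (t + r - s) (K (sol u s))"
    have "conv (sol u) (t + r) = integral {0..r} ?g + integral {r..t+r} ?g"
      unfolding conv_def using r t
      by (intro Henstock_Kurzweil_Integration.integral_combine[symmetric] conv_integrable sol_continuous) auto
    also have "integral {0..r} ?g = integral {0..r} (\<lambda>s. S t (S (r - s) (K (sol u s))))"
      using r t by (intro integral_cong) (simp add: algebra_simps flip: S_add)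
    also have "\<dots> = S t (conv (sol u) r)"
      unfolding conv_def by (intro integral_blinfun_apply conv_integrable sol_continuous) auto
    also have "integral {r..t+r} ?g = integral {0..t} (?g \<circ> (+) r)"
      using integral_shift_Icc_real[of 0 t ?g r] by simp
    also have "\<dots> = conv x t"
      unfolding conv_def x_def by (intro integral_cong) (simp add: algebra_simps)
    finally show "x t = S t (sol u r) + conv x t"
      using r t sol_eq[of r u] sol_eq[of "t + r" u]
      by (simp add: x_def[of t] S_add blinfun.add_right)
  qed
  then show ?thesis by (simp add: x_def)
qed

lemma pert_semigroup: "strongly_continuous_semigroup pert"
  unfolding strongly_continuous_semigroup_def
proof (intro conjI allI impI)
  show "clinear (blinfun_apply (pert t))" if "t \<ge> 0" for t
    using clin_pert[OF that] by (simp add: clin_iff_clinear)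
  show "pert 0 = id_blinfun" by (rule blinfun_eqI) (simp add: pert_apply)
  show "pert (s + t) = pert s o\<^sub>L pert t" if "s \<ge> 0" "t \<ge> 0" for s t
    using that by (intro blinfun_eqI) (simp add: pert_apply sol_add)
  show "continuous_on {0..} (\<lambda>t. pert t u)" for u
    by (rule continuous_on_eq[OF sol_continuous[of u]]) (simp add: pert_apply)
qed

lemma pert_bounded_semigroup: "bounded_semigroup pert (2 * C) rate"
  by unfold_locales (simp_all add: pert_semigroup norm_pert)

text \<open>The difference quotients of \<open>pert\<close> and \<open>S\<close> differ by
  \<open>conv_mean (sol u) h\<close>, which tends to \<open>K u\<close> for every \<open>u\<close>.
  So their limits exist for the same vectors, and the domain is unchanged.\<close>

lemma pert_generates:
  assumes "generates D A S"
  shows "generates D (\<lambda>u. A u + K u) pert"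
  unfolding generates_def
proof (intro conjI allI pert_semigroup)
  fix u v
  have "continuous_on {0..} (conv_mean (sol u))"
    by (rule conv_mean_continuous[OF sol_continuous])
  then have "(conv_mean (sol u) \<longlongrightarrow> conv_mean (sol u) 0) (at 0 within {0..})"
    by (simp add: continuous_on_def)
  moreover have "conv_mean (sol u) 0 = K u" by (simp add: conv_mean_def)
  ultimately have "(conv_mean (sol u) \<longlongrightarrow> K u) (at 0 within {0..})" by simp
  then have lim: "(conv_mean (sol u) \<longlongrightarrow> K u) (at_right 0)"
    by (rule tendsto_mono[OF at_le[of "{0<..}" "{0..}"], rotated]) (auto simp: subset_eq)
  have eq: "(pert h u - u) /\<^sub>R h = (S h u - u) /\<^sub>R h + conv_mean (sol u) h" if "h > 0" for h
    using that sol_eq[of h u] by (simp add: pert_apply conv_eq_mean algebra_simps)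
  have ev: "\<forall>\<^sub>F h in at_right 0. (pert h u - u) /\<^sub>R h = (S h u - u) /\<^sub>R h + conv_mean (sol u) h"
    using eq by (auto simp: eventually_at_filter)
  have "((\<lambda>h. (pert h u - u) /\<^sub>R h) \<longlongrightarrow> v) (at_right 0) \<longleftrightarrow>
      ((\<lambda>h. (S h u - u) /\<^sub>R h + conv_mean (sol u) h) \<longlongrightarrow> v) (at_right 0)"
    by (rule tendsto_cong[OF ev])
  also have "\<dots> \<longleftrightarrow> ((\<lambda>h. (S h u - u) /\<^sub>R h) \<longlongrightarrow> v - K u) (at_right 0)"
    using tendsto_diff[OF _ lim] tendsto_add[OF _ lim] by fastforce
  also have "\<dots> \<longleftrightarrow> u \<in> D \<and> A u = v - K u" using assms by (simp add: generates_def)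
  finally show "((\<lambda>h. (pert h u - u) /\<^sub>R h) \<longlongrightarrow> v) (at_right 0) \<longleftrightarrow> u \<in> D \<and> A u + K u = v"
    by (auto simp: algebra_simps)
qed

text \<open>For \<open>u\<close> in the unit ball the integrand of \<open>conv (sol u) t\<close> stays in one compact set.\<close>

lemma pert_diff_approximable:
  assumes compact: "\<And>B. bounded B \<Longrightarrow> compact (closure (K ` B))" and t: "t \<ge> 0"
  shows "approximable (pert t - S t)"
  unfolding approximable_iff
proof (intro allI impI)
  fix e :: real assume e: "e > 0"
  let ?T = "pert t - S t"
  \<comment> \<open>Bounds every \<open>sol u s\<close> with \<open>s \<le> t\<close> and
    \<open>norm u \<le> 1\<close>; the absolute value covers a negative \<open>rate\<close>.\<close>
  define r where "r = 2 * C * exp (\<bar>rate\<bar> * t)"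
  define X where "X = (\<lambda>p. S (fst p) (snd p)) ` ({0..t} \<times> closure (K ` cball 0 r))"
  \<comment> \<open>Makes \<open>\<delta> * t\<close> smaller than \<open>e\<close>, with
    \<open>t + 1\<close> in the denominator to cover \<open>t = 0\<close>.\<close>
  define \<delta> where "\<delta> = e / (2 * (t + 1))"
  have \<delta>: "\<delta> > 0" using e t by (simp add: \<delta>_def)
  have clT: "clin ?T" by (intro clin_intros clin_pert clin_S t)
  have "compact X"
    unfolding X_def
    by (intro compact_continuous_image compact_Times compact continuous_intros) auto
  from compact_oproj[OF this \<delta>] obtain E where E: "orthonormal E"
    "\<And>c. c \<in> X \<Longrightarrow> norm (c - oproj E c) \<le> \<delta>" by blast
  let ?Q = "id_blinfun - oproj E"
  have unit: "norm (?Q (?T u)) \<le> \<delta> * t" if u: "norm u \<le> 1" for u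
  proof -
    have "?T u = conv (sol u) t"
      using sol_eq[OF t, of u] by (simp add: blinfun.diff_left pert_apply t)
    then have "?Q (?T u) = integral {0..t} (\<lambda>s. ?Q (S (t - s) (K (sol u s))))"
      unfolding conv_def
      by (simp only: integral_blinfun_apply[OF conv_integrable[OF sol_continuous order_refl order_refl]])
    also have "norm \<dots> \<le> \<delta> * (t - 0)"
    proof (rule integral_bound[OF t])
      show "continuous_on {0..t} (\<lambda>s. ?Q (S (t - s) (K (sol u s))))"
        by (intro continuous_intros continuous_on_subset[OF sol_continuous]) auto
      fix s assume s: "s \<in> {0..t}"
      have "norm (sol u s) \<le> 2 * C * norm u * exp (rate * s)" using s by (intro sol_bound) auto
      also have "\<dots> \<le> 2 * C * 1 * exp (\<bar>rate\<bar> * t)"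
        using s u C_nonneg by (intro mult_mono) (auto intro!: mult_mono)
      finally have "K (sol u s) \<in> closure (K ` cball 0 r)"
        by (intro subsetD[OF closure_subset]) (simp add: r_def)
      then have "S (t - s) (K (sol u s)) \<in> X"
        using s by (auto simp: X_def intro!: image_eqI[of _ _ "(t - s, K (sol u s))"])
      from E(2)[OF this] show "norm (?Q (S (t - s) (K (sol u s)))) \<le> \<delta>"
        by (simp add: blinfun.diff_left)
    qed
    finally show ?thesis by simp
  qed
  have "norm (?T - (oproj E o\<^sub>L ?T)) \<le> \<delta> * t"
  proof (rule norm_blinfun_bound)
    fix u
    show "norm ((?T - (oproj E o\<^sub>L ?T)) u) \<le> \<delta> * t * norm u"
    proof (cases "u = 0")
      case False
      have "(?T - (oproj E o\<^sub>L ?T)) u = norm u *\<^sub>R ?Q (?T (u /\<^sub>R norm u))"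
        using False by (simp only: blinfun.scaleR_right) (simp add: blinfun.diff_left)
      then have "norm ((?T - (oproj E o\<^sub>L ?T)) u) = norm u * norm (?Q (?T (u /\<^sub>R norm u)))"
        by (simp only: norm_scaleR) simp
      also have "\<dots> \<le> norm u * (\<delta> * t)"
        using False by (intro mult_left_mono unit) auto
      finally show ?thesis by (simp only: mult.commute)
    qed simp
  qed (use \<delta> t in auto)
  also have "\<dots> < e" using e t by (simp add: \<delta>_def field_simps add_nonneg_pos)
  finally show "\<exists>F. finite_rank F \<and> norm (?T - F) < e"
    using finite_rank_oproj_compose[OF E(1) clT] by blast
qed

end

subsection \<open>Resolvents\<close>

lemma resolvent_identity:
  assumes lin: "linear_operator D A" and z: "z \<in> resolvent_set D A" and w: "w \<in> resolvent_set D A"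
  shows "resolvent D A z u - resolvent D A w u = (w - z) *\<^sub>C resolvent D A z (resolvent D A w u)"
proof -
  note Rz = resolvent_props[OF lin z] and Rw = resolvent_props[OF lin w]
  let ?x = "resolvent D A w u"
  have "z *\<^sub>C ?x - A ?x = (z - w) *\<^sub>C ?x + u"
    using Rw(2)[of u] by (simp add: scaleC_simps algebra_simps)
  then have "?x = resolvent D A z ((z - w) *\<^sub>C ?x + u)"
    using Rz(3)[OF Rw(1)[of u]] by simp
  also have "\<dots> = (z - w) *\<^sub>C resolvent D A z ?x + resolvent D A z u"
    by (simp add: blinfun.add_right clinD[OF Rz(4)])
  finally have "resolvent D A z u - ?x = - ((z - w) *\<^sub>C resolvent D A z ?x)"
    by (simp add: algebra_simps)
  then show ?thesis by (simp flip: complex_vector.scale_minus_left)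
qed

lemma resolvent_product:
  assumes "linear_operator D A" "z \<in> resolvent_set D A" "w \<in> resolvent_set D A" "w \<noteq> z"
  shows "resolvent D A w (resolvent D A z u)
    = (1 / (w - z)) *\<^sub>C (resolvent D A z u - resolvent D A w u)"
proof -
  have "resolvent D A z u - resolvent D A w u = (w - z) *\<^sub>C resolvent D A w (resolvent D A z u)"
    using resolvent_identity[OF assms(1) assms(3,2), of u]
    by (metis complex_vector.scale_minus_left minus_diff_eq)
  then show ?thesis using assms(4) by (simp only: scaleC_scaleC) (simp add: scaleC_one)
qed

lemma resolvent_commutes:
  assumes "linear_operator D A" "z \<in> resolvent_set D A" "w \<in> resolvent_set D A"
  shows "resolvent D A w (resolvent D A z u) = resolvent D A z (resolvent D A w u)"
proof (cases "w = z")
  case False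
  have "(1 / (w - z)) *\<^sub>C (resolvent D A z u - resolvent D A w u)
      = (1 / (z - w)) *\<^sub>C (resolvent D A w u - resolvent D A z u)"
  proof -
    have "1 / (w - z) = - (1 / (z - w))" using False by (simp add: divide_simps)
    then show ?thesis
      by (simp only: complex_vector.scale_minus_left)
        (simp add: complex_vector.scale_right_diff_distrib)
  qed
  then show ?thesis
    using resolvent_product[OF assms, of u] resolvent_product[OF assms(1,3,2), of u] False by simp
qed simp

text \<open>On \<open>D\<close>, z - A = (1 - (w - z) R(w)) (w - A), with a Neumann-invertible first
  factor for z near w. The choice of \<open>\<delta>\<close> keeps
  \<open>norm (w - z) * norm ?R\<close> at most 1/2, and the resolvent identity then bounds |R(z)|
  by 2 |R(w)|.\<close>

lemma resolvent_set_locally_bounded: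
  fixes A :: "'a::chilbert_space \<Rightarrow> 'a"
  assumes lin: "linear_operator D A" and w: "w \<in> resolvent_set D A"
  obtains \<delta> B where "\<delta> > 0" "B \<ge> 0"
    "\<And>z. dist z w < \<delta> \<Longrightarrow> z \<in> resolvent_set D A \<and> norm (resolvent D A z) \<le> B"
proof -
  let ?R = "resolvent D A w"
  note Rw = resolvent_props[OF lin w]
  define \<delta> where "\<delta> = 1 / (2 * (norm ?R + 1))"
  have pos: "norm ?R + 1 > 0" by (simp add: add_nonneg_pos)
  then have \<delta>: "\<delta> > 0" by (simp add: \<delta>_def)
  have half: "\<delta> * norm ?R \<le> 1 / 2" using pos by (simp add: \<delta>_def field_simps)
  show thesis
  proof (rule that[OF \<delta>, of "2 * norm ?R"])
    fix z assume z: "dist z w < \<delta>"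
    let ?B = "(w - z) *\<^sub>C ?R"
    have nB: "norm (w - z) * norm ?R \<le> 1 / 2"
      using order_trans[OF mult_right_mono[of "norm (w - z)" \<delta> "norm ?R"] half] z
      by (simp add: dist_norm norm_minus_commute)
    then have "cinvertible (id_blinfun - ?B)"
      by (intro cinvertible_id_minus_norm clin_scaleC Rw(4)) (simp add: norm_scaleC)
    then obtain W where W: "clin W" "\<And>x. (id_blinfun - ?B) (blinfun_apply W x) = x"
      "\<And>x. W ((id_blinfun - ?B) x) = x"
      using cinvertibleE by blast
    have shift: "z *\<^sub>C ?R x - A (?R x) = (id_blinfun - ?B) x" for x
    proof -
      have A: "A (?R x) = w *\<^sub>C ?R x - x" using Rw(2)[of x] by (simp add: algebra_simps)
      have "z *\<^sub>C ?R x - A (?R x) = x - (w - z) *\<^sub>C ?R x"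
        unfolding A by (simp add: algebra_simps)
      then show ?thesis
        by (simp only: blinfun.diff_left blinfun_apply_scaleC blinfun_apply_id_blinfun id_apply)
    qed
    have zr: "z \<in> resolvent_set D A"
    proof (rule resolvent_eqI(1)[of "?R o\<^sub>L W"])
      show "(?R o\<^sub>L W) y \<in> D" for y by (simp add: Rw(1))
      show "z *\<^sub>C (?R o\<^sub>L W) y - A ((?R o\<^sub>L W) y) = y" for y
        by (simp only: blinfun_apply_blinfun_compose shift W(2))
      fix u assume u: "u \<in> D"
      have "?R (w *\<^sub>C u - A u) = u" by (rule Rw(3)[OF u])
      then show "(?R o\<^sub>L W) (z *\<^sub>C u - A u) = u"
        using shift[of "w *\<^sub>C u - A u"] W(3)[of "w *\<^sub>C u - A u"] by simp
    qed
    have "norm (resolvent D A z) \<le> norm ?R + 1/2 * norm (resolvent D A z)"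
    proof (rule norm_blinfun_bound)
      fix u
      have "resolvent D A z u = ?R u + (w - z) *\<^sub>C ?R (resolvent D A z u)"
        using resolvent_identity[OF lin zr w, of u] resolvent_commutes[OF lin zr w, of u]
        by (simp add: algebra_simps)
      then have "norm (resolvent D A z u) \<le> norm (?R u) + norm (w - z) * norm (?R (resolvent D A z u))"
        by (metis norm_scaleC norm_triangle_ineq)
      also have "\<dots> \<le> norm ?R * norm u + norm (w - z) * (norm ?R * (norm (resolvent D A z) * norm u))"
        by (intro add_mono norm_blinfun mult_left_mono order_trans[OF norm_blinfun mult_left_mono[OF norm_blinfun]])
          auto
      also have "\<dots> \<le> norm ?R * norm u + 1/2 * (norm (resolvent D A z) * norm u)"
        using mult_right_mono[OF nB, of "norm (resolvent D A z) * norm u"] by (simp add: mult.assoc)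
      finally show "norm (resolvent D A z u) \<le> (norm ?R + 1/2 * norm (resolvent D A z)) * norm u"
        by (simp add: algebra_simps)
    qed simp
    then show "z \<in> resolvent_set D A \<and> norm (resolvent D A z) \<le> 2 * norm ?R"
      using zr by simp
  qed simp
qed

lemma open_resolvent_set:
  fixes A :: "'a::chilbert_space \<Rightarrow> 'a"
  assumes "linear_operator D A"
  shows "open (resolvent_set D A)"
  unfolding open_dist using resolvent_set_locally_bounded[OF assms] by metis

lemma continuous_on_resolvent:
  fixes A :: "'a::chilbert_space \<Rightarrow> 'a"
  assumes lin: "linear_operator D A"
  shows "continuous_on (resolvent_set D A) (resolvent D A)"
proof -
  have "isCont (resolvent D A) w" if w: "w \<in> resolvent_set D A" for w
  proof -
    obtain \<delta> B where \<delta>: "\<delta> > 0" "B \<ge> 0"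
      "\<And>z. dist z w < \<delta> \<Longrightarrow> z \<in> resolvent_set D A \<and> norm (resolvent D A z) \<le> B"
      using resolvent_set_locally_bounded[OF lin w] by blast
    have le: "norm (resolvent D A z - resolvent D A w) \<le> norm (w - z) * (B * norm (resolvent D A w))"
      if "dist z w < \<delta>" for z
    proof (rule norm_blinfun_bound)
      fix u
      have "norm ((resolvent D A z - resolvent D A w) u)
          = norm (w - z) * norm (resolvent D A z (resolvent D A w u))"
        using resolvent_identity[OF lin _ w, of z u] \<delta>(3)[OF that]
        by (simp add: blinfun.diff_left norm_scaleC)
      also have "\<dots> \<le> norm (w - z) * (B * (norm (resolvent D A w) * norm u))"
        using \<delta>(2) \<delta>(3)[OF that]
        by (intro mult_left_mono order_trans[OF norm_blinfun] mult_mono norm_blinfun) auto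
      finally show "norm ((resolvent D A z - resolvent D A w) u)
          \<le> norm (w - z) * (B * norm (resolvent D A w)) * norm u" by (simp add: mult.assoc)
    qed (use \<delta> in auto)
    have "((\<lambda>z. norm (w - z) * (B * norm (resolvent D A w))) \<longlongrightarrow> norm (w - w) * (B * norm (resolvent D A w))) (at w)"
      by (intro tendsto_intros)
    then have "((\<lambda>z. norm (w - z) * (B * norm (resolvent D A w))) \<longlongrightarrow> 0) (at w)" by simp
    moreover have "\<forall>\<^sub>F z in at w. norm (resolvent D A z - resolvent D A w) \<le> norm (w - z) * (B * norm (resolvent D A w))"
      using le \<delta>(1) by (auto simp: eventually_at)
    ultimately have "((\<lambda>z. resolvent D A z - resolvent D A w) \<longlongrightarrow> 0) (at w)"
      by (rule Lim_null_comparison[rotated])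
    then show ?thesis by (simp add: isCont_def LIM_zero_iff)
  qed
  then show ?thesis by (simp add: continuous_at_imp_continuous_on)
qed

text \<open>Scalar entries give access to Cauchy's theorem and residues, and
  \<open>cinner_eqI\<close> lifts the results back to vectors. By the resolvent identity the
  derivative at w is the entry of -R(w) R(w).\<close>

lemma holomorphic_resolvent:
  fixes A :: "'a::chilbert_space \<Rightarrow> 'a"
  assumes lin: "linear_operator D A"
  shows "(\<lambda>z. cinner (resolvent D A z u) v) holomorphic_on resolvent_set D A"
  unfolding holomorphic_on_def
proof
  fix w assume w: "w \<in> resolvent_set D A"
  let ?R = "resolvent D A" and ?f = "\<lambda>z. cinner (resolvent D A z u) v"
  have "(?R \<longlongrightarrow> ?R w) (at w within resolvent_set D A)"
    using continuous_on_resolvent[OF lin] w by (simp add: continuous_on_def)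
  then have "((\<lambda>z. - cinner (?R z (?R w u)) v) \<longlongrightarrow> - cinner (?R w (?R w u)) v) (at w within resolvent_set D A)"
    by (intro tendsto_intros cinner.tendsto)
  moreover have "\<forall>\<^sub>F z in at w within resolvent_set D A. - cinner (?R z (?R w u)) v = (?f z - ?f w) / (z - w)"
    unfolding eventually_at_filter
  proof (rule always_eventually, intro allI impI)
    fix z assume "z \<noteq> w" "z \<in> resolvent_set D A"
    then have "?f z - ?f w = (w - z) * cinner (?R z (?R w u)) v"
      using resolvent_identity[OF lin _ w, of z u] by (simp add: cinner_scaleC_left flip: cinner_diff_left)
    then show "- cinner (?R z (?R w u)) v = (?f z - ?f w) / (z - w)"
      using \<open>z \<noteq> w\<close> by (simp add: field_simps)
  qed
  ultimately have "((\<lambda>z. (?f z - ?f w) / (z - w)) \<longlongrightarrow> - cinner (?R w (?R w u)) v) (at w within resolvent_set D A)"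
    by (rule Lim_transform_eventually)
  then show "?f field_differentiable at w within resolvent_set D A"
    unfolding field_differentiable_def has_field_derivative_iff by blast
qed

lemma resolvent_eigenvector:
  assumes lin: "linear_operator D A" and z: "z \<in> resolvent_set D A" and v: "v \<in> D" "A v = l *\<^sub>C v"
  shows "(z - l) *\<^sub>C resolvent D A z v = v"
  using resolvent_props(3)[OF lin z v(1)] v(2)
  by (simp add: clinD[OF resolvent_props(4)[OF lin z]] flip: complex_vector.scale_left_diff_distrib)

subsection \<open>Vector-valued contour integrals over circles\<close>

lemma vector_contour_integral_integrable:
  fixes F :: "complex \<Rightarrow> 'b::complex_normed_vector"
  assumes r: "r > 0" and F: "continuous_on (sphere z r) F"
  shows "continuous_on {0..1} (\<lambda>t. vector_derivative (circlepath z r) (at t within {0..1}) *\<^sub>C F (circlepath z r t))"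
proof -
  have "continuous_on {0..1} (\<lambda>t. (2 * pi * \<i> * r * exp (2 * of_real pi * \<i> * of_real t)) *\<^sub>C F (circlepath z r t))"
  proof (intro scaleC.continuous_on continuous_intros)
    show "continuous_on {0..1} (\<lambda>t. F (circlepath z r t))"
    proof (rule continuous_on_compose2[OF F])
      show "continuous_on {0..1} (circlepath z r)"
        using path_circlepath by (simp add: path_def)
      show "circlepath z r ` {0..1} \<subseteq> sphere z r"
        using r by (simp flip: path_image_def)
    qed
  qed
  then show ?thesis
    by (rule continuous_on_eq) (simp add: vector_derivative_circlepath01)
qed

text \<open>Taking an entry is bounded and linear, so it commutes with the integral; this reduces
  operator-valued contour integrals to scalar ones.\<close>

lemma cinner_vector_contour_integral:
  fixes F :: "complex \<Rightarrow> 'b::complex_normed_vector \<Rightarrow>\<^sub>L 'a::chilbert_space"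
  assumes r: "r > 0" and F: "continuous_on (sphere z r) F"
  shows "cinner (vector_contour_integral (circlepath z r) F u) v
    = contour_integral (circlepath z r) (\<lambda>\<zeta>. cinner (F \<zeta> u) v)"
proof -
  let ?G = "\<lambda>t. vector_derivative (circlepath z r) (at t within {0..1}) *\<^sub>C F (circlepath z r t)"
  have int: "?G integrable_on {0..1}"
    by (intro integrable_continuous_real vector_contour_integral_integrable r F)
  have "bounded_linear (\<lambda>T :: 'b \<Rightarrow>\<^sub>L 'a. cinner (T u) v)"
    by (intro bounded_linear_compose[OF cinner.bounded_linear_left] blinfun.bounded_linear_left)
  from integral_linear[OF int this]
  have "cinner (vector_contour_integral (circlepath z r) F u) v
      = integral {0..1} (\<lambda>t. cinner (?G t u) v)"
    by (simp add: vector_contour_integral_def o_def)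
  also have "\<dots> = integral {0..1} (\<lambda>t. cinner (F (circlepath z r t) u) v * vector_derivative (circlepath z r) (at t))"
    by (intro integral_cong) (simp add: vector_derivative_circlepath01 vector_derivative_circlepath
        blinfun_apply_scaleC cinner_scaleC_left)
  finally show ?thesis by (simp add: contour_integral_integral)
qed

lemma vector_contour_integral_apply:
  fixes F :: "complex \<Rightarrow> 'a::chilbert_space \<Rightarrow>\<^sub>L 'a"
  assumes r: "r > 0" and F: "continuous_on (sphere z r) F" 
    and T: "clin T" "\<And>\<zeta> x. \<zeta> \<in> sphere z r \<Longrightarrow> T (F \<zeta> x) = F \<zeta> (blinfun_apply T x)"
  shows "T (vector_contour_integral (circlepath z r) F u) = vector_contour_integral (circlepath z r) F (T u)"
proof -
  let ?G = "\<lambda>t. vector_derivative (circlepath z r) (at t within {0..1}) *\<^sub>C F (circlepath z r t)"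
  have int: "?G integrable_on {0..1}"
    by (intro integrable_continuous_real vector_contour_integral_integrable r F)
  have circ: "circlepath z r t \<in> sphere z r" if "t \<in> {0..1}" for t
    using that r path_image_circlepath[of z r] unfolding path_image_def by auto
  have app: "vector_contour_integral (circlepath z r) F x = integral {0..1} (\<lambda>t. ?G t x)" for x
    unfolding vector_contour_integral_def by (rule blinfun_apply_integral[OF int])
  have "T (vector_contour_integral (circlepath z r) F u) = integral {0..1} (\<lambda>t. T (?G t u))"
    unfolding app
    using integral_blinfun_apply[of "\<lambda>t. ?G t u" "{0..1}" T]
      integrable_linear[OF int blinfun.bounded_linear_left[of u]] by (simp add: o_def)
  also have "\<dots> = integral {0..1} (\<lambda>t. ?G t (T u))"
    by (intro integral_cong) (simp add: blinfun_apply_scaleC clinD[OF T(1)] T(2)[OF circ])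
  finally show ?thesis by (simp add: app)
qed

text \<open>Riemann sums lie in \<open>V\<close> and approximate the integral. It is used for the
  closed subspace of approximable operators.\<close>

lemma integral_in_closed_subspace:
  fixes f :: "real \<Rightarrow> 'b::banach"
  assumes int: "f integrable_on {a..b}" and V: "closed V" "subspace V" and f: "\<And>t. t \<in> {a..b} \<Longrightarrow> f t \<in> V"
  shows "integral {a..b} f \<in> V"
proof -
  have "\<exists>y\<in>V. dist y (integral {a..b} f) < e" if e: "e > 0" for e
  proof -
    obtain \<gamma> where \<gamma>: "gauge \<gamma>" "\<And>\<D>. \<D> tagged_division_of {a..b} \<Longrightarrow> \<gamma> fine \<D> \<Longrightarrow>
        norm (sum (\<lambda>(x,k). measure lborel k *\<^sub>R f x) \<D> - integral {a..b} f) < e"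
      using has_integral_real[THEN iffD1, OF integrable_integral[OF int], rule_format, OF e] by metis
    obtain p where p: "p tagged_division_of {a..b}" "\<gamma> fine p"
      using fine_division_exists_real[OF \<gamma>(1)] by blast
    have "sum (\<lambda>(x,k). measure lborel k *\<^sub>R f x) p \<in> V"
    proof (rule subspace_sum[OF V(2)])
      fix c assume c: "c \<in> p"
      obtain x k where xk: "c = (x, k)" by (cases c)
      then have "x \<in> {a..b}" using tag_in_interval[OF p(1)] c by simp
      then show "(case c of (x, k) \<Rightarrow> measure lborel k *\<^sub>R f x) \<in> V"
        using V(2) by (simp add: xk subspace_mul f)
    qed
    then show ?thesis using \<gamma>(2)[OF p] by (auto simp: dist_norm)
  qed
  then show ?thesis using closed_approachable[OF V(1), of "integral {a..b} f"] by blast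
qed

lemma vector_contour_integral_approximable:
  fixes F :: "complex \<Rightarrow> 'a::chilbert_space \<Rightarrow>\<^sub>L 'a"
  assumes r: "r > 0" and F: "continuous_on (sphere z r) F" 
    and ap: "\<And>\<zeta>. \<zeta> \<in> sphere z r \<Longrightarrow> approximable (F \<zeta>)"
  shows "approximable (vector_contour_integral (circlepath z r) F)"
proof -
  have circ: "circlepath z r t \<in> sphere z r" if "t \<in> {0..1}" for t
    using that r path_image_circlepath[of z r] unfolding path_image_def by auto
  have "subspace {T :: 'a \<Rightarrow>\<^sub>L 'a. approximable T}"
    by (auto simp: subspace_def approximable_zero approximable_add scaleR_scaleC approximable_scaleC)
  then have "vector_contour_integral (circlepath z r) F \<in> {T. approximable T}"
    unfolding vector_contour_integral_def
    by (intro integral_in_closed_subspace integrable_continuous_real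
        vector_contour_integral_integrable r F closed_approximable)
      (auto intro!: approximable_scaleC ap circ)
  then show ?thesis by simp
qed

subsection \<open>Riesz projections\<close>

lemma riesz_radius_exists:
  assumes "z isolated_in spectrum D A"
  shows "\<exists>r. riesz_radius D A z r"
proof -
  obtain T where T: "open T" "T \<inter> spectrum D A = {z}"
    using assms by (auto simp: isolated_in_def)
  then obtain e where e: "e > 0" "ball z e \<subseteq> T" by (metis IntD1 insertI1 openE)
  have "sphere z (e/2) \<subseteq> resolvent_set D A"
  proof
    fix w assume w: "w \<in> sphere z (e/2)"
    then have "w \<in> T" "w \<noteq> z" using e by auto
    then show "w \<in> resolvent_set D A" using T(2) by (auto simp: spectrum_def)
  qed
  moreover have "ball z (e/2) \<inter> spectrum D A \<subseteq> {z}"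
  proof -
    have "ball z (e/2) \<subseteq> ball z e" using e(1) by (intro subset_ball) simp
    then have "ball z (e/2) \<inter> spectrum D A \<subseteq> T \<inter> spectrum D A" using e(2) by blast
    then show ?thesis by (simp only: T(2))
  qed
  ultimately show ?thesis
    using e(1) unfolding riesz_radius_def by (intro exI[of _ "e/2"] conjI) simp_all
qed

lemma riesz_radius_cball:
  assumes "riesz_radius D A z r"
  shows "cball z r - {z} \<subseteq> resolvent_set D A"
  using assms by (auto simp: riesz_radius_def spectrum_def subset_iff less_le)

lemma riesz_radius_ball: "riesz_radius D A z r \<Longrightarrow> ball z r - {z} \<subseteq> resolvent_set D A"
  using riesz_radius_cball[of D A z r] ball_subset_cball[of z r] by blast

lemma riesz_radius_mono:
  assumes "riesz_radius D A z r" "0 < s" "s \<le> r"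
  shows "riesz_radius D A z s"
proof -
  have "sphere z s \<subseteq> cball z r - {z}" using assms(2,3) by auto
  moreover have "ball z s \<inter> spectrum D A \<subseteq> {z}"
    using assms(1) subset_ball[OF assms(3), of z] unfolding riesz_radius_def by blast
  ultimately show ?thesis
    using assms(2) riesz_radius_cball[OF assms(1)] by (simp add: riesz_radius_def order_trans)
qed

text \<open>The residue is independent of \<open>r\<close>: every admissible radius yields the same
  operator, so the one picked by \<open>SOME\<close> in \<open>riesz_projection\<close> does not
  matter.\<close>

lemma riesz_contour_residue:
  fixes A :: "'a::chilbert_space \<Rightarrow> 'a"
  assumes lin: "linear_operator D A" and r: "riesz_radius D A z r"
  shows "cinner (((1 / (2 * of_real pi * \<i>)) *\<^sub>C
      vector_contour_integral (circlepath z r) (resolvent D A)) u) v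
    = residue (\<lambda>w. cinner (resolvent D A w u) v) z"
proof -
  let ?f = "\<lambda>w. cinner (resolvent D A w u) v"
  let ?s = "resolvent_set D A \<union> ball z r"
  have pos: "r > 0" and sph: "sphere z r \<subseteq> resolvent_set D A"
    using r by (auto simp: riesz_radius_def)
  have "(?f has_contour_integral 2 * pi * \<i> * residue ?f z) (circlepath z r)"
  proof (rule base_residue)
    show "open ?s" by (intro open_Un open_ball open_resolvent_set lin)
    show "z \<in> ?s" using pos by simp
    show "?f holomorphic_on ?s - {z}"
      by (rule holomorphic_on_subset[OF holomorphic_resolvent[OF lin]])
        (use riesz_radius_ball[OF r] in blast)
    show "cball z r \<subseteq> ?s" using sph by (auto simp: subset_iff less_le)
  qed (rule pos)
  then have "contour_integral (circlepath z r) ?f = 2 * pi * \<i> * residue ?f z"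
    by (rule contour_integral_unique)
  moreover have "cinner (vector_contour_integral (circlepath z r) (resolvent D A) u) v
      = contour_integral (circlepath z r) ?f"
    by (intro cinner_vector_contour_integral pos continuous_on_subset[OF continuous_on_resolvent[OF lin] sph])
  ultimately show ?thesis by (simp add: blinfun_apply_scaleC cinner_scaleC_left)
qed

lemma riesz_projection_residue:
  fixes A :: "'a::chilbert_space \<Rightarrow> 'a"
  assumes lin: "linear_operator D A" and r: "riesz_radius D A z r"
  shows "cinner (riesz_projection D A z u) v = residue (\<lambda>w. cinner (resolvent D A w u) v) z"
  unfolding riesz_projection_def
  by (rule riesz_contour_residue[OF lin someI[of "riesz_radius D A z", OF r]])

lemma riesz_projection_eq:
  fixes A :: "'a::chilbert_space \<Rightarrow> 'a"
  assumes "linear_operator D A" "riesz_radius D A z r"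
  shows "riesz_projection D A z = (1 / (2 * of_real pi * \<i>)) *\<^sub>C
    vector_contour_integral (circlepath z r) (resolvent D A)"
  by (rule blinfun_eqI, rule cinner_eqI)
    (simp only: riesz_projection_residue[OF assms] riesz_contour_residue[OF assms])

lemma riesz_projection_commute:
  fixes A :: "'a::chilbert_space \<Rightarrow> 'a"
  assumes lin: "linear_operator D A" and r: "riesz_radius D A z r" and T: "clin T"
    and comm: "\<And>w x. w \<in> resolvent_set D A \<Longrightarrow> T (resolvent D A w x) = resolvent D A w (blinfun_apply T x)"
  shows "T (riesz_projection D A z u) = riesz_projection D A z (T u)"
proof -
  have pos: "r > 0" and sph: "sphere z r \<subseteq> resolvent_set D A"
    using r by (auto simp: riesz_radius_def)
  have "T (vector_contour_integral (circlepath z r) (resolvent D A) u)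
      = vector_contour_integral (circlepath z r) (resolvent D A) (T u)"
    by (intro vector_contour_integral_apply pos T comm
        continuous_on_subset[OF continuous_on_resolvent[OF lin] sph] subsetD[OF sph])
  then show ?thesis
    by (simp add: riesz_projection_eq[OF lin r] blinfun_apply_scaleC clinD[OF T])
qed

lemma eventually_in_resolvent_set:
  assumes "riesz_radius D A z r"
  shows "\<forall>\<^sub>F w in at z. w \<in> resolvent_set D A"
  using riesz_radius_cball[OF assms] assms
  by (auto simp: eventually_at riesz_radius_def subset_iff dist_commute intro!: exI[of _ r])

text \<open>Near \<open>z\<close> the entries of R(w) v are \<open>cinner v x / (w - l)\<close>,
  with a simple pole at \<open>l\<close> and holomorphic elsewhere. Both cases are needed to see
  that a sum of projections fixes \<open>v\<close>.\<close>

lemma riesz_projection_eigenvector: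
  fixes A :: "'a::chilbert_space \<Rightarrow> 'a"
  assumes lin: "linear_operator D A" and r: "riesz_radius D A z r" and v: "v \<in> D" "A v = l *\<^sub>C v"
  shows "riesz_projection D A z v = (if z = l then v else 0)"
proof (rule cinner_eqI)
  fix x
  have res: "cinner (resolvent D A w v) x = cinner v x / (w - l)"
    if "w \<in> resolvent_set D A" "w \<noteq> l" for w
  proof -
    have "(w - l) * cinner (resolvent D A w v) x = cinner v x"
      using resolvent_eigenvector[OF lin that(1) v] by (simp flip: cinner_scaleC_left)
    then show ?thesis using that(2) by (simp add: field_simps)
  qed
  have "\<forall>\<^sub>F w in at z. w \<noteq> l"
  proof (cases "z = l")
    case True
    then show ?thesis by (simp add: eventually_at_filter)
  next
    case False
    then show ?thesis by (intro eventually_neq_at_within)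
  qed
  with eventually_in_resolvent_set[OF r]
  have "\<forall>\<^sub>F w in at z. cinner (resolvent D A w v) x = cinner v x / (w - l)"
    by eventually_elim (rule res)
  then have "cinner (riesz_projection D A z v) x = residue (\<lambda>w. cinner v x / (w - l)) z"
    unfolding riesz_projection_residue[OF lin r] by (rule residue_cong) simp
  also have "\<dots> = (if z = l then cinner v x else 0)"
  proof (cases "z = l")
    case True
    then show ?thesis using residue_simple[of UNIV z "\<lambda>_. cinner v x"] by simp
  next
    case False
    have "residue (\<lambda>w. cinner v x / (w - l)) z = 0"
      by (rule residue_holo[of "- {l}"]) (use False in \<open>auto intro!: holomorphic_intros\<close>)
    then show ?thesis using False by simp
  qed
  finally show "cinner (riesz_projection D A z v) x = cinner (if z = l then v else 0) x" by simp
qed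

text \<open>By the resolvent identity, \<open>R(w) P\<^sub>z u\<close> is the Cauchy transform of \<open>R(\<zeta>) u\<close> over a circle
  around \<open>z\<close>, plus \<open>R(w) u\<close> if \<open>w\<close> is inside.\<close>

lemma resolvent_riesz_projection:
  fixes A :: "'a::chilbert_space \<Rightarrow> 'a"
  assumes lin: "linear_operator D A" and r: "riesz_radius D A z r"
    and w: "w \<in> resolvent_set D A" "w \<notin> sphere z r"
  shows "cinner (resolvent D A w (riesz_projection D A z u)) v
    = (if w \<in> ball z r then cinner (resolvent D A w u) v else 0)
      - 1 / (2 * of_real pi * \<i>) * contour_integral (circlepath z r) (\<lambda>\<zeta>. cinner (resolvent D A \<zeta> u) v / (\<zeta> - w))"
proof -
  let ?R = "resolvent D A" and ?c = "1 / (2 * of_real pi * \<i>)"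
  have pos: "r > 0" and sph: "sphere z r \<subseteq> resolvent_set D A"
    using r by (auto simp: riesz_radius_def)
  have cont: "continuous_on (sphere z r) ?R"
    by (rule continuous_on_subset[OF continuous_on_resolvent[OF lin] sph])
  have "?R w (riesz_projection D A z u) = riesz_projection D A z (?R w u)"
    by (rule riesz_projection_commute[OF lin r]) (simp_all add: resolvent_props(4)[OF lin] resolvent_commutes[OF lin] w)
  then have "cinner (?R w (riesz_projection D A z u)) v
      = ?c * contour_integral (circlepath z r) (\<lambda>\<zeta>. cinner (?R \<zeta> (?R w u)) v)"
    by (simp add: riesz_projection_eq[OF lin r] blinfun_apply_scaleC cinner_scaleC_left
        cinner_vector_contour_integral[OF pos cont])
  also have "contour_integral (circlepath z r) (\<lambda>\<zeta>. cinner (?R \<zeta> (?R w u)) v)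
      = contour_integral (circlepath z r) (\<lambda>\<zeta>. cinner (?R w u) v / (\<zeta> - w) - cinner (?R \<zeta> u) v / (\<zeta> - w))"
  proof (rule contour_integral_cong[OF refl])
    fix \<zeta> assume "\<zeta> \<in> path_image (circlepath z r)"
    then have "\<zeta> \<in> sphere z r" using pos by simp
    then have "\<zeta> \<in> resolvent_set D A" "\<zeta> \<noteq> w" using sph w by blast+
    then show "cinner (?R \<zeta> (?R w u)) v = cinner (?R w u) v / (\<zeta> - w) - cinner (?R \<zeta> u) v / (\<zeta> - w)"
      by (simp add: resolvent_product[OF lin w(1)] cinner_scaleC_left cinner_diff_left diff_divide_distrib)
  qed
  also have "\<dots> = contour_integral (circlepath z r) (\<lambda>\<zeta>. cinner (?R w u) v / (\<zeta> - w))
      - contour_integral (circlepath z r) (\<lambda>\<zeta>. cinner (?R \<zeta> u) v / (\<zeta> - w))"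
  proof (rule contour_integral_diff)
    have "continuous_on (sphere z r) (\<lambda>\<zeta>. cinner (?R \<zeta> u) v)"
      using holomorphic_on_imp_continuous_on[OF holomorphic_resolvent[OF lin]] sph continuous_on_subset by blast
    then show "(\<lambda>\<zeta>. cinner (?R \<zeta> u) v / (\<zeta> - w)) contour_integrable_on circlepath z r"
      using pos w by (intro contour_integrable_continuous_circlepath continuous_intros) auto
    show "(\<lambda>\<zeta>. cinner (?R w u) v / (\<zeta> - w)) contour_integrable_on circlepath z r"
      using pos w by (intro contour_integrable_continuous_circlepath continuous_intros) auto
  qed
  also have "contour_integral (circlepath z r) (\<lambda>\<zeta>. cinner (?R w u) v / (\<zeta> - w))
      = 2 * of_real pi * \<i> * (if w \<in> ball z r then cinner (?R w u) v else 0)"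
  proof (cases "w \<in> ball z r")
    case True
    have "((\<lambda>\<zeta>. cinner (?R w u) v / (\<zeta> - w)) has_contour_integral 2 * of_real pi * \<i> * cinner (?R w u) v) (circlepath z r)"
      by (rule Cauchy_integral_circlepath_simple) (use True in \<open>auto simp: dist_norm norm_minus_commute\<close>)
    then show ?thesis using True by (simp add: contour_integral_unique)
  next
    case False
    have "((\<lambda>\<zeta>. cinner (?R w u) v / (\<zeta> - w)) has_contour_integral 0) (circlepath z r)"
    proof (rule Cauchy_theorem_convex_simple)
      show "(\<lambda>\<zeta>. cinner (?R w u) v / (\<zeta> - w)) holomorphic_on cball z r"
        using False w(2) by (intro holomorphic_intros) (auto simp: less_le)
    qed (use pos in auto)
    then show ?thesis using False by (simp add: contour_integral_unique)
  qed
  finally show ?thesis by (simp add: right_diff_distrib)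
qed

text \<open>Differentiation under a Cauchy-type integral off the contour. In the product of two
  Riesz projections this term is holomorphic near the outer base point and contributes no
  residue.\<close>

lemma cauchy_transform_circlepath_holomorphic:
  assumes f: "continuous_on (sphere z r) f" and r: "r > 0"
  shows "(\<lambda>w. contour_integral (circlepath z r) (\<lambda>\<zeta>. f \<zeta> / (\<zeta> - w))) holomorphic_on - sphere z r"
proof -
  have img: "path_image (circlepath z r) = sphere z r" using r by simp
  have int: "((\<lambda>\<zeta>. f \<zeta> / (\<zeta> - w) ^ 1) has_contour_integral
      contour_integral (circlepath z r) (\<lambda>\<zeta>. f \<zeta> / (\<zeta> - w))) (circlepath z r)"
    if "w \<in> UNIV - path_image (circlepath z r)" for w
  proof -
    have "(\<lambda>\<zeta>. f \<zeta> / (\<zeta> - w)) contour_integrable_on circlepath z r"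
      using r that img f by (intro contour_integrable_continuous_circlepath continuous_intros) auto
    then show ?thesis by (simp add: has_contour_integral_integral)
  qed
  have "(\<lambda>w. contour_integral (circlepath z r) (\<lambda>\<zeta>. f \<zeta> / (\<zeta> - w))) field_differentiable at w"
    if "w \<in> - sphere z r" for w
  proof -
    have "((\<lambda>w. contour_integral (circlepath z r) (\<lambda>\<zeta>. f \<zeta> / (\<zeta> - w))) has_field_derivative
        of_nat 1 * contour_integral (circlepath z r) (\<lambda>\<zeta>. f \<zeta> / (\<zeta> - w) ^ Suc 1)) (at w)"
      by (rule Cauchy_next_derivative(2)[where S = UNIV and B = "2 * pi * \<bar>r\<bar>", OF _ _ int])
        (use that f img in \<open>auto simp: vector_derivative_circlepath norm_mult\<close>)
    then show ?thesis by (auto simp: field_differentiable_def)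
  qed
  then show ?thesis by (simp add: holomorphic_on_def field_differentiable_at_within)
qed

text \<open>Take the residue at \<open>z0\<close> in the formula for R(w) applied to the projected
  vector: besides a function holomorphic near \<open>z0\<close> it contains R(w) u if
  \<open>z0 = z1\<close>, and nothing otherwise.\<close>

lemma riesz_projection_product:
  fixes A :: "'a::chilbert_space \<Rightarrow> 'a"
  assumes lin: "linear_operator D A" and r0: "riesz_radius D A z0 r0" and r1: "riesz_radius D A z1 r1"
  shows "riesz_projection D A z0 (riesz_projection D A z1 u)
    = (if z0 = z1 then riesz_projection D A z1 u else 0)"
proof (rule cinner_eqI)
  fix v
  let ?R = "resolvent D A"
  \<comment> \<open>For distinct centres, half their distance keeps \<open>z0\<close> outside the
    closed disc around \<open>z1\<close>; otherwise \<open>z0\<close> is its centre. Either way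
    \<open>z0\<close> avoids the circle.\<close>
  define r where "r = (if z0 = z1 then r1 else min r1 (dist z0 z1 / 2))"
  have pos1: "r1 > 0" using r1 by (simp add: riesz_radius_def)
  have pos: "r > 0" using pos1 by (simp add: r_def)
  have r: "riesz_radius D A z1 r"
    by (rule riesz_radius_mono[OF r1 pos]) (simp add: r_def)
  have off: "z0 \<notin> sphere z1 r" 
    using pos pos1 zero_less_dist_iff[of z0 z1]
    by (cases "z0 = z1") (auto simp: r_def dist_commute[of z1 z0] min_def split: if_splits)
  define h where "h w = - (1 / (2 * of_real pi * \<i>) *
    contour_integral (circlepath z1 r) (\<lambda>\<zeta>. cinner (?R \<zeta> u) v / (\<zeta> - w)))" for w
  have "sphere z1 r \<subseteq> resolvent_set D A" using r by (simp add: riesz_radius_def)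
  then have "continuous_on (sphere z1 r) (\<lambda>\<zeta>. cinner (?R \<zeta> u) v)"
    using holomorphic_on_imp_continuous_on[OF holomorphic_resolvent[OF lin]] continuous_on_subset by blast
  from cauchy_transform_circlepath_holomorphic[OF this pos]
  have h: "h holomorphic_on - sphere z1 r" unfolding h_def by (intro holomorphic_intros)
  have h0: "residue h z0 = 0"
    by (rule residue_holo[OF _ _ h]) (use off in auto)
  have ev: "\<forall>\<^sub>F w in at z0. w \<in> resolvent_set D A \<and> w \<notin> sphere z1 r \<and> (w \<in> ball z1 r \<longleftrightarrow> z0 = z1)"
  proof (intro eventually_conj eventually_in_resolvent_set[OF r0])
    have "open (- sphere z1 r)" by (simp add: open_Compl)
    then have "\<forall>\<^sub>F w in at z0. w \<in> - sphere z1 r"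
      using off by (intro eventually_at_in_open') auto
    then show "\<forall>\<^sub>F w in at z0. w \<notin> sphere z1 r" by simp
    show "\<forall>\<^sub>F w in at z0. w \<in> ball z1 r \<longleftrightarrow> z0 = z1"
    proof (cases "z0 = z1")
      case True
      then have "\<forall>\<^sub>F w in at z0. w \<in> ball z1 r"
        using pos by (intro eventually_at_in_open') auto
      then show ?thesis using True by simp
    next
      case False
      then have "z0 \<in> - cball z1 r" using pos1 zero_less_dist_iff[of z0 z1]
        by (auto simp: r_def dist_commute[of z1 z0] min_def split: if_splits)
      then have "\<forall>\<^sub>F w in at z0. w \<in> - cball z1 r"
        by (intro eventually_at_in_open') (auto simp: open_Compl)
      then show ?thesis using False by (auto elim: eventually_mono)
    qed
  qed
  have "cinner (riesz_projection D A z0 (riesz_projection D A z1 u)) v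
      = residue (\<lambda>w. cinner (?R w (riesz_projection D A z1 u)) v) z0"
    by (rule riesz_projection_residue[OF lin r0])
  also have "\<dots> = residue (\<lambda>w. (if z0 = z1 then cinner (?R w u) v else 0) + h w) z0"
  proof (rule residue_cong[OF _ refl])
    show "\<forall>\<^sub>F w in at z0. cinner (?R w (riesz_projection D A z1 u)) v
        = (if z0 = z1 then cinner (?R w u) v else 0) + h w"
      using ev
    proof eventually_elim
      case (elim w)
      then show ?case
        using resolvent_riesz_projection[OF lin r, of w u v] by (simp add: h_def)
    qed
  qed
  also have "\<dots> = (if z0 = z1 then cinner (riesz_projection D A z1 u) v else 0)"
  proof (cases "z0 = z1")
    case True
    have "residue (\<lambda>w. cinner (?R w u) v + h w) z0 = residue (\<lambda>w. cinner (?R w u) v) z0 + residue h z0"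
    proof (rule residue_add[of "ball z0 r"])
      show "(\<lambda>w. cinner (?R w u) v) holomorphic_on ball z0 r - {z0}"
        by (rule holomorphic_on_subset[OF holomorphic_resolvent[OF lin]])
          (use riesz_radius_ball[OF r] True in blast)
      show "h holomorphic_on ball z0 r - {z0}"
        by (rule holomorphic_on_subset[OF h]) (use True in auto)
    qed (use pos in auto)
    then show ?thesis
      using h0 True by (simp add: riesz_projection_residue[OF lin r])
  qed (simp add: h0)
  finally show "cinner (riesz_projection D A z0 (riesz_projection D A z1 u)) v
      = cinner (if z0 = z1 then riesz_projection D A z1 u else 0) v" by simp
qed

text \<open>The second resolvent identity \<open>R = R\<^sub>0 + R K R\<^sub>0\<close>; the contour integral of \<open>R\<^sub>0\<close> vanishes.\<close>

lemma riesz_projection_approximable: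
  fixes A A0 :: "'a::chilbert_space \<Rightarrow> 'a"
  assumes lin: "linear_operator D A" and lin0: "linear_operator D A0"
    and K: "approximable K" and A: "\<And>u. u \<in> D \<Longrightarrow> A u = A0 u + blinfun_apply K u"
    and r1: "riesz_radius D A z r1" and z: "z \<in> resolvent_set D A0"
  shows "approximable (riesz_projection D A z)"
proof -
  let ?R = "resolvent D A" and ?Q = "resolvent D A0"
  obtain e where e: "e > 0" "cball z e \<subseteq> resolvent_set D A0"
    using open_resolvent_set[OF lin0] z open_contains_cball by blast
  \<comment> \<open>Small enough for the disc to lie in the resolvent set of \<open>A0\<close>, so
    that Cauchy's theorem disposes of \<open>?Q\<close>. The remaining integrand is approximable
    because of its factor \<open>K\<close>.\<close>
  define r where "r = min e r1"
  have "r1 > 0" using r1 by (simp add: riesz_radius_def)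
  then have pos: "r > 0" using e by (simp add: r_def)
  have r: "riesz_radius D A z r" by (rule riesz_radius_mono[OF r1 pos]) (simp add: r_def)
  have sph: "sphere z r \<subseteq> resolvent_set D A" using r by (simp add: riesz_radius_def)
  have cb: "cball z r \<subseteq> resolvent_set D A0" using e(2) by (auto simp: r_def)
  then have sph0: "sphere z r \<subseteq> resolvent_set D A0" by auto
  have cont: "continuous_on (sphere z r) ?R" "continuous_on (sphere z r) ?Q"
    using continuous_on_resolvent[OF lin] continuous_on_resolvent[OF lin0] sph sph0 continuous_on_subset by blast+
  let ?F = "\<lambda>\<zeta>. ?R \<zeta> o\<^sub>L K o\<^sub>L ?Q \<zeta>"
  have contF: "continuous_on (sphere z r) ?F"
    by (intro bounded_bilinear.continuous_on[OF bounded_bilinear_blinfun_compose] cont continuous_on_const)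
  have second: "?R \<zeta> u = ?Q \<zeta> u + ?F \<zeta> u" if "\<zeta> \<in> sphere z r" for \<zeta> u
  proof -
    note R0 = resolvent_props[OF lin0 subsetD[OF sph0 that]]
    have left: "?R \<zeta> (\<zeta> *\<^sub>C ?Q \<zeta> u - A (?Q \<zeta> u)) = ?Q \<zeta> u"
      by (rule resolvent_props(3)[OF lin subsetD[OF sph that] R0(1)])
    have "\<zeta> *\<^sub>C ?Q \<zeta> u - A (?Q \<zeta> u) = (\<zeta> *\<^sub>C ?Q \<zeta> u - A0 (?Q \<zeta> u)) - K (?Q \<zeta> u)"
      by (simp add: A R0(1))
    also have "\<dots> = u - K (?Q \<zeta> u)" by (simp only: R0(2))
    finally have "?R \<zeta> (u - K (?Q \<zeta> u)) = ?Q \<zeta> u" using left by (simp only:)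
    then show ?thesis by (simp add: blinfun.diff_right algebra_simps)
  qed
  have "vector_contour_integral (circlepath z r) ?R = vector_contour_integral (circlepath z r) ?F"
  proof (rule blinfun_eqI, rule cinner_eqI)
    fix u v
    have zero: "((\<lambda>\<zeta>. cinner (?Q \<zeta> u) v) has_contour_integral 0) (circlepath z r)"
      by (rule Cauchy_theorem_convex_simple[of _ "cball z r"])
        (use pos holomorphic_on_subset[OF holomorphic_resolvent[OF lin0] cb] in auto)
    have "continuous_on (sphere z r) (\<lambda>\<zeta>. cinner (?F \<zeta> u) v)"
      by (intro cinner.continuous_on continuous_on_const
          bounded_linear.continuous_on[OF blinfun.bounded_linear_left] contF)
    then have int: "(\<lambda>\<zeta>. cinner (?F \<zeta> u) v) contour_integrable_on circlepath z r"
      using pos by (intro contour_integrable_continuous_circlepath) simp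
    have "cinner (vector_contour_integral (circlepath z r) ?R u) v
        = contour_integral (circlepath z r) (\<lambda>\<zeta>. cinner (?Q \<zeta> u) v + cinner (?F \<zeta> u) v)"
      unfolding cinner_vector_contour_integral[OF pos cont(1)]
    proof (rule contour_integral_cong[OF refl])
      fix \<zeta> assume "\<zeta> \<in> path_image (circlepath z r)"
      then have "\<zeta> \<in> sphere z r" using pos by simp
      then show "cinner (?R \<zeta> u) v = cinner (?Q \<zeta> u) v + cinner (?F \<zeta> u) v"
        by (simp only: second cinner_add_left)
    qed
    also have "\<dots> = 0 + contour_integral (circlepath z r) (\<lambda>\<zeta>. cinner (?F \<zeta> u) v)"
      by (intro contour_integral_unique has_contour_integral_add zero has_contour_integral_integral int)
    finally show "cinner (vector_contour_integral (circlepath z r) ?R u) v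
        = cinner (vector_contour_integral (circlepath z r) ?F u) v"
      unfolding cinner_vector_contour_integral[OF pos contF] by simp
  qed
  moreover have "approximable (vector_contour_integral (circlepath z r) ?F)"
  proof (rule vector_contour_integral_approximable[OF pos contF])
    fix \<zeta> assume \<zeta>: "\<zeta> \<in> sphere z r"
    show "approximable (?F \<zeta>)"
      by (intro approximable_compose_right approximable_compose_left K
          resolvent_props(4)[OF lin] resolvent_props(4)[OF lin0] subsetD[OF sph \<zeta>] subsetD[OF sph0 \<zeta>])
  qed
  ultimately show ?thesis
    unfolding riesz_projection_eq[OF lin r] by (simp add: approximable_scaleC)
qed

subsection \<open>Power bounds from the spectral radius\<close>

lemma inverse_resolvent_expansion:
  assumes T: "clin T" and \<mu>: "\<mu> \<in> resolvent_set UNIV (blinfun_apply T)"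
  shows "\<mu> *\<^sub>C resolvent UNIV T \<mu> u = u + resolvent UNIV T \<mu> (blinfun_apply T u)"
  using resolvent_props(3)[OF linear_operator_UNIV[OF T] \<mu>, of u]
  by (simp add: blinfun.diff_right clinD[OF resolvent_props(4)[OF linear_operator_UNIV[OF T] \<mu>]] algebra_simps)

text \<open>For \<open>\<bar>z\<bar> \<le> 1/\<rho>\<close> the function \<open>z \<mapsto> \<langle>(1 - z T)\<^sup>-\<^sup>1 u, v\<rangle>\<close> is analytic with Taylor coefficients
  \<open>\<langle>T\<^sup>n u, v\<rangle>\<close>, which Cauchy's inequality estimates.\<close>

lemma power_bound:
  fixes T :: "'a::chilbert_space \<Rightarrow>\<^sub>L 'a"
  assumes T: "clin T" and \<rho>: "\<rho> > 0" and res: "\<And>\<mu>. norm \<mu> \<ge> \<rho> \<Longrightarrow> \<mu> \<in> resolvent_set UNIV (blinfun_apply T)"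
  shows "\<exists>C\<ge>0. \<forall>n x. norm ((blinfun_apply T ^^ n) x) \<le> C * \<rho> ^ n * norm x"
proof -
  let ?R = "resolvent UNIV (blinfun_apply T)" and ?\<rho> = "resolvent_set UNIV (blinfun_apply T)"
  note lin = linear_operator_UNIV[OF T]
  \<comment> \<open>For z \<noteq> 0 the inverse of 1 - z T is R(1/z) / z; the value at 0 fills the
    removable singularity.\<close>
  define f where "f u v z = (if z = 0 then cinner u v else cinner (?R (1/z) u) v / z)" for u v z
  define W where "W = {z \<in> - {0}. 1/z \<in> ?\<rho>}"
  have W_open: "open W"
  proof -
    have "continuous_on (- {0::complex}) (\<lambda>z. 1/z)" by (intro continuous_intros) auto
    then have "open ((- {0}) \<inter> (\<lambda>z. 1/z) -` ?\<rho>)"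
      by (intro continuous_open_preimage open_resolvent_set[OF lin]) (auto simp: open_Compl)
    then show ?thesis by (simp add: W_def Int_def vimage_def)
  qed
  have W: "z \<in> W" if "z \<noteq> 0" "norm z \<le> 1 / \<rho>" for z
  proof -
    have "norm (1/z) \<ge> \<rho>" using that \<rho> by (simp add: norm_divide field_simps)
    then show ?thesis using that res by (simp add: W_def)
  qed
  have holW: "f u v holomorphic_on W" for u v
  proof -
    have "(\<lambda>z. cinner (?R (1/z) u) v / z) holomorphic_on W"
    proof (intro holomorphic_intros)
      have "((\<lambda>\<mu>. cinner (?R \<mu> u) v) \<circ> (\<lambda>z. 1/z)) holomorphic_on W"
        by (rule holomorphic_on_compose_gen[OF _ holomorphic_resolvent[OF lin]])
          (auto simp: W_def intro!: holomorphic_intros)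
      then show "(\<lambda>z. cinner (?R (1/z) u) v) holomorphic_on W" by (simp add: o_def)
    qed (simp add: W_def)
    then show ?thesis by (rule holomorphic_transform) (simp add: f_def W_def)
  qed
  have step: "f u v z = cinner u v + z * f (T u) v z" if "z = 0 \<or> z \<in> W" for u v z
  proof (cases "z = 0")
    case False
    then have "1/z \<in> ?\<rho>" using that by (simp add: W_def)
    from inverse_resolvent_expansion[OF T this, of u]
    have "1/z * cinner (?R (1/z) u) v = cinner u v + cinner (?R (1/z) (T u)) v"
      by (metis cinner_add_left cinner_scaleC_left)
    then show ?thesis using False by (simp add: f_def)
  qed (simp add: f_def)
  have isCont0: "isCont (f u v) 0" for u v
  proof -
    \<comment> \<open>Below 1/\<rho> the resolvent at 1/z exists. Below the second bound, R(1/z) x =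
      z (x + T R(1/z) x) gives |R(1/z) x| \<le> 2 |x| |z|, which controls \<open>f\<close> near
      0.\<close>
    define \<delta> where "\<delta> = min (1 / \<rho>) (1 / (2 * (norm T + 1)))"
    have pos: "norm T + 1 > 0" by (simp add: add_nonneg_pos)
    then have \<delta>: "\<delta> > 0" using \<rho> by (simp add: \<delta>_def)
    have small: "norm (?R (1/z) x) \<le> 2 * norm x * norm z" if z: "z \<noteq> 0" "norm z < \<delta>" for z x
    proof -
      have zW: "1/z \<in> ?\<rho>" using W[of z] z by (simp add: \<delta>_def W_def)
      have half: "norm z * norm T \<le> 1/2"
      proof -
        have "norm z * (2 * (norm T + 1)) \<le> 1" using z pos by (simp add: \<delta>_def field_simps)
        then have "norm z * 2 + norm z * norm T * 2 \<le> 1" by (simp add: algebra_simps)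
        then show ?thesis using norm_ge_zero[of z] by linarith
      qed
      have "?R (1/z) x = z *\<^sub>C (x + T (?R (1/z) x))"
        using resolvent_props(2)[OF lin zW, of x] z
        by (metis (no_types, lifting) add.commute diff_add_cancel nonzero_divide_eq_eq scaleC_one scaleC_scaleC mult.commute)
      then have "norm (?R (1/z) x) = norm z * norm (x + T (?R (1/z) x))"
        by (metis norm_scaleC)
      also have "\<dots> \<le> norm z * (norm x + norm T * norm (?R (1/z) x))"
        by (intro mult_left_mono norm_triangle_le add_left_mono norm_blinfun) simp
      also have "\<dots> \<le> norm z * norm x + 1/2 * norm (?R (1/z) x)"
        using mult_right_mono[OF half, of "norm (?R (1/z) x)"] by (simp add: algebra_simps)
      finally show ?thesis by (simp add: mult.commute[of "norm z" "norm x"])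
    qed
    have bound: "norm (f u v z - f u v 0) \<le> norm z * (2 * norm (T u) * norm v)"
      if z: "z \<noteq> 0" "norm z < \<delta>" for z
    proof -
      have "norm (cinner (?R (1/z) (T u)) v) \<le> 2 * norm (T u) * norm z * norm v"
        by (rule order_trans[OF cauchy_schwarz mult_right_mono[OF small]]) (use z in auto)
      then have "norm (f (T u) v z) \<le> 2 * norm (T u) * norm v"
        using z by (simp add: f_def norm_divide field_simps)
      moreover have "f u v z - f u v 0 = z * f (T u) v z"
        using step[of z u v] W[of z] z by (simp add: f_def[of u v 0] \<delta>_def)
      ultimately show ?thesis by (simp add: norm_mult mult_left_mono)
    qed
    have "((\<lambda>z::complex. norm z * (2 * norm (T u) * norm v)) \<longlongrightarrow> 0) (at 0)"
      by (intro tendsto_mult_left_zero tendsto_norm_zero tendsto_ident_at)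
    moreover have "\<forall>\<^sub>F z in at 0. norm (f u v z - f u v 0) \<le> norm z * (2 * norm (T u) * norm v)"
      using bound \<delta> by (auto simp: eventually_at)
    ultimately have "((\<lambda>z. f u v z - f u v 0) \<longlongrightarrow> 0) (at 0)"
      by (rule Lim_null_comparison[rotated])
    then show ?thesis by (simp add: isCont_def LIM_zero_iff)
  qed
  have cont: "continuous_on (cball 0 (1/\<rho>)) (f u v)" for u v
  proof (rule continuous_at_imp_continuous_on, intro ballI)
    fix z :: complex assume z: "z \<in> cball 0 (1/\<rho>)"
    show "isCont (f u v) z"
    proof (cases "z = 0")
      case False
      then have "z \<in> W" using W z by simp
      then show ?thesis
        using holomorphic_on_imp_continuous_on[OF holW] W_open by (simp add: continuous_on_eq_continuous_at)
    qed (simp add: isCont0)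
  qed
  have hol: "f u v holomorphic_on ball 0 (1/\<rho>)" for u v
  proof (rule no_isolated_singularity[where K = "{0}"])
    show "continuous_on (ball 0 (1/\<rho>)) (f u v)"
      by (rule continuous_on_subset[OF cont]) auto
    show "f u v holomorphic_on ball 0 (1/\<rho>) - {0}"
      by (rule holomorphic_on_subset[OF holW]) (auto intro!: W)
  qed auto
  have expansion: "\<exists>F. f u v has_fps_expansion F" for u v
    using analytic_at_imp_has_fps_expansion_0 hol[of u v] \<rho>
    by (metis analytic_at centre_in_ball open_ball zero_less_divide_1_iff)
  have ev: "\<forall>\<^sub>F z in nhds 0. f u v z = cinner u v + z * f (T u) v z" for u v
  proof -
    have "\<forall>\<^sub>F z in nhds 0. z \<in> ball 0 (1/\<rho>)"
      using \<rho> by (intro eventually_nhds_in_open) auto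
    then show ?thesis
    proof eventually_elim
      case (elim z)
      then have "z = 0 \<or> z \<in> W" using W[of z] by (cases "z = 0") simp_all
      then show ?case by (rule step)
    qed
  qed
  \<comment> \<open>Comparing power series in \<open>ev\<close> shifts coefficients: the one of
    order n + 1 for \<open>u\<close> is the one of order n for \<open>T u\<close>.\<close>
  have coeff: "fps_nth F n = cinner ((blinfun_apply T ^^ n) u) v" if "f u v has_fps_expansion F" for F n u v
    using that
  proof (induction n arbitrary: u F)
    case 0
    then show ?case using has_fps_expansion_imp_0_eq_fps_nth_0[OF 0] by (simp add: f_def)
  next
    case (Suc n)
    obtain G where G: "f (T u) v has_fps_expansion G" using expansion by blast
    have "(\<lambda>z. cinner u v + z * f (T u) v z) has_fps_expansion fps_const (cinner u v) + fps_X * G"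
      by (intro fps_expansion_intros G)
    then have "f u v has_fps_expansion fps_const (cinner u v) + fps_X * G"
      using has_fps_expansion_cong[OF ev refl] by blast
    then have "fps_nth F (Suc n) = fps_nth (fps_const (cinner u v) + fps_X * G) (Suc n)"
      using fps_nth_fps_expansion[OF Suc.prems] fps_nth_fps_expansion by metis
    then show ?case using Suc.IH[OF G] by (simp add: funpow_swap1)
  qed
  have "compact (?R ` sphere 0 \<rho>)"
    by (intro compact_continuous_image continuous_on_subset[OF continuous_on_resolvent[OF lin]])
      (auto intro!: res)
  then obtain B where B: "\<And>\<mu>. norm \<mu> = \<rho> \<Longrightarrow> norm (?R \<mu>) \<le> B"
    using compact_imp_bounded by (force simp: bounded_iff)
  have B0: "B \<ge> 0" using order_trans[OF norm_ge_zero B[of "of_real \<rho>"]] \<rho> by simp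
  have "norm ((blinfun_apply T ^^ n) x) \<le> \<rho> * B * \<rho> ^ n * norm x" for n x
  proof -
    \<comment> \<open>Testing against \<open>?y\<close> itself turns the estimate of a coefficient
      into one of the squared norm of \<open>?y\<close>, from which one factor cancels.\<close>
    let ?y = "(blinfun_apply T ^^ n) x"
    obtain F where F: "f x ?y has_fps_expansion F" using expansion by blast
    have circle: "norm (f x ?y z) \<le> \<rho> * B * norm x * norm ?y" if z: "norm (0 - z) = 1/\<rho>" for z
    proof -
      have "z \<noteq> 0" using z \<rho> by auto
      have "norm (1/z) = \<rho>" using z by (simp add: norm_divide)
      then have "norm (cinner (?R (1/z) x) ?y) \<le> B * norm x * norm ?y"
        by (intro order_trans[OF cauchy_schwarz] mult_right_mono order_trans[OF norm_blinfun] B) auto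
      from mult_right_mono[OF this, of \<rho>] \<rho>
      have "norm (cinner (?R (1/z) x) ?y) * \<rho> \<le> \<rho> * B * norm x * norm ?y" by (simp add: mult_ac)
      moreover have "norm (f x ?y z) = norm (cinner (?R (1/z) x) ?y) * \<rho>"
        using \<open>z \<noteq> 0\<close> z by (simp add: f_def norm_divide)
      ultimately show ?thesis by simp
    qed
    have "norm ((deriv ^^ n) (f x ?y) 0) \<le> fact n * (\<rho> * B * norm x * norm ?y) / (1/\<rho>) ^ n"
      using \<rho> by (intro Cauchy_inequality hol cont circle) auto
    then have "norm (fps_nth F n) \<le> \<rho> * B * norm x * norm ?y * \<rho> ^ n"
      unfolding fps_nth_fps_expansion[OF F] by (simp add: norm_divide field_simps power_one_over)
    then have "(norm ?y)\<^sup>2 \<le> \<rho> * B * norm x * norm ?y * \<rho> ^ n"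
      by (simp add: coeff[OF F] cinner_self norm_power)
    then have "norm ?y * norm ?y \<le> (\<rho> * B * \<rho> ^ n * norm x) * norm ?y"
      by (simp add: power2_eq_square mult_ac)
    then show ?thesis
      using B0 \<rho> by (cases "norm ?y = 0") (auto simp: mult_le_cancel_right)
  qed
  then show ?thesis using B0 \<rho> by (intro exI[of _ "\<rho> * B"]) simp
qed

subsection \<open>Finiteness of the set of large eigenvalues\<close>

lemma eigenvector_span_invariant:
  assumes lin: "linear_operator D A" and v: "\<And>l. l \<in> \<Lambda> \<Longrightarrow> v l \<in> D \<and> A (v l) = l *\<^sub>C v l"
    and x: "x \<in> complex_vector.span (v ` \<Lambda>)"
  shows "x \<in> D \<and> A x \<in> complex_vector.span (v ` \<Lambda>)"
  using x
proof (induction rule: complex_vector.span_induct_alt)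
  case base
  have "A (0 *\<^sub>C 0) = 0 *\<^sub>C A 0"
    using lin unfolding linear_operator_def by (metis complex_vector.subspace_0)
  then show ?case
    using lin by (simp add: linear_operator_def complex_vector.subspace_0 complex_vector.span_zero)
next
  case (step c y x)
  then obtain l where l: "l \<in> \<Lambda>" "y = v l" by blast
  then have y: "y \<in> D" "A y = l *\<^sub>C y" using v by auto
  have cy: "c *\<^sub>C y \<in> D" "A (c *\<^sub>C y) = c *\<^sub>C A y"
    using lin y by (auto simp: linear_operator_def complex_vector.subspace_scale)
  have "A (c *\<^sub>C y + x) = c *\<^sub>C l *\<^sub>C y + A x"
    using lin cy step y by (simp add: linear_operator_def)
  moreover have "c *\<^sub>C y + x \<in> D"
    using lin cy step by (simp add: linear_operator_def complex_vector.subspace_add)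
  moreover have "y \<in> complex_vector.span (v ` \<Lambda>)" using step(1) by (rule complex_vector.span_base)
  then have "c *\<^sub>C l *\<^sub>C y + A x \<in> complex_vector.span (v ` \<Lambda>)"
    using step by (simp add: complex_vector.span_add complex_vector.span_scale)
  ultimately show ?case by simp
qed

text \<open>Induction on the eigenvalues: applying A - l to \<open>x\<close> removes the component
  along \<open>v l\<close>, so \<open>(k - l) *\<^sub>C x\<close>, and hence \<open>x\<close>, lies
  in the smaller span.\<close>

lemma eigenvector_span_new_eigenvalue:
  assumes lin: "linear_operator D A" and "finite \<Lambda>"
    and "\<And>l. l \<in> \<Lambda> \<Longrightarrow> v l \<in> D \<and> A (v l) = l *\<^sub>C v l"
    and "x \<in> complex_vector.span (v ` \<Lambda>)" "A x = k *\<^sub>C x" "k \<notin> \<Lambda>"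
  shows "x = 0"
  using assms(2-)
proof (induction \<Lambda> arbitrary: x)
  case (insert l \<Lambda>)
  have v: "v l \<in> D" "A (v l) = l *\<^sub>C v l" and "k \<noteq> l" using insert.prems by auto
  obtain c where c: "x - c *\<^sub>C v l \<in> complex_vector.span (v ` \<Lambda>)"
    using insert.prems(2) by (auto simp: complex_vector.span_insert)
  define y where "y = x - c *\<^sub>C v l"
  have y: "y \<in> D" "A y \<in> complex_vector.span (v ` \<Lambda>)"
    using eigenvector_span_invariant[OF lin, of \<Lambda> v y] c insert.prems(1) by (auto simp: y_def)
  have x: "x = y + c *\<^sub>C v l" by (simp add: y_def)
  have cv: "c *\<^sub>C v l \<in> D" "A (c *\<^sub>C v l) = c *\<^sub>C l *\<^sub>C v l"
    using lin v by (auto simp: linear_operator_def complex_vector.subspace_scale)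
  have "A x = A y + c *\<^sub>C l *\<^sub>C v l"
    unfolding x using lin y cv by (simp add: linear_operator_def)
  then have "k *\<^sub>C x - l *\<^sub>C x = A y + c *\<^sub>C l *\<^sub>C v l - l *\<^sub>C (y + c *\<^sub>C v l)"
    using insert.prems(3) x by simp
  also have "\<dots> = A y - l *\<^sub>C y"
    by (simp add: scaleC_simps mult.commute)
  also have "\<dots> \<in> complex_vector.span (v ` \<Lambda>)"
    using y c by (intro complex_vector.span_diff complex_vector.span_scale) (simp_all add: y_def)
  finally have "(k - l) *\<^sub>C x \<in> complex_vector.span (v ` \<Lambda>)"
    by (simp add: complex_vector.scale_left_diff_distrib)
  then have "(1 / (k - l)) *\<^sub>C (k - l) *\<^sub>C x \<in> complex_vector.span (v ` \<Lambda>)"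
    by (rule complex_vector.span_scale)
  then have "x \<in> complex_vector.span (v ` \<Lambda>)"
    using \<open>k \<noteq> l\<close> by (simp only: scaleC_scaleC) (simp add: scaleC_one)
  then show ?case using insert by auto
qed simp

text \<open>Orthonormalising eigenvectors triangularises \<open>T\<close>, with the eigenvalues on the diagonal.\<close>

lemma eigenvectors_orthonormalise:
  fixes T :: "'a::chilbert_space \<Rightarrow>\<^sub>L 'a"
  assumes lin: "linear_operator D A" and T: "clin T" and "finite \<Lambda>"
    and "\<And>l. l \<in> \<Lambda> \<Longrightarrow> v l \<in> D \<and> A (v l) = l *\<^sub>C v l \<and> v l \<noteq> 0 \<and> T (v l) = \<mu> l *\<^sub>C v l"
  obtains W where "orthonormal W" "card W = card \<Lambda>"
    "complex_vector.span W = complex_vector.span (v ` \<Lambda>)" "\<And>w. w \<in> W \<Longrightarrow> \<exists>l\<in>\<Lambda>. cinner (T w) w = \<mu> l"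
  using assms(3-)
proof (induction \<Lambda> arbitrary: thesis)
  case empty
  show ?case by (rule empty(1)[of "{}"]) (simp_all add: orthonormal_def)
next
  case (insert l \<Lambda>)
  obtain W where W: "orthonormal W" "card W = card \<Lambda>" "complex_vector.span W = complex_vector.span (v ` \<Lambda>)"
    "\<And>w. w \<in> W \<Longrightarrow> \<exists>l\<in>\<Lambda>. cinner (T w) w = \<mu> l"
    using insert.IH insert.prems(2) by blast
  have l: "v l \<in> D" "A (v l) = l *\<^sub>C v l" "v l \<noteq> 0" "T (v l) = \<mu> l *\<^sub>C v l"
    using insert.prems(2) by auto
  have new: "v l \<notin> complex_vector.span W"
    using eigenvector_span_new_eigenvalue[OF lin insert.hyps(1), of v "v l" l] insert l W(3) by auto
  define p where "p = v l - oproj W (v l)"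
  define e where "e = complex_of_real (1 / norm p) *\<^sub>C p"
  note step = gram_schmidt_step[OF W(1) new, folded p_def, folded e_def]
  have inv: "T x \<in> complex_vector.span W" if "x \<in> complex_vector.span W" for x
  proof -
    have "T ` complex_vector.span (v ` \<Lambda>) \<subseteq> complex_vector.span (v ` \<Lambda>)"
      unfolding clin_span[OF T]
    proof (rule complex_vector.span_minimal)
      show "T ` v ` \<Lambda> \<subseteq> complex_vector.span (v ` \<Lambda>)"
      proof clarify
        fix m assume "m \<in> \<Lambda>"
        then have "T (v m) = \<mu> m *\<^sub>C v m" "v m \<in> v ` \<Lambda>" using insert.prems(2) by auto
        then show "T (v m) \<in> complex_vector.span (v ` \<Lambda>)"
          by (simp only: complex_vector.span_scale complex_vector.span_base)
      qed
    qed (rule complex_vector.subspace_span)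
    then show ?thesis using that W(3) by auto
  qed
  have np: "norm p \<noteq> 0" using new oproj_in_span[of W "v l"] by (auto simp: p_def)
  have "cinner (T e) e = \<mu> l"
  proof -
    let ?q = "oproj W (v l)" and ?c = "complex_of_real (1 / norm p)"
    \<comment> \<open>Modulo the span of \<open>W\<close>, which \<open>T\<close> leaves invariant,
      \<open>e\<close> is a multiple of \<open>v l\<close>. So \<open>T e\<close> is
      \<open>\<mu> l *\<^sub>C e\<close> up to a vector of that span, which is orthogonal to
      \<open>e\<close>.\<close>
    have "T e = ?c *\<^sub>C (\<mu> l *\<^sub>C v l - T ?q)"
      by (simp add: e_def p_def clinD[OF T] blinfun.diff_right l)
    also have "\<dots> = \<mu> l *\<^sub>C e + ?c *\<^sub>C (\<mu> l *\<^sub>C ?q - T ?q)"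
      by (simp add: e_def p_def scaleC_simps mult.commute)
    finally have "cinner (T e) e = \<mu> l * cinner e e + ?c * cinner (\<mu> l *\<^sub>C ?q - T ?q) e"
      by (simp only: cinner_add_left cinner_scaleC_left)
    moreover have "cinner (\<mu> l *\<^sub>C ?q - T ?q) e = 0"
      using step(5)[of "\<mu> l *\<^sub>C ?q - T ?q"]
      by (subst cinner_swap_zero)
        (auto intro!: complex_vector.span_diff complex_vector.span_scale inv oproj_in_span)
    ultimately show ?thesis using step(6) by (simp add: cinner_self)
  qed
  moreover have "complex_vector.span (insert e W) = complex_vector.span (v ` insert l \<Lambda>)"
    using step(3) W(3) by (simp add: complex_vector.span_insert)
  moreover have "finite W" using W(1) by (simp add: orthonormal_def)
  ultimately show ?case
    using insert.prems(1)[OF step(1)] step(2) W insert.hyps by auto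
qed

text \<open>The diagonal entries of a compact operator in an orthonormal system are square summable
  up to a small error, by Bessel's inequality.\<close>

lemma finitely_many_large_diagonal_entries:
  fixes T G :: "'a::chilbert_space \<Rightarrow>\<^sub>L 'a"
  assumes G: "approximable G" and \<rho>: "\<rho> > 0" and small: "norm (T - G) \<le> \<rho> / 4"
  obtains N :: nat where "\<And>W. orthonormal W \<Longrightarrow> (\<And>w. w \<in> W \<Longrightarrow> norm (cinner (T w) w) \<ge> \<rho>) \<Longrightarrow> card W \<le> N"
proof -
  obtain E where E: "orthonormal E" "norm (G - (oproj E o\<^sub>L G)) < \<rho>/4"
    using approximable_oproj[OF G, of "\<rho>/4"] \<rho> by auto
  \<comment> \<open>From the double sum below: each vector of \<open>W\<close> contributes at least
    \<open>(\<rho>/2)\<^sup>2\<close>, each vector of \<open>E\<close> at most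
    \<open>(norm G)\<^sup>2\<close>.\<close>
  define b where "b = (norm G)\<^sup>2 * card E / (\<rho>/2)\<^sup>2"
  show thesis
  proof (rule that[of "nat \<lceil>b\<rceil>"])
    fix W :: "'a set" assume W: "orthonormal W" "\<And>w. w \<in> W \<Longrightarrow> norm (cinner (T w) w) \<ge> \<rho>"
    have le: "(\<rho>/2)\<^sup>2 \<le> (norm G)\<^sup>2 * (\<Sum>e\<in>E. (norm (cinner w e))\<^sup>2)" if w: "w \<in> W" for w
    proof -
      have nw: "norm w = 1" using W(1) w by (simp add: orthonormal_def)
      have err: "norm (cinner (B w) w) \<le> norm B" for B :: "'a \<Rightarrow>\<^sub>L 'a"
        using order_trans[OF cauchy_schwarz mult_right_mono[OF norm_blinfun[of B w]], of w] nw by simp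
      have "cinner (T w) w = cinner ((T - G) w) w + cinner ((G - (oproj E o\<^sub>L G)) w) w + cinner (oproj E (G w)) w"
        by (simp add: blinfun.diff_left cinner_diff_left)
      then have "\<rho> \<le> norm (cinner ((T - G) w) w) + norm (cinner ((G - (oproj E o\<^sub>L G)) w) w) + norm (cinner (oproj E (G w)) w)"
        using W(2)[OF w]
        by (simp only:) (blast intro: order_trans order_trans[OF norm_triangle_ineq add_right_mono[OF norm_triangle_ineq]])
      \<comment> \<open>Each of the two errors takes at most a quarter of
        \<open>\<rho>\<close>.\<close>
      then have "\<rho>/2 \<le> norm (cinner (oproj E (G w)) w)"
        using err[of "T - G"] err[of "G - (oproj E o\<^sub>L G)"] small E(2) by linarith
      also have "\<dots> \<le> norm (G w) * norm (oproj E w)"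
        unfolding cinner_oproj_commute by (rule cauchy_schwarz)
      also have "\<dots> \<le> norm G * norm (oproj E w)"
        using norm_blinfun[of G w] nw by (intro mult_right_mono) auto
      finally have "(\<rho>/2)\<^sup>2 \<le> (norm G * norm (oproj E w))\<^sup>2"
        using \<rho> by (intro power_mono) auto
      then show ?thesis by (simp add: power_mult_distrib norm_oproj_power2[OF E(1)])
    qed
    have "card W * (\<rho>/2)\<^sup>2 \<le> (\<Sum>w\<in>W. (norm G)\<^sup>2 * (\<Sum>e\<in>E. (norm (cinner w e))\<^sup>2))"
      using sum_mono[OF le] by simp
    \<comment> \<open>Once the sums are exchanged, Bessel's inequality for the system
      \<open>W\<close> applies to each vector of \<open>E\<close>, giving a bound independent of the
      size of \<open>W\<close>.\<close>
    also have "\<dots> = (norm G)\<^sup>2 * (\<Sum>e\<in>E. \<Sum>w\<in>W. (norm (cinner e w))\<^sup>2)"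
    proof -
      have "norm (cinner w e) = norm (cinner e w)" for w e :: 'a
        by (metis cinner_commute complex_mod_cnj)
      then have "(\<Sum>e\<in>E. (norm (cinner w e))\<^sup>2) = (\<Sum>e\<in>E. (norm (cinner e w))\<^sup>2)" for w
        by (intro sum.cong refl arg_cong[where f = "\<lambda>x. x\<^sup>2"])
      then show ?thesis
        by (simp only: sum_distrib_left[symmetric]) (subst sum.swap, rule refl)
    qed
    also have "\<dots> \<le> (norm G)\<^sup>2 * (\<Sum>e\<in>E. 1)"
    proof (intro mult_left_mono sum_mono)
      fix e assume "e \<in> E"
      then have "norm e = 1" using E(1) by (simp add: orthonormal_def)
      then show "(\<Sum>w\<in>W. (norm (cinner e w))\<^sup>2) \<le> 1" using bessel[OF W(1), of e] by simp
    qed simp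
    finally have "card W \<le> b" using \<rho> by (simp add: b_def field_simps)
    then show "card W \<le> nat \<lceil>b\<rceil>" by linarith
  qed
qed

subsection \<open>Compact perturbations of generators\<close>

locale compactly_perturbed_generator = perturbed_semigroup S C b K
  for S :: "real \<Rightarrow> 'a::chilbert_space \<Rightarrow>\<^sub>L 'a" and C b and K :: "'a \<Rightarrow>\<^sub>L 'a" +
  fixes D :: "'a set" and A0 :: "'a \<Rightarrow> 'a"
  assumes gen0: "generates D A0 S" and lin0: "linear_operator D A0"
    and K_approximable: "approximable K" and K_compact: "bounded X \<Longrightarrow> compact (closure (K ` X))"
begin

definition A :: "'a \<Rightarrow> 'a" where "A u = A0 u + K u"

lemma lin_A: "linear_operator D A"
  using lin0 by (auto simp: linear_operator_def A_def blinfun.add_right clinD[OF clin_K] scaleC_add_right)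

sublocale unperturbed: semigroup_generator S C b D A0
  by unfold_locales (rule gen0 lin0)+

sublocale perturbed: semigroup_generator pert "2 * C" rate D A
  using pert_generates[OF gen0] lin_A
  by (intro semigroup_generator.intro pert_bounded_semigroup semigroup_generator_axioms.intro)
    (simp_all add: A_def[abs_def])

lemma pert_approximable: "t \<ge> 0 \<Longrightarrow> approximable (pert t - S t)"
  by (rule pert_diff_approximable[OF K_compact])

text \<open>The n-th power of \<open>S t\<close> is \<open>S (real n * t)\<close>, so
  \<open>C\<close> enters once and not n times; the Neumann series of \<open>S t\<close> divided by
  \<open>\<mu>\<close> thus converges for any \<open>C\<close>.\<close>

lemma invertible_outside_disc:
  assumes t: "t \<ge> 0" and \<mu>: "norm \<mu> > exp (b * t)"
  shows "cinvertible (\<mu> *\<^sub>C id_blinfun - S t)"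
proof -
  have \<mu>0: "\<mu> \<noteq> 0" using \<mu> by auto
  let ?B = "(1/\<mu>) *\<^sub>C S t" and ?q = "exp (b * t) / norm \<mu>"
  have iter: "(blinfun_apply ?B ^^ n) x = (1/\<mu>)^n *\<^sub>C S (real n * t) x" for n x
  proof (induction n)
    case 0
    then show ?case by (simp add: scaleC_one)
  next
    case (Suc n)
    have "S t (S (real n * t) x) = S (real (Suc n) * t) x"
      using t by (simp add: algebra_simps flip: S_add)
    then show ?case
      using Suc by (simp add: blinfun_apply_scaleC clinD[OF clin_S[OF t]] scaleC_scaleC)
  qed
  have "cinvertible (id_blinfun - ?B)"
  proof (rule cinvertible_id_minus[of _ C ?q])
    show "clin ?B" by (intro clin_scaleC clin_S t)
    show "?q < 1" using \<mu> \<mu>0 by simp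
    fix n x
    have "norm (S (real n * t) x) \<le> C * exp (b * (real n * t)) * norm x"
      by (rule order_trans[OF norm_blinfun mult_right_mono[OF norm_S]]) (use t in auto)
    then have "norm (S (real n * t) x) \<le> C * exp (b * t) ^ n * norm x"
      by (simp add: mult_ac flip: exp_of_nat_mult)
    then have "norm (1/\<mu>) ^ n * norm (S (real n * t) x) \<le> norm (1/\<mu>) ^ n * (C * exp (b * t) ^ n * norm x)"
      by (rule mult_left_mono) simp
    then show "norm ((blinfun_apply ?B ^^ n) x) \<le> C * ?q ^ n * norm x"
      unfolding iter by (simp add: norm_scaleC norm_power norm_divide power_divide mult_ac)
  qed simp
  then have "cinvertible (\<mu> *\<^sub>C (id_blinfun - ?B))" by (rule cinvertible_scaleC[OF _ \<mu>0])
  moreover have "\<mu> *\<^sub>C (id_blinfun - ?B) = \<mu> *\<^sub>C id_blinfun - S t"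
    using \<mu>0 by (simp add: complex_vector.scale_right_diff_distrib scaleC_scaleC scaleC_one)
  ultimately show ?thesis by simp
qed

text \<open>\<open>Re l > b\<close> puts \<open>exp l\<close> outside the disc for time 1, and
  \<open>spectral_inclusion\<close> carries this back to the generator.\<close>

lemma unperturbed_resolvent_set:
  assumes "Re l > b"
  shows "l \<in> resolvent_set D A0"
proof (rule unperturbed.spectral_inclusion[of 1])
  have "cinvertible (exp l *\<^sub>C id_blinfun - S 1)"
    using assms by (intro invertible_outside_disc) simp_all
  then have "cinvertible (exp (- l) *\<^sub>C (exp l *\<^sub>C id_blinfun - S 1))"
    by (rule cinvertible_scaleC) simp
  then show "cinvertible (id_blinfun - exp (- l * of_real 1) *\<^sub>C S 1)"
    by (simp add: complex_vector.scale_right_diff_distrib scaleC_scaleC scaleC_one flip: exp_add)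
qed simp

text \<open>On \<open>D\<close>, l - A = (1 - K R) (l - A0) with R the unperturbed resolvent at
  \<open>l\<close>. The Fredholm alternative applies to the compact K R, and R maps kernel vectors
  of 1 - K R to eigenvectors of \<open>A\<close>.\<close>

lemma spectrum_eigenvalue:
  assumes l: "l \<in> spectrum D A" "Re l > b"
  shows "eigenvalue D A l"
proof (rule ccontr)
  assume no: "\<not> eigenvalue D A l"
  let ?Q = "resolvent D A0 l"
  note Q = resolvent_props[OF lin0 unperturbed_resolvent_set[OF l(2)]]
  let ?G = "K o\<^sub>L ?Q"
  have shift: "l *\<^sub>C ?Q x - A (?Q x) = x - ?G x" for x
    using Q(2)[of x] by (simp add: A_def algebra_simps)
  have "cinvertible (id_blinfun - ?G)"
  proof (rule fredholm_alternative)
    show "cinvertible (id_blinfun :: 'a \<Rightarrow>\<^sub>L 'a)"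
      by (auto simp: cinvertible_def intro: exI[of _ id_blinfun])
    show "approximable ?G" by (intro approximable_compose_right Q(4) K_approximable)
    fix x assume "id_blinfun x = ?G x"
    then have x: "x = K (?Q x)" by simp
    then have "A (?Q x) = l *\<^sub>C ?Q x" using shift[of x] by simp
    then have "?Q x = 0" using no Q(1)[of x] by (auto simp: eigenvalue_def)
    then show "x = 0" using x by simp
  qed
  then obtain W where W: "clin W" "\<And>x. (id_blinfun - ?G) (blinfun_apply W x) = x"
    "\<And>x. W ((id_blinfun - ?G) x) = x" using cinvertibleE by blast
  have "l \<in> resolvent_set D A"
  proof (rule resolvent_eqI(1)[of "?Q o\<^sub>L W"])
    show "(?Q o\<^sub>L W) y \<in> D" for y by (simp add: Q(1))
    show "l *\<^sub>C (?Q o\<^sub>L W) y - A ((?Q o\<^sub>L W) y) = y" for y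
      using shift[of "W y"] W(2)[of y] by (simp add: blinfun.diff_left)
    fix u assume u: "u \<in> D"
    have Qu: "?Q (l *\<^sub>C u - A0 u) = u" by (rule Q(3)[OF u])
    have "l *\<^sub>C u - A u = (id_blinfun - ?G) (l *\<^sub>C u - A0 u)"
      using shift[of "l *\<^sub>C u - A0 u"] by (simp add: blinfun.diff_left Qu)
    then have "W (l *\<^sub>C u - A u) = l *\<^sub>C u - A0 u" by (simp only: W(3))
    then show "(?Q o\<^sub>L W) (l *\<^sub>C u - A u) = u" by (simp add: Qu)
  qed
  then show False using l by (simp add: spectrum_def)
qed

lemma eigenvalue_spectrum:
  assumes "u \<in> D" "u \<noteq> 0" "A u = l *\<^sub>C u"
  shows "l \<in> spectrum D A"
proof (rule ccontr)
  assume "l \<notin> spectrum D A"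
  then have "l \<in> resolvent_set D A" by (simp add: spectrum_def)
  from resolvent_eigenvector[OF lin_A this assms(1,3)] assms(2) show False by simp
qed

text \<open>Stated for any compact perturbation \<open>T\<close> of \<open>S t\<close>, as it serves
  both \<open>pert t\<close> and \<open>pert 1\<close> composed with the complementary
  projection.\<close>

lemma compactly_perturbed_eigenvalue:
  assumes t: "t \<ge> 0" and T: "clin T" "approximable (T - S t)" and \<mu>: "norm \<mu> > exp (b * t)"
    and spec: "\<mu> \<in> spectrum UNIV (blinfun_apply T)"
  obtains u where "u \<noteq> 0" "T u = \<mu> *\<^sub>C u"
proof -
  have "\<exists>u. u \<noteq> 0 \<and> T u = \<mu> *\<^sub>C u"
  proof (rule ccontr)
    assume no: "\<nexists>u. u \<noteq> 0 \<and> T u = \<mu> *\<^sub>C u"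
    have "cinvertible ((\<mu> *\<^sub>C id_blinfun - S t) - (T - S t))"
      by (rule fredholm_alternative[OF invertible_outside_disc[OF t \<mu>] T(2)])
        (use no in \<open>simp add: blinfun.diff_left blinfun_apply_scaleC; metis\<close>)
    then have "cinvertible (\<mu> *\<^sub>C id_blinfun - T)" by simp
    then show False using spec by (simp add: spectrum_def resolvent_set_blinfun_iff[OF T(1)])
  qed
  then show ?thesis using that by blast
qed

lemma finite_spectrum_halfplane:
  assumes \<epsilon>: "\<epsilon> > 0"
  shows "finite (spectrum D A \<inter> {z. Re z \<ge> b + \<epsilon>})"
proof (rule ccontr)
  assume inf: "infinite (spectrum D A \<inter> {z. Re z \<ge> b + \<epsilon>})"
  \<comment> \<open>By exp x \<ge> 1 + x this gives exp(\<epsilon> t) \<ge> 4 C, so the norm of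
    \<open>S t\<close> is at most \<open>\<rho> / 4\<close>, while the eigenvalues of
    \<open>pert t\<close> in question have modulus at least \<open>\<rho>\<close>.\<close>
  define t where "t = 4 * C / \<epsilon>"
  have t: "t \<ge> 0" using \<epsilon> C_nonneg by (simp add: t_def)
  define \<rho> where "\<rho> = exp ((b + \<epsilon>) * t)"
  have "4 * C \<le> exp (\<epsilon> * t)"
  proof -
    have "\<epsilon> * t = 4 * C" using \<epsilon> by (simp add: t_def)
    then have "exp (\<epsilon> * t) = exp (4 * C)" by simp
    then show ?thesis using exp_ge_add_one_self[of "4 * C"] by linarith
  qed
  then have "C * exp (b * t) \<le> \<rho> / 4"
    using mult_right_mono[of "4 * C" "exp (\<epsilon> * t)" "exp (b * t)"]
    by (simp add: \<rho>_def algebra_simps flip: exp_add)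
  then have "norm (pert t - (pert t - S t)) \<le> \<rho> / 4" using norm_S[OF t] by simp
  from finitely_many_large_diagonal_entries[OF pert_approximable[OF t] _ this]
  obtain N where N: "\<And>W. orthonormal W \<Longrightarrow> (\<And>w. w \<in> W \<Longrightarrow> norm (cinner (pert t w) w) \<ge> \<rho>) \<Longrightarrow> card W \<le> N"
    by (auto simp: \<rho>_def)
  \<comment> \<open>One eigenvalue more than the count of large diagonal entries allows.\<close>
  obtain \<Lambda> where \<Lambda>: "finite \<Lambda>" "card \<Lambda> = Suc N" "\<Lambda> \<subseteq> spectrum D A \<inter> {z. Re z \<ge> b + \<epsilon>}"
    using infinite_arbitrarily_large[OF inf] by blast
  have "\<exists>v. v \<in> D \<and> A v = l *\<^sub>C v \<and> v \<noteq> 0" if "l \<in> \<Lambda>" for l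
    using spectrum_eigenvalue[of l] that \<Lambda>(3) \<epsilon> by (force simp: eigenvalue_def)
  then obtain v where v: "\<And>l. l \<in> \<Lambda> \<Longrightarrow> v l \<in> D \<and> A (v l) = l *\<^sub>C v l \<and> v l \<noteq> 0" by metis
  have vT: "v l \<in> D \<and> A (v l) = l *\<^sub>C v l \<and> v l \<noteq> 0 \<and> pert t (v l) = exp (l * of_real t) *\<^sub>C v l"
    if "l \<in> \<Lambda>" for l
    using v[OF that] perturbed.eigenvector_S[of "v l" l t] t by auto
  obtain W where W: "orthonormal W" "card W = card \<Lambda>"
    "\<And>w. w \<in> W \<Longrightarrow> \<exists>l\<in>\<Lambda>. cinner (pert t w) w = exp (l * of_real t)"
  proof (rule eigenvectors_orthonormalise[OF lin_A clin_pert[OF t] \<Lambda>(1) vT])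
    fix W :: "'a set"
    assume "orthonormal W" "card W = card \<Lambda>"
      "\<And>w. w \<in> W \<Longrightarrow> \<exists>l\<in>\<Lambda>. cinner (pert t w) w = exp (l * of_real t)"
    then show thesis by (rule that)
  qed
  have "card W \<le> N"
  proof (rule N[OF W(1)])
    fix w assume "w \<in> W"
    then obtain l where l: "l \<in> \<Lambda>" "cinner (pert t w) w = exp (l * of_real t)" using W(3) by blast
    then have "Re l \<ge> b + \<epsilon>" using \<Lambda>(3) by blast
    then show "\<rho> \<le> norm (cinner (pert t w) w)"
      using t by (simp add: l(2) \<rho>_def mult_right_mono)
  qed
  then show False using W(2) \<Lambda>(2) by simp
qed

lemma spectrum_isolated:
  assumes l: "l \<in> spectrum D A" "Re l > b"
  shows "l isolated_in spectrum D A"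
proof -
  \<comment> \<open>Half the gap leaves \<open>l\<close> in the open half-plane right of
    \<open>b + \<epsilon>\<close>; the other spectral points there, finitely many, are cut
    out.\<close>
  define \<epsilon> where "\<epsilon> = (Re l - b) / 2"
  have \<epsilon>: "\<epsilon> > 0" "Re l > b + \<epsilon>" using l(2) by (simp_all add: \<epsilon>_def field_simps)
  let ?F = "spectrum D A \<inter> {z. Re z \<ge> b + \<epsilon>}"
  let ?T = "{z. Re z > b + \<epsilon>} - (?F - {l})"
  have "open ?T"
    by (intro open_Diff open_halfspace_Re_gt finite_imp_closed finite_Diff finite_spectrum_halfplane \<epsilon>)
  moreover have "?T \<inter> spectrum D A = {l}" using l(1) \<epsilon>(2) by auto
  ultimately show ?thesis using l(1) unfolding isolated_in_def by blast
qed

section \<open>Riesz projections in the half-plane right of \<open>b\<close>\<close>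

lemma spectrum_riesz_radius:
  assumes "l \<in> spectrum D A" "Re l > b"
  obtains r where "riesz_radius D A l r"
  using riesz_radius_exists[OF spectrum_isolated[OF assms]] by blast

lemma riesz_approximable:
  assumes l: "l \<in> spectrum D A" "Re l > b"
  shows "approximable (riesz_projection D A l)"
proof -
  obtain r where "riesz_radius D A l r" by (rule spectrum_riesz_radius[OF l])
  then show ?thesis
    by (rule riesz_projection_approximable[OF lin_A lin0 K_approximable A_def])
      (rule unperturbed_resolvent_set[OF l(2)])
qed

lemma finite_multiplicity:
  assumes l: "l \<in> spectrum D A" "Re l > b"
  shows "algebraic_multiplicity D A l < \<infinity>"
proof -
  obtain r where r: "riesz_radius D A l r" by (rule spectrum_riesz_radius[OF l])
  show ?thesis
    unfolding algebraic_multiplicity_def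
    by (rule approximable_projection_range[OF riesz_approximable[OF l]])
      (simp add: riesz_projection_product[OF lin_A r r])
qed

section \<open>Growth on the range of the complementary projection\<close>

lemma pert_resolvent:
  assumes t: "t \<ge> 0" and z: "z \<in> resolvent_set D A"
  shows "pert t (resolvent D A z x) = resolvent D A z (pert t x)"
proof -
  note R = resolvent_props[OF lin_A z]
  let ?u = "resolvent D A z x"
  have "z *\<^sub>C pert t ?u - A (pert t ?u) = pert t (z *\<^sub>C ?u - A ?u)"
    using perturbed.S_generator(2)[OF R(1)[of x] t] by (simp add: clinD[OF clin_pert[OF t]] blinfun.diff_right)
  also have "\<dots> = pert t x" by (simp only: R(2))
  finally show ?thesis
    using R(3)[OF perturbed.S_generator(1)[OF R(1)[of x] t]] by simp
qed

text \<open>The eigenvalues of \<open>S 1 (1 - P)\<close> outside the disc of radius \<open>e\<^sup>\<omega>\<close> would come from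
  eigenvectors of \<open>A\<close> in the range of \<open>1 - P\<close>, but \<open>P\<close> fixes all of these.\<close>

lemma complementary_growth_bound:
  assumes F: "finite F" "F \<subseteq> spectrum D A" "\<And>l. l \<in> F \<Longrightarrow> Re l > b"
    and \<omega>: "\<omega> > b" "\<And>l. l \<in> spectrum D A - F \<Longrightarrow> Re l < \<omega>"
  defines "P \<equiv> \<Sum>l\<in>F. riesz_projection D A l"
  shows "\<exists>c\<ge>1. \<forall>u. \<forall>t\<ge>0. norm (pert t (u - P u)) \<le> c * exp (\<omega> * t) * norm (u - P u)"
proof -
  let ?P = "riesz_projection D A"
  have "\<exists>r. riesz_radius D A l r" if "l \<in> F" for l
    using spectrum_riesz_radius[of l] F that by blast
  then obtain r where r: "\<And>l. l \<in> F \<Longrightarrow> riesz_radius D A l (r l)" by metis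
  have P_apply: "P x = (\<Sum>l\<in>F. ?P l x)" for x by (simp add: P_def blinfun.sum_left)
  have P_idem: "P (P x) = P x" for x
  proof -
    have "P (P x) = (\<Sum>m\<in>F. \<Sum>l\<in>F. ?P l (?P m x))" by (simp add: P_apply blinfun.sum_right)
    also have "\<dots> = (\<Sum>m\<in>F. \<Sum>l\<in>F. if l = m then ?P m x else 0)"
      by (intro sum.cong refl riesz_projection_product[OF lin_A r r])
    also have "\<dots> = P x" using F(1) by (simp add: P_apply)
    finally show ?thesis .
  qed
  have P_app: "approximable P"
    unfolding P_def using F by (intro approximable_sum riesz_approximable) auto
  have P_clin: "clin P" by (rule approximable_clin[OF P_app])
  have P_comm: "pert t (P x) = P (pert t x)" if t: "t \<ge> 0" for t x
    unfolding P_apply blinfun.sum_right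
    by (intro sum.cong refl riesz_projection_commute[OF lin_A r] clin_pert[OF t] pert_resolvent[OF t])
  have P_eigen: "P v = v" if v: "v \<in> D" "A v = l *\<^sub>C v" and l: "l \<in> F" for v l
  proof -
    have "P v = (\<Sum>m\<in>F. if m = l then v else 0)"
      unfolding P_apply by (intro sum.cong refl riesz_projection_eigenvector[OF lin_A r v])
    then show ?thesis using F(1) l by simp
  qed
  define Q where "Q = id_blinfun - P"
  have Q_apply: "Q x = x - P x" for x by (simp add: Q_def blinfun.diff_left)
  have Q_clin: "clin Q" unfolding Q_def by (intro clin_intros P_clin)
  have Q_idem: "Q (Q x) = Q x" for x by (simp add: Q_apply blinfun.diff_right P_idem)
  have Q_comm: "pert t (Q x) = Q (pert t x)" if "t \<ge> 0" for t x
    by (simp add: Q_apply blinfun.diff_right P_comm[OF that])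
  let ?T = "pert 1 o\<^sub>L Q"
  have T_clin: "clin ?T" by (intro clin_intros clin_pert Q_clin) simp
  \<comment> \<open>Both terms are compact, the second because \<open>P\<close> is a finite sum of
    compact projections.\<close>
  have diff: "?T - S 1 = (pert 1 - S 1) - (pert 1 o\<^sub>L P)"
    by (rule blinfun_eqI) (simp add: blinfun.diff_left Q_apply blinfun.diff_right)
  have T_app: "approximable (?T - S 1)"
    unfolding diff by (intro approximable_diff pert_approximable approximable_compose_left clin_pert P_app) auto
  have "\<mu> \<in> resolvent_set UNIV (blinfun_apply ?T)" if \<mu>: "norm \<mu> \<ge> exp \<omega>" for \<mu>
  proof (rule ccontr)
    assume "\<mu> \<notin> resolvent_set UNIV (blinfun_apply ?T)"
    then have "\<mu> \<in> spectrum UNIV (blinfun_apply ?T)" by (simp add: spectrum_def)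
    moreover have "norm \<mu> > exp (b * 1)" using \<mu> \<omega>(1) by (smt (verit) exp_less_mono mult.right_neutral)
    ultimately obtain u where u: "u \<noteq> 0" "?T u = \<mu> *\<^sub>C u"
      using compactly_perturbed_eigenvalue[OF _ T_clin T_app] by auto
    have \<mu>0: "\<mu> \<noteq> 0" using \<mu> by (auto simp: not_le)
    \<comment> \<open>\<open>Q\<close> is a projection commuting with \<open>pert 1\<close>, so an
      eigenvector of \<open>?T\<close> for \<open>\<mu> \<noteq> 0\<close> lies in the range of
      \<open>Q\<close> and is an eigenvector of \<open>pert 1\<close>.\<close>
    have "Q (?T u) = ?T u" by (simp add: Q_idem flip: Q_comm)
    then have "\<mu> *\<^sub>C Q u = \<mu> *\<^sub>C u" by (simp only: u(2) clinD[OF Q_clin])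
    then have Qu: "Q u = u" using \<mu>0 by simp
    then have "pert 1 u = \<mu> *\<^sub>C u" using u(2) by simp
    then obtain l where l: "exp (of_real 1 * l) = \<mu>" "perturbed.Nint l 1 u \<in> D"
      "perturbed.Nint l 1 u \<noteq> 0" "A (perturbed.Nint l 1 u) = l *\<^sub>C perturbed.Nint l 1 u"
      using perturbed.point_spectral_mapping[OF zero_less_one u(1) _ \<mu>0] by blast
    let ?v = "perturbed.Nint l 1 u"
    have "exp (Re l) \<ge> exp \<omega>" using \<mu> l(1) by (metis mult_1 norm_exp_eq_Re of_real_1)
    then have "\<not> Re l < \<omega>" by simp
    moreover have "l \<in> spectrum D A" by (rule eigenvalue_spectrum[OF l(2-4)])
    ultimately have "l \<in> F" using \<omega>(2) by blast
    then have "P ?v = ?v" by (rule P_eigen[OF l(2,4)])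
    \<comment> \<open>\<open>?v\<close> integrates multiples of \<open>pert s u\<close>, all in the
      range of \<open>Q\<close>, so it stays there; being fixed by \<open>P\<close> as well, it
      would be 0.\<close>
    moreover have "Q ?v = ?v"
    proof -
      have "Q ?v = integral {0..1} (\<lambda>s. Q (exp (- l * of_real s) *\<^sub>C pert s u))"
        unfolding perturbed.Nint_def by (rule integral_blinfun_apply[symmetric]) (rule perturbed.Nint_integrable)
      also have "\<dots> = ?v"
        unfolding perturbed.Nint_def
        by (intro integral_cong) (simp add: clinD[OF Q_clin] Qu flip: Q_comm)
      finally show ?thesis .
    qed
    ultimately show False using l(3) by (simp add: Q_apply)
  qed
  from power_bound[OF T_clin exp_gt_zero[of \<omega>] this] obtain c where c: "c \<ge> 0"
    "\<And>n x. norm ((blinfun_apply ?T ^^ n) x) \<le> c * exp \<omega> ^ n * norm x" by metis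
  have iter: "(blinfun_apply ?T ^^ n) (Q u) = pert (real n) (Q u)" for n u
  proof (induction n)
    case 0
    then show ?case by simp
  next
    case (Suc n)
    have "(blinfun_apply ?T ^^ Suc n) (Q u) = pert 1 (Q (pert (real n) (Q u)))"
      by (simp only: funpow.simps o_apply Suc blinfun_apply_blinfun_compose)
    also have "Q (pert (real n) (Q u)) = pert (real n) (Q u)" by (simp add: Q_idem flip: Q_comm)
    also have "pert 1 (pert (real n) (Q u)) = pert (real (Suc n)) (Q u)"
      using perturbed.S_add[of 1 "real n" "Q u"] by simp
    finally show ?case .
  qed
  \<comment> \<open>Factors: a bound for the fractional part of \<open>t\<close>, the constant of
    the powers, and the loss in replacing the integer part by \<open>t\<close>.\<close>
  define c' where "c' = 2 * C * exp \<bar>rate\<bar> * c * exp \<bar>\<omega>\<bar>"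
  have c': "c' \<ge> 0" using c(1) C_nonneg by (simp add: c'_def)
  have "norm (pert t (Q u)) \<le> c' * exp (\<omega> * t) * norm (Q u)" if t: "t \<ge> 0" for t u
  proof -
    define n where "n = nat \<lfloor>t\<rfloor>"
    define s where "s = t - real n"
    have s: "s \<ge> 0" "s \<le> 1" using t by (simp_all add: s_def n_def) linarith
    have "pert t (Q u) = pert s (pert (real n) (Q u))"
      using perturbed.S_add[of s "real n" "Q u"] s by (simp add: s_def)
    then have "norm (pert t (Q u)) \<le> norm (pert s) * norm (pert (real n) (Q u))"
      by (simp add: norm_blinfun)
    also have "\<dots> \<le> (2 * C * exp \<bar>rate\<bar>) * (c * exp \<omega> ^ n * norm (Q u))"
    proof (rule mult_mono)
      have "norm (pert s) \<le> 2 * C * exp (rate * s)" by (rule norm_pert[OF s(1)])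
      also have "rate * s \<le> \<bar>rate\<bar>"
        using s by (metis abs_ge_self abs_mult abs_of_nonneg mult_left_le abs_ge_zero order_trans)
      then have "2 * C * exp (rate * s) \<le> 2 * C * exp \<bar>rate\<bar>"
        using C_nonneg by (simp add: mult_left_mono)
      finally show "norm (pert s) \<le> 2 * C * exp \<bar>rate\<bar>" .
      show "norm (pert (real n) (Q u)) \<le> c * exp \<omega> ^ n * norm (Q u)"
        using c(2)[of n "Q u"] by (simp add: iter)
    qed (use C_nonneg in auto)
    \<comment> \<open>\<open>\<omega>\<close> may be negative, so passing from \<open>n\<close> to
      \<open>t\<close> costs the factor \<open>exp \<bar>\<omega>\<bar>\<close>.\<close>
    also have "exp \<omega> ^ n \<le> exp \<bar>\<omega>\<bar> * exp (\<omega> * t)"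
    proof -
      have "- (\<omega> * s) \<le> \<bar>\<omega>\<bar>"
        using s by (metis abs_ge_minus_self abs_ge_zero abs_mult abs_of_nonneg mult_left_le order_trans)
      then have "real n * \<omega> \<le> \<bar>\<omega>\<bar> + \<omega> * t" by (simp add: s_def algebra_simps)
      then show ?thesis by (simp flip: exp_add exp_of_nat_mult)
    qed
    then have "(2 * C * exp \<bar>rate\<bar>) * (c * exp \<omega> ^ n * norm (Q u))
        \<le> (2 * C * exp \<bar>rate\<bar>) * (c * (exp \<bar>\<omega>\<bar> * exp (\<omega> * t)) * norm (Q u))"
      using C_nonneg c(1) by (intro mult_left_mono mult_right_mono) auto
    finally show ?thesis by (simp add: c'_def mult_ac)
  qed
  note bound = this
  show ?thesis
  proof (intro exI[of _ "max 1 c'"] conjI allI impI)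
    fix u and t :: real assume "t \<ge> 0"
    then have "norm (pert t (Q u)) \<le> c' * (exp (\<omega> * t) * norm (Q u))"
      using bound[of t u] by (simp add: mult.assoc)
    also have "\<dots> \<le> max 1 c' * (exp (\<omega> * t) * norm (Q u))"
      by (rule mult_right_mono) auto
    finally show "norm (pert t (u - P u)) \<le> max 1 c' * exp (\<omega> * t) * norm (u - P u)"
      by (simp add: Q_apply mult.assoc)
  qed simp
qed

lemma spectral_mapping:
  assumes \<epsilon>: "\<epsilon> > 0" and t: "t > 0"
  shows "spectrum UNIV (blinfun_apply (pert t)) - ball 0 (exp (t * (b + \<epsilon>)))
    = (\<lambda>z. exp (complex_of_real t * z)) ` (spectrum D A \<inter> {z. Re z \<ge> b + \<epsilon>})"
proof (intro set_eqI iffI)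
  fix \<mu> assume "\<mu> \<in> spectrum UNIV (blinfun_apply (pert t)) - ball 0 (exp (t * (b + \<epsilon>)))"
  then have \<mu>: "\<mu> \<in> spectrum UNIV (blinfun_apply (pert t))" "norm \<mu> \<ge> exp (t * (b + \<epsilon>))" by auto
  \<comment> \<open>The margin \<open>\<epsilon>\<close> puts the complement of the open disc
    strictly outside radius \<open>exp (b * t)\<close>, where the Fredholm argument applies.\<close>
  have "b * t < t * (b + \<epsilon>)" using t \<epsilon> by (simp add: algebra_simps)
  then have big: "norm \<mu> > exp (b * t)" using \<mu>(2) by (meson exp_less_mono less_le_trans)
  have \<mu>0: "\<mu> \<noteq> 0" using big by (auto simp: not_less[symmetric])
  have t0: "t \<ge> 0" using t by simp
  obtain u where u: "u \<noteq> 0" "pert t u = \<mu> *\<^sub>C u"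
    using compactly_perturbed_eigenvalue[OF t0 clin_pert[OF t0] pert_approximable[OF t0] big \<mu>(1)] by blast
  obtain l where l: "exp (of_real t * l) = \<mu>" "perturbed.Nint l t u \<in> D"
    "perturbed.Nint l t u \<noteq> 0" "A (perturbed.Nint l t u) = l *\<^sub>C perturbed.Nint l t u"
    using perturbed.point_spectral_mapping[OF t u \<mu>0] by blast
  have "norm \<mu> = exp (t * Re l)" by (simp flip: l(1))
  then have "b + \<epsilon> \<le> Re l" using \<mu>(2) t by simp
  then show "\<mu> \<in> (\<lambda>z. exp (complex_of_real t * z)) ` (spectrum D A \<inter> {z. Re z \<ge> b + \<epsilon>})"
    using l(1) eigenvalue_spectrum[OF l(2-4)] by (intro image_eqI[of _ _ l]) auto
next
  fix \<mu> assume "\<mu> \<in> (\<lambda>z. exp (complex_of_real t * z)) ` (spectrum D A \<inter> {z. Re z \<ge> b + \<epsilon>})"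
  then obtain l where l: "\<mu> = exp (complex_of_real t * l)" "l \<in> spectrum D A" "Re l \<ge> b + \<epsilon>" by auto
  have t0: "t \<ge> 0" using t by simp
  obtain v where v: "v \<in> D" "v \<noteq> 0" "A v = l *\<^sub>C v"
    using spectrum_eigenvalue[OF l(2)] l(3) \<epsilon> by (auto simp: eigenvalue_def)
  have Tv: "pert t v = \<mu> *\<^sub>C v"
    using perturbed.eigenvector_S[OF v(1,3) t0] by (simp add: l(1) mult.commute)
  have "\<mu> \<in> spectrum UNIV (blinfun_apply (pert t))"
  proof (rule ccontr)
    assume "\<mu> \<notin> spectrum UNIV (blinfun_apply (pert t))"
    then have "\<mu> \<in> resolvent_set UNIV (blinfun_apply (pert t))" by (simp add: spectrum_def)
    from resolvent_eigenvector[OF linear_operator_UNIV[OF clin_pert[OF t0]] this UNIV_I Tv] v(2)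
    show False by simp
  qed
  moreover have "norm \<mu> \<ge> exp (t * (b + \<epsilon>))" using l t by simp
  ultimately show "\<mu> \<in> spectrum UNIV (blinfun_apply (pert t)) - ball 0 (exp (t * (b + \<epsilon>)))" by simp
qed

end

text \<open>Isolation accompanies the eigenvalue claim because the Riesz projections, and with them
  the multiplicities, are meaningful at isolated points. The supremum is formed in
  \<open>ereal\<close>, where it is -\<infinity> over the empty set.\<close>

theorem theoremB1:
  fixes D :: "'a::chilbert_space set"
    and L0 L' :: "'a \<Rightarrow> 'a"
    and S0 :: "real \<Rightarrow> 'a \<Rightarrow>\<^sub>L 'a"
    and M \<omega>0 :: real
  assumes "closed_operator D L0"
    and "generates D L0 S0"
    and "M > 0"
    and "\<And>u \<tau>. \<tau> \<ge> 0 \<Longrightarrow> norm (S0 \<tau> u) \<le> M * exp (\<omega>0 * \<tau>) * norm u"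
    and "compact_operator L'"
  defines "L \<equiv> \<lambda>u. L0 u + L' u"
  shows "\<exists>S. generates D L S \<and>
    (\<forall>\<epsilon>>0.
      let S\<^sub>\<epsilon> = spectrum D L \<inter> {z. Re z \<ge> \<omega>0 + \<epsilon>};
          P = (\<Sum>z\<in>S\<^sub>\<epsilon>. riesz_projection D L z);
          r\<^sub>\<epsilon> = (SUP z\<in>spectrum D L - S\<^sub>\<epsilon>. ereal (Re z))
      in
        (finite S\<^sub>\<epsilon> \<and>
         (\<forall>z\<in>S\<^sub>\<epsilon>. eigenvalue D L z \<and> z isolated_in spectrum D L \<and>
                  algebraic_multiplicity D L z < \<infinity>)) \<and>
        (\<forall>\<tau>>0. spectrum UNIV (blinfun_apply (S \<tau>)) - ball 0 (exp (\<tau> * (\<omega>0 + \<epsilon>)))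
               = (\<lambda>z. exp (complex_of_real \<tau> * z)) ` S\<^sub>\<epsilon>) \<and>
        (\<forall>\<omega>. ereal \<omega> > max (ereal \<omega>0) r\<^sub>\<epsilon> \<longrightarrow>
           (\<exists>C\<ge>1. \<forall>u. \<forall>\<tau>\<ge>0.
              norm (S \<tau> (u - P u)) \<le> C * exp (\<omega> * \<tau>) * norm (u - P u))))"
proof -
  obtain K where K: "clin K" "blinfun_apply K = L'" "approximable K"
    "\<And>X. bounded X \<Longrightarrow> compact (closure (K ` X))"
    using compact_operatorE[OF assms(5)] by metis
  have "norm (S0 t) \<le> M * exp (\<omega>0 * t)" if "t \<ge> 0" for t
    using assms(3,4) that by (intro norm_blinfun_bound) auto
  then interpret compactly_perturbed_generator S0 M \<omega>0 K D L0
    using assms(1,2) K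
    by unfold_locales (auto simp: closed_operator_def generates_def)
  have L: "L = A" by (rule ext) (simp add: L_def A_def K(2))
  show ?thesis
    unfolding L Let_def
  proof (intro exI[of _ pert] conjI allI impI perturbed.gen ballI)
    fix \<epsilon> :: real assume \<epsilon>: "\<epsilon> > 0"
    show "finite (spectrum D A \<inter> {z. \<omega>0 + \<epsilon> \<le> Re z})"
      by (rule finite_spectrum_halfplane[OF \<epsilon>])
    fix z assume "z \<in> spectrum D A \<inter> {z. \<omega>0 + \<epsilon> \<le> Re z}"
    then have z: "z \<in> spectrum D A" "Re z > \<omega>0" using \<epsilon> by auto
    show "eigenvalue D A z" by (rule spectrum_eigenvalue[OF z])
    show "z isolated_in spectrum D A" by (rule spectrum_isolated[OF z])
    show "algebraic_multiplicity D A z < \<infinity>" by (rule finite_multiplicity[OF z])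
  next
    fix \<epsilon> \<tau> :: real assume "\<epsilon> > 0" "\<tau> > 0"
    then show "spectrum UNIV (blinfun_apply (pert \<tau>)) - ball 0 (exp (\<tau> * (\<omega>0 + \<epsilon>)))
        = (\<lambda>z. exp (complex_of_real \<tau> * z)) ` (spectrum D A \<inter> {z. \<omega>0 + \<epsilon> \<le> Re z})"
      by (rule spectral_mapping)
  next
    fix \<epsilon> \<omega> :: real
    let ?F = "spectrum D A \<inter> {z. \<omega>0 + \<epsilon> \<le> Re z}"
    assume \<epsilon>: "\<epsilon> > 0" and \<omega>: "max (ereal \<omega>0) (SUP z\<in>spectrum D A - ?F. ereal (Re z)) < ereal \<omega>"
    show "\<exists>c\<ge>1. \<forall>u. \<forall>\<tau>\<ge>0. norm (pert \<tau> (u - (\<Sum>z\<in>?F. riesz_projection D A z) u))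
        \<le> c * exp (\<omega> * \<tau>) * norm (u - (\<Sum>z\<in>?F. riesz_projection D A z) u)"
    proof (rule complementary_growth_bound)
      show "finite ?F" by (rule finite_spectrum_halfplane[OF \<epsilon>])
      show "\<omega>0 < \<omega>" using \<omega> by simp
      fix l assume "l \<in> spectrum D A - ?F"
      then have "ereal (Re l) \<le> (SUP z\<in>spectrum D A - ?F. ereal (Re z))" by (rule SUP_upper)
      also have "\<dots> < ereal \<omega>" using \<omega> by simp
      finally show "Re l < \<omega>" by simp
    qed (use \<epsilon> in auto)
  qed
qed

end
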